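(* Let $n$ be a sample size, let $\mathcal M_n$ be a finite and non-empty collection of models $m$, each satisfying $|m|<n-1$, and let $r_n=\sup_{m\in\mathcal M_n}|m|/n$. Then for each $\epsilon>0$ and each finite $c>0$, $$\sup_{\beta,\sigma,\Sigma:\ \mathrm{Var}_{\beta,\sigma,\Sigma}[y]\le c}P_{n,\beta,\sigma,\Sigma}\left(\sup_{m\in\mathcal M_n}|\hat\rho^2(m)-\rho^2(m)|>\epsilon\right)\;\le\;4\,\#\mathcal M_n\,\exp\left[-n(1-r_n)\,\Psi\left(\frac{\epsilon}{2c}(1-r_n)\right)\right],$$ where the outer supremum is over all parameters $\beta,\sigma,\Sigma$ of the Gaussian linear model described in the context with $\mathrm{Var}_{\beta,\sigma,\Sigma}[y]\le c$, $\#\mathcal M_n$ is the number of models in $\mathcal M_n$, and $\Psi(x)=\frac18\left(\frac{x}{x+1}\right)^2$ for $x\ge0$.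
   Context: Model. A response $y$ satisfies $y=\sum_{j=1}^\infty x_j\beta_j+u$, where $\beta=(\beta_j)_{j\ge1}$ is a real sequence; $u$ has mean zero and variance $\sigma^2\ge0$; the random sequence $x=(x_j)_{j\ge1}$ has mean zero and covariances $\Sigma=[E(x_ix_j)]_{i,j\ge1}$; the series converges in squared mean; each $x_j$ is uncorrelated with $u$; and for all $k\ge1$ and $j_1<\dots<j_k$ the covariance matrix of $(x_{j_1},\dots,x_{j_k})'$ is positive definite. All these random variables ($y$, $u$ and $x_j$, $j\ge1$) are assumed jointly Gaussian. Sample. $(Y,X)$ consists of $n$ i.i.d. copies $(y^{(i)},x^{(i)})$, $i=1,\dots,n$, of $(y,x)$; $P_{n,\beta,\sigma,\Sigma}$ and $E_{n,\beta,\sigma,\Sigma}$ denote the corresponding probability and expectation. $\mathrm{Var}_{\beta,\sigma,\Sigma}[y]$ is the variance of $y$. Models. A model is a 0-1 sequence $m=(m_j)_{j\ge1}$, with $|m|$ the number of ones in $m$ ($|m|=0$ is allowed). The restricted least-squares estimator $\tilde\beta(m)$ has $j$th component zero whenever $m_j=0$; its remaining $|m|$ components are obtained by least-squares regression of $Y=(y^{(1)},\dots,y^{(n)})'$ on the corresponding columns of $X$. The residual sum of squares is $\mathrm{RSS}(m)=\sum_{i=1}^n\bigl(y^{(i)}-x^{(i)\prime}\tilde\beta(m)\bigr)^2$. Prediction error. Let $(y^{(f)},x^{(f)})$ be a copy of $(y,x)$ independent of $(Y,X)$. The conditional mean squared prediction error is $\rho^2(m)=E_{n,\beta,\sigma,\Sigma}\bigl[(y^{(f)}-x^{(f)\prime}\tilde\beta(m))^2\mid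 Y,X\bigr]$. Estimator. $\hat\rho^2(m)=\dfrac{\mathrm{RSS}(m)}{n-|m|}\cdot\dfrac{n+1}{n+1-|m|}$. *)

theory Defs
  imports "HOL-Probability.Probability"
begin

text \<open>A real random variable is Gaussian if its law is a normal distribution; the degenerate
  case of variance zero is included, since \<open>\<sigma> = 0\<close> is allowed below.\<close>

definition gaussian_rv :: "'a measure \<Rightarrow> ('a \<Rightarrow> real) \<Rightarrow> bool" where
  "gaussian_rv M Z \<longleftrightarrow> Z \<in> borel_measurable M \<and>
     (\<exists>\<mu> s. (s = 0 \<and> distr M borel Z = return borel \<mu>) \<or>
            (s > 0 \<and> distr M borel Z = density lborel (normal_density \<mu> s)))"

text \<open>The Gaussian linear model on an arbitrary probability space. Sequences are indexed from \<open>0\<close>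
  instead of \<open>1\<close>. The mean-square limit is stated with the nonnegative integral, so
  that it carries its own integrability. Joint Gaussianity of the whole family means that every
  finite linear combination is Gaussian.\<close>

locale gaussian_linear_model = prob_space M for M :: "'a measure" +
  fixes y u :: "'a \<Rightarrow> real" and x :: "nat \<Rightarrow> 'a \<Rightarrow> real"
    and \<beta> :: "nat \<Rightarrow> real" and \<sigma> :: real and \<Sigma> :: "nat \<Rightarrow> nat \<Rightarrow> real"
  assumes u_square_integrable: "integrable M (\<lambda>\<omega>. (u \<omega>)\<^sup>2)"
    and x_square_integrable: "\<And>j. integrable M (\<lambda>\<omega>. (x j \<omega>)\<^sup>2)"
    and sigma_nonneg: "0 \<le> \<sigma>"
    and u_mean: "expectation u = 0"
    and u_variance: "variance u = \<sigma>\<^sup>2"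
    and x_mean: "\<And>j. expectation (x j) = 0"
    and x_cov: "\<And>i j. expectation (\<lambda>\<omega>. x i \<omega> * x j \<omega>) = \<Sigma> i j"
    and x_u_uncorrelated: "\<And>j. expectation (\<lambda>\<omega>. x j \<omega> * u \<omega>) = 0"
    and series_mean_square:
      "(\<lambda>k. \<integral>\<^sup>+ \<omega>. ennreal ((y \<omega> - u \<omega> - (\<Sum>j<k. x j \<omega> * \<beta> j))\<^sup>2) \<partial>M) \<longlonglongrightarrow> 0"
    and cov_positive_definite:
      "\<And>J c. finite J \<Longrightarrow> \<exists>j\<in>J. c j \<noteq> 0 \<Longrightarrow> 0 < (\<Sum>i\<in>J. \<Sum>j\<in>J. c i * c j * \<Sigma> i j)"
    and jointly_gaussian:
      "\<And>a b c J. finite J \<Longrightarrow> gaussian_rv M (\<lambda>\<omega>. a * y \<omega> + b * u \<omega> + (\<Sum>j\<in>J. c j * x j \<omega>))"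

text \<open>All quantities of interest depend on the model only through the law of \<open>(y, u, x)\<close>, so the
  model is realised on the space of values of this triple, with the coordinate maps as random
  variables. The parameters determine the (centred Gaussian) law uniquely, hence the choice in
  \<open>model_law\<close> is immaterial; a triple of parameters is admissible if the model exists for it.\<close>

type_synonym parameters = "(nat \<Rightarrow> real) \<times> real \<times> (nat \<Rightarrow> nat \<Rightarrow> real)"

definition triple_space :: "(real \<times> real \<times> (nat \<Rightarrow> real)) measure" where
  "triple_space = borel \<Otimes>\<^sub>M (borel \<Otimes>\<^sub>M (\<Pi>\<^sub>M j\<in>UNIV. borel))"

definition is_model_law :: "parameters \<Rightarrow> (real \<times> real \<times> (nat \<Rightarrow> real)) measure \<Rightarrow> bool" where
  "is_model_law = (\<lambda>(\<beta>, \<sigma>, \<Sigma>) L. sets L = sets triple_space \<and>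
     gaussian_linear_model L (\<lambda>(y, u, x). y) (\<lambda>(y, u, x). u) (\<lambda>j (y, u, x). x j) \<beta> \<sigma> \<Sigma>)"

definition admissible :: "parameters set" where
  "admissible = {\<theta>. \<exists>L. is_model_law \<theta> L}"

definition model_law :: "parameters \<Rightarrow> (real \<times> real \<times> (nat \<Rightarrow> real)) measure" where
  "model_law \<theta> = (SOME L. is_model_law \<theta> L)"

lemma (in gaussian_linear_model) rv_measurable:
  "y \<in> borel_measurable M" "u \<in> borel_measurable M" "x j \<in> borel_measurable M"
  using jointly_gaussian[of "{}" 1 0] jointly_gaussian[of "{}" 0 1]
    jointly_gaussian[of "{j}" 0 0 "\<lambda>_. 1"]
  by (simp_all add: gaussian_rv_def)

text \<open>Any realisation of the model, on whatever probability space, induces a model law.\<close>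

lemma (in gaussian_linear_model) is_model_law_distr:
  "is_model_law (\<beta>, \<sigma>, \<Sigma>) (distr M triple_space (\<lambda>\<omega>. (y \<omega>, u \<omega>, \<lambda>j. x j \<omega>)))"
proof -
  let ?f = "\<lambda>\<omega>. (y \<omega>, u \<omega>, \<lambda>j. x j \<omega>)"
  let ?L = "distr M triple_space ?f"
  note rv_measurable [measurable]
  have f [measurable]: "?f \<in> M \<rightarrow>\<^sub>M triple_space"
    unfolding triple_space_def by (intro measurable_Pair measurable_PiM_single') auto
  have Y [measurable]: "(\<lambda>(y, u, x). y) \<in> borel_measurable triple_space"
    and U [measurable]: "(\<lambda>(y, u, x). u) \<in> borel_measurable triple_space"
    and X [measurable]: "(\<lambda>(y, u, x). x j) \<in> borel_measurable triple_space" for j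
    unfolding triple_space_def by measurable
  note YUX = Y[unfolded case_prod_beta] U[unfolded case_prod_beta] X[unfolded case_prod_beta]
  note [measurable] = YUX
  interpret L: prob_space ?L
    by (rule prob_space_distr) simp
  have gaussian: "gaussian_rv ?L Z" if "Z \<in> borel_measurable triple_space" "gaussian_rv M (\<lambda>\<omega>. Z (?f \<omega>))" for Z
    using that unfolding gaussian_rv_def by (simp add: distr_distr comp_def)
  have "gaussian_linear_model ?L (\<lambda>(y, u, x). y) (\<lambda>(y, u, x). u) (\<lambda>j (y, u, x). x j) \<beta> \<sigma> \<Sigma>"
  proof unfold_locales
    show "integrable ?L (\<lambda>\<omega>. ((\<lambda>(y, u, x). u) \<omega>)\<^sup>2)"
      using u_square_integrable by (subst integrable_distr_eq) (auto simp: case_prod_beta)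
    show "integrable ?L (\<lambda>\<omega>. ((\<lambda>(y, u, x). x j) \<omega>)\<^sup>2)" for j
      using x_square_integrable by (subst integrable_distr_eq) (auto simp: case_prod_beta)
    show "0 \<le> \<sigma>" by (rule sigma_nonneg)
    show u0: "L.expectation (\<lambda>(y, u, x). u) = 0"
      using u_mean by (subst integral_distr) (auto simp: case_prod_beta)
    show "L.variance (\<lambda>(y, u, x). u) = \<sigma>\<^sup>2"
      unfolding u0 using u_variance u_mean
      by (subst integral_distr) (auto simp: case_prod_beta)
    show "L.expectation (\<lambda>(y, u, x). x j) = 0" for j
      using x_mean by (subst integral_distr) (auto simp: case_prod_beta)
    show "L.expectation (\<lambda>\<omega>. (case \<omega> of (y, u, x) \<Rightarrow> x i) * (case \<omega> of (y, u, x) \<Rightarrow> x j)) = \<Sigma> i j" for i j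
      using x_cov by (subst integral_distr) (auto simp: case_prod_beta)
    show "L.expectation (\<lambda>\<omega>. (case \<omega> of (y, u, x) \<Rightarrow> x j) * (case \<omega> of (y, u, x) \<Rightarrow> u)) = 0" for j
      using x_u_uncorrelated by (subst integral_distr) (auto simp: case_prod_beta)
    show "(\<lambda>k. \<integral>\<^sup>+ \<omega>. ennreal (((case \<omega> of (y, u, x) \<Rightarrow> y) - (case \<omega> of (y, u, x) \<Rightarrow> u)
        - (\<Sum>j<k. (case \<omega> of (y, u, x) \<Rightarrow> x j) * \<beta> j))\<^sup>2) \<partial>?L) \<longlonglongrightarrow> 0"
      using series_mean_square by (subst nn_integral_distr) (auto simp: case_prod_beta)
    show "0 < (\<Sum>i\<in>J. \<Sum>j\<in>J. c i * c j * \<Sigma> i j)"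
      if "finite J" "\<exists>j\<in>J. c j \<noteq> 0" for J c
      using that by (rule cov_positive_definite)
    show "gaussian_rv ?L (\<lambda>\<omega>. a * (case \<omega> of (y, u, x) \<Rightarrow> y) + b * (case \<omega> of (y, u, x) \<Rightarrow> u)
        + (\<Sum>j\<in>J. c j * (case \<omega> of (y, u, x) \<Rightarrow> x j)))" if "finite J" for a b c J
      using jointly_gaussian[OF that, of a b c] by (intro gaussian) (auto simp: case_prod_beta)
  qed
  then show ?thesis
    by (simp add: is_model_law_def)
qed

text \<open>The response has law \<open>obs_law\<close> jointly with the regressors; the error \<open>u\<close> is unobserved.\<close>

definition obs_law :: "parameters \<Rightarrow> (real \<times> (nat \<Rightarrow> real)) measure" where
  "obs_law \<theta> = distr (model_law \<theta>) (borel \<Otimes>\<^sub>M (\<Pi>\<^sub>M j\<in>UNIV. borel)) (\<lambda>(y, u, x). (y, x))"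

definition var_y :: "parameters \<Rightarrow> real" where
  "var_y \<theta> = (\<integral>\<omega>. (fst \<omega> - (\<integral>\<omega>'. fst \<omega>' \<partial>model_law \<theta>))\<^sup>2 \<partial>model_law \<theta>)"

text \<open>The two lemmas below show that for every \<open>c > 0\<close> there are admissible parameters with
  \<open>var_y \<theta> \<le> c\<close>, so a supremum over these parameters is not taken over the empty set.\<close>

lemma standard_model:
  "gaussian_linear_model (PiM UNIV (\<lambda>_::nat. density lborel std_normal_density))
     (\<lambda>_. 0) (\<lambda>_. 0) (\<lambda>j \<omega>. \<omega> j) (\<lambda>_. 0) 0 (\<lambda>i j. if i = j then 1 else 0)"
proof -
  let ?N = "density lborel (\<lambda>t. ennreal (std_normal_density t))"
  let ?M = "PiM UNIV (\<lambda>_::nat. ?N)"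
  interpret N: prob_space ?N by (rule prob_space_normal_density) simp
  interpret product_prob_space "\<lambda>_::nat. ?N" UNIV by unfold_locales
  have dist: "distr ?M borel (\<lambda>\<omega>. \<omega> j) = ?N" for j
  proof -
    have "distr ?M borel (\<lambda>\<omega>. \<omega> j) = distr ?M ?N (\<lambda>\<omega>. \<omega> j)" by (rule distr_cong) auto
    then show ?thesis using PiM_component[of j] by simp
  qed
  have m[measurable]: "(\<lambda>\<omega>. \<omega> j) \<in> borel_measurable ?M" for j
    by (rule measurable_component_singleton[of j UNIV "\<lambda>_. ?N", simplified measurable_cong_sets[OF refl sets_density] measurable_lborel1]) auto
  have D: "distributed ?M lborel (\<lambda>\<omega>. \<omega> j) std_normal_density" for j
    unfolding distributed_def using dist[of j] m[of j]
    by (auto cong: distr_cong)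
  have ind: "P.indep_vars (\<lambda>_. borel) (\<lambda>j \<omega>. \<omega> j) UNIV"
  proof (subst P.indep_vars_iff_distr_eq_PiM')
    show "distr ?M (PiM UNIV (\<lambda>_. borel)) (\<lambda>x. \<lambda>i\<in>UNIV. x i) = (\<Pi>\<^sub>M i\<in>UNIV. distr ?M borel (\<lambda>\<omega>. \<omega> i))"
      unfolding dist by (auto simp: restrict_def intro!: distr_cong[THEN trans, OF refl _ _ distr_id] sets_PiM_cong)
  qed auto
  have sq: "integrable ?M (\<lambda>\<omega>. (\<omega> j)\<^sup>2)" for j
    by (subst distributed_integrable[OF D, symmetric]) (auto simp: integrable_std_normal_moment)
  have i1: "integrable ?M (\<lambda>\<omega>. \<omega> j)" for j
    using distributed_integrable[OF D[of j], of "\<lambda>t. t"] integrable_std_normal_moment[of 1] by simp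
  have e: "P.expectation (\<lambda>\<omega>. \<omega> j) = 0" for j
    by (rule P.standard_normal_distributed_expectation[OF D])
  show ?thesis
  proof unfold_locales
    show "P.expectation (\<lambda>\<omega>. \<omega> i * \<omega> j) = (if i = j then 1 else 0)" for i j
    proof (cases "i = j")
      case True
      then show ?thesis using P.standard_normal_distributed_variance[OF D, of j]
        unfolding e by (simp add: power2_eq_square)
    next
      case False
      have "P.indep_vars (\<lambda>_. borel) (\<lambda>j \<omega>. \<omega> j) {i, j}"
        by (rule P.indep_vars_subset[OF ind]) auto
      from P.indep_vars_lebesgue_integral[OF _ this i1] False e show ?thesis by simp
    qed
    show "0 < (\<Sum>i\<in>J. \<Sum>j\<in>J. c i * c j * (if i = j then 1 else 0))"
      if "finite J" "\<exists>j\<in>J. c j \<noteq> 0" for J and c :: "nat \<Rightarrow> real"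
    proof -
      have "(\<Sum>i\<in>J. \<Sum>j\<in>J. c i * c j * (if i = j then 1 else 0)) = (\<Sum>i\<in>J. (c i)\<^sup>2)"
        using that by (intro sum.cong) (auto simp: if_distrib power2_eq_square cong: if_cong)
      also have "\<dots> > 0" using that by (auto intro!: sum_pos2)
      finally show ?thesis .
    qed
    show "gaussian_rv ?M (\<lambda>\<omega>. a * 0 + b * 0 + (\<Sum>j\<in>J. c j * \<omega> j))"
      if J: "finite J" for a b :: real and c J
    proof (cases "\<exists>j\<in>J. c j \<noteq> 0")
      case False
      then have "(\<lambda>\<omega>. a * 0 + b * 0 + (\<Sum>j\<in>J. c j * \<omega> j)) = (\<lambda>_. 0)"
        by (auto simp: fun_eq_iff intro!: sum.neutral)
      moreover have "distr ?M borel (\<lambda>_. 0) = return borel (0::real)"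
        by (rule P.distr_const) simp
      ultimately show ?thesis unfolding gaussian_rv_def by auto
    next
      case True
      let ?I = "{j \<in> J. c j \<noteq> 0}"
      have eq: "(\<lambda>\<omega>. a * 0 + b * 0 + (\<Sum>j\<in>J. c j * \<omega> j)) = (\<lambda>\<omega>. \<Sum>j\<in>?I. c j * \<omega> j)"
        using J by (auto simp: fun_eq_iff intro!: sum.mono_neutral_right)
      have "P.indep_vars (\<lambda>_. borel) (\<lambda>j \<omega>. c j * \<omega> j) ?I"
        by (rule P.indep_vars_compose2[OF P.indep_vars_subset[OF ind]]) auto
      moreover have "distributed ?M lborel (\<lambda>\<omega>. c j * \<omega> j) (normal_density 0 \<bar>c j\<bar>)" if "c j \<noteq> 0" for j
        using P.normal_density_affine[OF D, of "c j" 0] that by simp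
      ultimately have "distributed ?M lborel (\<lambda>\<omega>. \<Sum>j\<in>?I. c j * \<omega> j)
          (normal_density (\<Sum>j\<in>?I. 0) (sqrt (\<Sum>j\<in>?I. \<bar>c j\<bar>\<^sup>2)))"
        using J True by (intro P.sum_indep_normal) auto
      moreover have "(\<Sum>j\<in>?I. \<bar>c j\<bar>\<^sup>2) > 0"
        using J True by (intro sum_pos) auto
      ultimately show ?thesis unfolding eq gaussian_rv_def distributed_def
        by (intro conjI exI[of _ 0] exI[of _ "sqrt (\<Sum>j\<in>?I. (c j)\<^sup>2)"]) (auto cong: distr_cong)
    qed
  qed (use sq e in auto)
qed

lemma admissible_standard:
  defines "\<theta> \<equiv> (\<lambda>_. 0, 0, \<lambda>i j. if i = j then 1 else 0) :: parameters"
  shows "\<theta> \<in> admissible" "var_y \<theta> = 0"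
proof -
  show adm: "\<theta> \<in> admissible"
    unfolding admissible_def \<theta>_def
    using gaussian_linear_model.is_model_law_distr[OF standard_model] by blast
  then have "is_model_law \<theta> (model_law \<theta>)"
    unfolding admissible_def model_law_def by (auto intro: someI)
  then interpret L: gaussian_linear_model "model_law \<theta>" "\<lambda>(y, u, x). y" "\<lambda>(y, u, x). u"
    "\<lambda>j (y, u, x). x j" "\<lambda>_. 0" 0 "\<lambda>i j. if i = j then 1 else 0"
    by (simp add: is_model_law_def \<theta>_def)
  note L.rv_measurable [measurable]
  have u: "AE \<omega> in model_law \<theta>. (case \<omega> of (y, u, x) \<Rightarrow> u) = 0"
    using L.u_variance integral_nonneg_eq_0_iff_AE[OF L.u_square_integrable]
    unfolding L.u_mean by auto
  have "(\<integral>\<^sup>+ \<omega>. ennreal (((case \<omega> of (y, u, x) \<Rightarrow> y) - (case \<omega> of (y, u, x) \<Rightarrow> u))\<^sup>2) \<partial>model_law \<theta>) = 0"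
    using L.series_mean_square by (simp add: LIMSEQ_const_iff)
  then have "AE \<omega> in model_law \<theta>. (case \<omega> of (y, u, x) \<Rightarrow> y) - (case \<omega> of (y, u, x) \<Rightarrow> u) = 0"
    by (subst (asm) nn_integral_0_iff_AE)
      (use borel_measurable_diff[OF L.rv_measurable(1,2)] in \<open>auto simp: case_prod_beta intro!: borel_measurable_power\<close>)
  with u have y: "AE \<omega> in model_law \<theta>. (case \<omega> of (y, u, x) \<Rightarrow> y) = 0"
    by eventually_elim auto
  then have y: "AE \<omega> in model_law \<theta>. fst \<omega> = 0"
    by (simp add: case_prod_beta)
  have [measurable]: "fst \<in> borel_measurable (model_law \<theta>)"
  proof -
    have "fst = (\<lambda>(y :: real, u :: real, x :: nat \<Rightarrow> real). y)" by (auto simp: fun_eq_iff)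
    with L.rv_measurable(1) show ?thesis by metis
  qed
  have E: "L.expectation fst = 0"
    using y by (subst integral_cong_AE[where g = "\<lambda>_. 0"]) auto
  show "var_y \<theta> = 0"
    unfolding var_y_def E using y by (subst integral_cong_AE[where g = "\<lambda>_. 0"]) auto
qed

text \<open>A sample \<open>d\<close> lists the observations \<open>d i = (y\<^sup>(\<^sup>i\<^sup>), x\<^sup>(\<^sup>i\<^sup>))\<close> for \<open>i < n\<close>. The probability
  \<open>joint_prob n \<theta>\<close> lives on pairs of a sample and an independent future observation.\<close>

type_synonym data = "nat \<Rightarrow> real \<times> (nat \<Rightarrow> real)"

definition sample_law :: "nat \<Rightarrow> parameters \<Rightarrow> data measure" where
  "sample_law n \<theta> = (\<Pi>\<^sub>M i\<in>{..<n}. obs_law \<theta>)"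

definition joint_prob :: "nat \<Rightarrow> parameters \<Rightarrow> (data \<times> (real \<times> (nat \<Rightarrow> real))) measure" where
  "joint_prob n \<theta> = sample_law n \<theta> \<Otimes>\<^sub>M obs_law \<theta>"

text \<open>A model is a 0-1 sequence, with \<open>True\<close> for 1. Note that \<open>model_size\<close> is meaningful only for
  models with finitely many ones.\<close>

type_synonym model = "nat \<Rightarrow> bool"

definition model_size :: "model \<Rightarrow> nat" where
  "model_size m = card {j. m j}"

definition residual :: "model \<Rightarrow> (nat \<Rightarrow> real) \<Rightarrow> real \<times> (nat \<Rightarrow> real) \<Rightarrow> real" where
  "residual m b = (\<lambda>(y, x). y - (\<Sum>j | m j. x j * b j))"

definition is_least_squares :: "nat \<Rightarrow> data \<Rightarrow> model \<Rightarrow> (nat \<Rightarrow> real) \<Rightarrow> bool" where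
  "is_least_squares n d m b \<longleftrightarrow> (\<forall>j. \<not> m j \<longrightarrow> b j = 0) \<and>
     (\<forall>b'. (\<Sum>i<n. (residual m b (d i))\<^sup>2) \<le> (\<Sum>i<n. (residual m b' (d i))\<^sup>2))"

text \<open>For \<open>|m| \<le> n\<close> the least-squares solution is unique with probability one. On the exceptional
  null set the estimator is set to zero, which keeps it measurable.\<close>

definition beta_tilde :: "nat \<Rightarrow> data \<Rightarrow> model \<Rightarrow> nat \<Rightarrow> real" where
  "beta_tilde n d m = (if \<exists>!b. is_least_squares n d m b
                       then THE b. is_least_squares n d m b else (\<lambda>_. 0))"

definition RSS :: "nat \<Rightarrow> data \<Rightarrow> model \<Rightarrow> real" where
  "RSS n d m = (\<Sum>i<n. (residual m (beta_tilde n d m) (d i))\<^sup>2)"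

definition rho2_hat :: "nat \<Rightarrow> data \<Rightarrow> model \<Rightarrow> real" where
  "rho2_hat n d m = RSS n d m / (real n - real (model_size m)) *
                    ((real n + 1) / (real n + 1 - real (model_size m)))"

text \<open>The conditional expectation is taken given the sigma-algebra generated by the sample; as a
  version of a conditional expectation, \<open>rho2\<close> is determined almost surely.\<close>

definition rho2 :: "nat \<Rightarrow> parameters \<Rightarrow> model \<Rightarrow> data \<times> (real \<times> (nat \<Rightarrow> real)) \<Rightarrow> real" where
  "rho2 n \<theta> m = real_cond_exp (joint_prob n \<theta>)
                  (vimage_algebra (space (joint_prob n \<theta>)) fst (sample_law n \<theta>))
                  (\<lambda>(d, f). (residual m (beta_tilde n d m) f)\<^sup>2)"

definition Psi :: "real \<Rightarrow> real" where
  "Psi t = 1 / 8 * (t / (t + 1))\<^sup>2"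

end

theory Submission
  imports Defs
begin

text \<open>
  Fix a model with \<open>p\<close> regressors and replace them by linear combinations \<open>z\<^sub>1, \<dots>, z\<^sub>p\<close> that are orthonormal
  in the population. Then \<open>y = \<Sum> \<eta>\<^sub>k z\<^sub>k + w\<close> with \<open>w\<close> independent of \<open>z\<close> and of variance \<open>s\<^sup>2 \<le> Var y\<close>, so
  for a sample \<open>Z\<close>, \<open>w = s v\<close> with independent standard normal entries,
  \<open>RSS = s\<^sup>2 |res v|\<^sup>2\<close> and \<open>\<rho>\<^sup>2 = s\<^sup>2 (1 + |\<gamma>|\<^sup>2)\<close>, where \<open>\<gamma>\<close> are the coefficients in the regression of \<open>v\<close> on \<open>Z\<close>.
  Here \<open>|res v|\<^sup>2\<close> is chi-square with \<open>n - p\<close> degrees of freedom, and \<open>|\<gamma>|\<^sup>2\<close> behaves like a ratio of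
  independent chi-square variables with \<open>p\<close> and \<open>n + 1 - p\<close> degrees of freedom. The latter is proved by
  adding one column at a time: the coefficient \<open>\<kappa>\<close> of the last column has a Student distribution
  up to scale, and \<open>1 + |\<gamma>|\<^sup>2\<close> factors in law as \<open>1 + \<kappa>\<^sup>2\<close> times an independent copy of \<open>1 + |\<gamma>|\<^sup>2\<close> for the
  previous columns. The test functions \<open>((1 + x) / (\<alpha> + \<beta> x)) powr ((n + 1) / 2)\<close> are stable under this
  recursion and give the Chernoff bounds for \<open>|\<gamma>|\<^sup>2\<close>; both tails of both quantities, at distance
  \<open>\<epsilon> / 2\<close> from the common centre \<open>s\<^sup>2 (n + 1) / (n + 1 - p)\<close>, add up to the factor \<open>4\<close>. Gaussian vectors are
  identified through their characteristic functions, coordinate by coordinate, by Levy's theorem.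
\<close>

section \<open>Product measures and characteristic functions\<close>

text \<open>The squared coefficient norm has only polynomially decaying tails in general, so it has
  no exponential moments and the usual Chernoff bound does not apply to it. The test functions get
  around this. If A and B are independent chi-square variables with p and n + 1 - p degrees of
  freedom, the ratio x = A / B is independent of A + B, and averaging exp(((1 - \<beta>) A + (1 -
  \<alpha>) B) / 2) over A + B for given x leaves ((1 + x) / (\<alpha> + \<beta> x)) powr ((n + 1) /
  2). The test functions are thus the Chernoff exponentials for a comparison of A with a multiple of
  B, written as functions of the ratio alone. Their expectation is computed column by column, so
  neither a Wishart law nor an inverse Gram matrix occurs. Chi-square densities are avoided too: a
  Gaussian weight on a normal vector only rescales the vector, and this determines the law of the
  residual sum of squares. No joint law of the two quantities enters, since their tails are combined
  by a union bound. As 1 + p / (n + 1 - p) = (n + 1) / (n + 1 - p), the second factor of the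
  estimator is the centre of the prediction error relative to the error variance.\<close>

context prob_space
begin

text \<open>The weight \<open>2 + G\<close> is positive, so it defines a tilted probability measure, under which \<open>X\<close> has
  the same characteristic function \<open>char \<mu>\<close> as under \<open>M\<close>.\<close>

lemma real_weight_char_factor:
  fixes G :: "'a \<Rightarrow> real" and X :: "'a \<Rightarrow> real"
  assumes X[measurable]: "X \<in> borel_measurable M" and G[measurable]: "G \<in> borel_measurable M"
    and bound: "\<And>\<omega>. \<bar>G \<omega>\<bar> \<le> 1" and \<mu>: "real_distribution \<mu>"
    and weighted: "\<And>t. (CLINT \<omega>|M. of_real (G \<omega>) * iexp (t * X \<omega>)) = of_real (expectation G) * char \<mu> t"
    and unweighted: "\<And>t. (CLINT \<omega>|M. iexp (t * X \<omega>)) = char \<mu> t"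
    and A[measurable]: "A \<in> sets borel"
  shows "expectation (\<lambda>\<omega>. G \<omega> * indicator A (X \<omega>)) = expectation G * measure \<mu> A"
proof -
  interpret \<mu>: real_distribution \<mu> by fact
  have iG: "integrable M G" by (rule integrable_const_bound[where B=1]) (use bound in auto)
  have EG: "\<bar>expectation G\<bar> \<le> 1"
  proof -
    have "norm (expectation G) \<le> expectation (\<lambda>\<omega>. norm (G \<omega>))" by (rule integral_norm_bound)
    also have "\<dots> \<le> expectation (\<lambda>_. 1)" using iG bound by (intro integral_mono) auto
    finally show ?thesis by (simp add: prob_space)
  qed
  define e where "e = 2 + expectation G"
  have e: "e > 0" using EG unfolding e_def by linarith
  define h where "h = (\<lambda>\<omega>. (2 + G \<omega>) / e)"
  have h0: "h \<omega> \<ge> 0" for \<omega> using bound[of \<omega>] e unfolding h_def by (auto intro!: divide_nonneg_nonneg)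
  have h[measurable]: "h \<in> borel_measurable M" unfolding h_def by measurable
  have ih: "integrable M h" unfolding h_def using iG by auto
  have Eh: "expectation h = 1" unfolding h_def using iG e by (simp add: e_def prob_space)
  define D where "D = density M (\<lambda>\<omega>. ennreal (h \<omega>))"
  have [measurable_cong]: "sets D = sets M" unfolding D_def by simp
  have pD: "prob_space D"
  proof
    have "emeasure D (space D) = (\<integral>\<^sup>+\<omega>. ennreal (h \<omega>) \<partial>M)"
      unfolding D_def by (subst emeasure_density) (auto intro!: nn_integral_cong simp: space_density)
    also have "\<dots> = 1" using ih Eh h0 by (subst nn_integral_eq_integral) auto
    finally show "emeasure D (space D) = 1" .
  qed
  have law: "real_distribution (distr D borel X)"
    using pD by (intro prob_space.real_distribution_distr) auto
  have lawX: "real_distribution (distr M borel X)"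
    by (intro real_distribution_distr) auto
  have "char (distr M borel X) t = char \<mu> t" for t
    using unweighted[of t] by (simp add: char_def integral_distr)
  then have XM: "distr M borel X = \<mu>"
    by (intro Levy_uniqueness lawX \<mu>) auto
  have i1: "complex_integrable M (\<lambda>\<omega>. iexp (t * X \<omega>))" for t
    by (intro integrable_iexp) auto
  have i2: "complex_integrable M (\<lambda>\<omega>. of_real (G \<omega>) * iexp (t * X \<omega>))" for t
    by (rule integrable_const_bound[where B=1]) (use bound in \<open>auto simp: norm_mult\<close>)
  have "char (distr D borel X) t = char \<mu> t" for t
  proof -
    have "char (distr D borel X) t = (CLINT \<omega>|M. h \<omega> *\<^sub>R iexp (t * X \<omega>))"
      unfolding char_def D_def
      by (subst integral_distr) (auto simp: integral_density h0)
    also have "\<dots> = (CLINT \<omega>|M. (1/e) *\<^sub>R (2 * iexp (t * X \<omega>) + of_real (G \<omega>) * iexp (t * X \<omega>)))"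
      by (intro Bochner_Integration.integral_cong) (auto simp: h_def scaleR_conv_of_real algebra_simps add_divide_distrib)
    also have "\<dots> = (1/e) *\<^sub>R (2 * char \<mu> t + of_real (expectation G) * char \<mu> t)"
      using i1[of t] i2[of t] weighted[of t] unweighted[of t] by simp
    also have "\<dots> = (1/e) *\<^sub>R (of_real e * char \<mu> t)"
      unfolding e_def by (simp add: algebra_simps)
    also have "\<dots> = char \<mu> t" using e by (simp add: scaleR_conv_of_real)
    finally show ?thesis .
  qed
  then have XD: "distr D borel X = \<mu>"
    by (intro Levy_uniqueness law \<mu>) auto
  have iA: "integrable M (\<lambda>\<omega>. indicator A (X \<omega>) :: real)"
    by (rule integrable_const_bound[where B=1]) (auto simp: indicator_def)
  have iGA: "integrable M (\<lambda>\<omega>. G \<omega> * indicator A (X \<omega>) :: real)"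
    by (rule integrable_const_bound[where B=1]) (use bound in \<open>auto simp: indicator_def\<close>)
  have mA: "expectation (\<lambda>\<omega>. indicator A (X \<omega>)) = measure \<mu> A"
  proof -
    have "measure \<mu> A = (\<integral>x. indicator A x \<partial>distr M borel X)" unfolding XM by simp
    also have "\<dots> = expectation (\<lambda>\<omega>. indicator A (X \<omega>))" by (rule integral_distr) auto
    finally show ?thesis by simp
  qed
  \<comment> \<open>The law of \<open>X\<close> is \<open>\<mu>\<close> under both measures, so the
    tilted probability of the event is a linear equation for the weighted expectation, solved at the
    end.\<close>
  have "measure \<mu> A = (\<integral>x. indicator A x \<partial>distr D borel X)" unfolding XD by simp
  also have "\<dots> = expectation (\<lambda>\<omega>. h \<omega> * indicator A (X \<omega>))"
    unfolding D_def by (subst integral_distr, simp, simp, subst integral_density) (auto simp: h0)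
  also have "\<dots> = expectation (\<lambda>\<omega>. (1/e) * (2 * indicator A (X \<omega>) + G \<omega> * indicator A (X \<omega>)))"
    by (intro Bochner_Integration.integral_cong) (auto simp: h_def algebra_simps add_divide_distrib)
  also have "\<dots> = (1/e) * (2 * measure \<mu> A + expectation (\<lambda>\<omega>. G \<omega> * indicator A (X \<omega>)))"
    using iA iGA mA by simp
  finally show ?thesis using e by (simp add: e_def field_simps)
qed

text \<open>Real and imaginary part of \<open>F\<close> are admissible real weights: conjugating the
  hypothesis at \<open>- t\<close> gives the same factorisation for the conjugate of
  \<open>F\<close>, since \<open>char \<mu> (- t)\<close> is the conjugate of
  \<open>char \<mu> t\<close>, and both parts are linear combinations of \<open>F\<close> and its
  conjugate.\<close>

lemma complex_weight_char_factor:
  fixes F :: "'a \<Rightarrow> complex" and X :: "'a \<Rightarrow> real"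
  assumes X[measurable]: "X \<in> borel_measurable M" and F[measurable]: "F \<in> borel_measurable M"
    and bound: "\<And>\<omega>. cmod (F \<omega>) \<le> 1" and \<mu>: "real_distribution \<mu>"
    and weighted: "\<And>t. (CLINT \<omega>|M. F \<omega> * iexp (t * X \<omega>)) = (CLINT \<omega>|M. F \<omega>) * char \<mu> t"
    and unweighted: "\<And>t. (CLINT \<omega>|M. iexp (t * X \<omega>)) = char \<mu> t"
    and A[measurable]: "A \<in> sets borel"
  shows "(CLINT \<omega>|M. F \<omega> * indicator A (X \<omega>)) = (CLINT \<omega>|M. F \<omega>) * measure \<mu> A"
proof -
  have [measurable]: "(\<lambda>\<omega>. cnj (F \<omega>)) \<in> borel_measurable M"
    by (rule measurable_compose[OF F borel_measurable_continuous_onI]) (intro continuous_intros)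
  have iF: "complex_integrable M F" by (rule integrable_const_bound[where B=1]) (use bound in auto)
  have iFt: "complex_integrable M (\<lambda>\<omega>. F \<omega> * iexp (t * X \<omega>))" for t
    by (rule integrable_const_bound[where B=1]) (use bound in \<open>auto simp: norm_mult\<close>)
  have icFt: "complex_integrable M (\<lambda>\<omega>. cnj (F \<omega>) * iexp (t * X \<omega>))" for t
    by (rule integrable_const_bound[where B=1]) (use bound in \<open>auto simp: norm_mult\<close>)
  have cw: "(CLINT \<omega>|M. cnj (F \<omega>) * iexp (t * X \<omega>)) = cnj (CLINT \<omega>|M. F \<omega>) * char \<mu> t" for t
  proof -
    have c: "cnj (iexp (- t * x)) = iexp (t * x)" for x by (simp add: exp_cnj)
    have "cnj (CLINT \<omega>|M. F \<omega> * iexp (- t * X \<omega>)) = (CLINT \<omega>|M. cnj (F \<omega> * iexp (- t * X \<omega>)))"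
      by (rule Bochner_Integration.integral_cnj[symmetric])
    moreover have "cnj (char \<mu> (- t)) = char \<mu> t"
      unfolding char_def by (subst Bochner_Integration.integral_cnj[symmetric]) (simp only: c)
    ultimately show ?thesis unfolding weighted[of "- t"] complex_cnj_mult c by simp
  qed
  have re: "expectation (\<lambda>\<omega>. Re (F \<omega>)) = Re (CLINT \<omega>|M. F \<omega>)"
    and im: "expectation (\<lambda>\<omega>. Im (F \<omega>)) = Im (CLINT \<omega>|M. F \<omega>)" using iF by simp_all
  have R: "expectation (\<lambda>\<omega>. Re (F \<omega>) * indicator A (X \<omega>)) = expectation (\<lambda>\<omega>. Re (F \<omega>)) * measure \<mu> A"
  proof (rule real_weight_char_factor[OF X _ _ \<mu> _ unweighted A])
    show "\<bar>Re (F \<omega>)\<bar> \<le> 1" for \<omega> using abs_Re_le_cmod[of "F \<omega>"] bound[of \<omega>] by linarith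
    fix t
    have re_eq: "of_real (Re z) * w = (z * w + cnj z * w) / 2" for z w :: complex
      by (simp add: complex_eq_iff)
    have "(CLINT \<omega>|M. of_real (Re (F \<omega>)) * iexp (t * X \<omega>))
        = (CLINT \<omega>|M. (F \<omega> * iexp (t * X \<omega>) + cnj (F \<omega>) * iexp (t * X \<omega>)) / 2)"
      by (intro Bochner_Integration.integral_cong refl) (rule re_eq)
    also have "\<dots> = ((CLINT \<omega>|M. F \<omega>) * char \<mu> t + cnj (CLINT \<omega>|M. F \<omega>) * char \<mu> t) / 2"
      using iFt[of t] icFt[of t] weighted[of t] cw[of t] by simp
    also have "\<dots> = of_real (Re (CLINT \<omega>|M. F \<omega>)) * char \<mu> t"
      unfolding re_eq ..
    finally show "(CLINT \<omega>|M. of_real (Re (F \<omega>)) * iexp (t * X \<omega>))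
      = of_real (expectation (\<lambda>\<omega>. Re (F \<omega>))) * char \<mu> t" unfolding re .
  qed auto
  have I: "expectation (\<lambda>\<omega>. Im (F \<omega>) * indicator A (X \<omega>)) = expectation (\<lambda>\<omega>. Im (F \<omega>)) * measure \<mu> A"
  proof (rule real_weight_char_factor[OF X _ _ \<mu> _ unweighted A])
    show "\<bar>Im (F \<omega>)\<bar> \<le> 1" for \<omega> using abs_Im_le_cmod[of "F \<omega>"] bound[of \<omega>] by linarith
    fix t
    have im_eq: "of_real (Im z) * w = (z * w - cnj z * w) / (2 * \<i>)" for z w :: complex
      by (simp add: complex_eq_iff)
    have "(CLINT \<omega>|M. of_real (Im (F \<omega>)) * iexp (t * X \<omega>))
        = (CLINT \<omega>|M. (F \<omega> * iexp (t * X \<omega>) - cnj (F \<omega>) * iexp (t * X \<omega>)) / (2 * \<i>))"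
      unfolding im_eq ..
    also have "\<dots> = ((CLINT \<omega>|M. F \<omega>) * char \<mu> t - cnj (CLINT \<omega>|M. F \<omega>) * char \<mu> t) / (2 * \<i>)"
      using iFt[of t] icFt[of t] weighted[of t] cw[of t] by simp
    also have "\<dots> = of_real (Im (CLINT \<omega>|M. F \<omega>)) * char \<mu> t"
      unfolding im_eq ..
    finally show "(CLINT \<omega>|M. of_real (Im (F \<omega>)) * iexp (t * X \<omega>))
      = of_real (expectation (\<lambda>\<omega>. Im (F \<omega>))) * char \<mu> t" unfolding im .
  qed auto
  have iFA: "complex_integrable M (\<lambda>\<omega>. F \<omega> * indicator A (X \<omega>))"
    by (rule integrable_const_bound[where B=1]) (use bound in \<open>auto simp: norm_mult indicator_def\<close>)
  show ?thesis
  proof (rule complex_eqI)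
    have "Re (CLINT \<omega>|M. F \<omega> * indicator A (X \<omega>)) = expectation (\<lambda>\<omega>. Re (F \<omega> * indicator A (X \<omega>)))"
      by (rule integral_Re[OF iFA, symmetric])
    also have "\<dots> = expectation (\<lambda>\<omega>. Re (F \<omega>) * indicator A (X \<omega>))"
      by (intro Bochner_Integration.integral_cong) (auto simp: indicator_def)
    finally show "Re (CLINT \<omega>|M. F \<omega> * indicator A (X \<omega>)) = Re ((CLINT \<omega>|M. F \<omega>) * measure \<mu> A)"
      unfolding R re by simp
    have "Im (CLINT \<omega>|M. F \<omega> * indicator A (X \<omega>)) = expectation (\<lambda>\<omega>. Im (F \<omega> * indicator A (X \<omega>)))"
      by (rule integral_Im[OF iFA, symmetric])
    also have "\<dots> = expectation (\<lambda>\<omega>. Im (F \<omega>) * indicator A (X \<omega>))"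
      by (intro Bochner_Integration.integral_cong) (auto simp: indicator_def)
    finally show "Im (CLINT \<omega>|M. F \<omega> * indicator A (X \<omega>)) = Im ((CLINT \<omega>|M. F \<omega>) * measure \<mu> A)"
      unfolding I im by simp
  qed
qed

text \<open>Coordinates are moved one at a time from the exponential to the indicators.\<close>

lemma prob_Inter_char_prod:
  fixes X :: "'i \<Rightarrow> 'a \<Rightarrow> real"
  assumes I: "finite I" and X[measurable]: "\<And>i. i \<in> I \<Longrightarrow> X i \<in> borel_measurable M"
    and \<mu>: "\<And>i. real_distribution (\<mu> i)"
    and char: "\<And>t. (CLINT \<omega>|M. iexp (\<Sum>i\<in>I. t i * X i \<omega>)) = (\<Prod>i\<in>I. char (\<mu> i) (t i))"
    and A[measurable]: "\<And>i. A i \<in> sets borel"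
  shows "expectation (\<lambda>\<omega>. \<Prod>i\<in>I. indicator (A i) (X i \<omega>)) = (\<Prod>i\<in>I. measure (\<mu> i) (A i))"
proof -
  define F where "F J t \<omega> = (\<Prod>i\<in>J. indicator (A i) (X i \<omega>) :: complex) * iexp (\<Sum>i\<in>I - J. t i * X i \<omega>)" for J t \<omega>
  have "(CLINT \<omega>|M. F J t \<omega>) = (\<Prod>i\<in>J. measure (\<mu> i) (A i)) * (\<Prod>i\<in>I - J. char (\<mu> i) (t i))"
    if "finite J" "J \<subseteq> I" for J t
    using that
  proof (induction J arbitrary: t rule: finite_induct)
    case empty
    then show ?case using char by (simp add: F_def)
  next
    case (insert k J)
    interpret \<mu>k: real_distribution "\<mu> k" by fact
    have k: "k \<in> I" "k \<notin> J" "J \<subseteq> I" using insert by auto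
    have IJ: "I - J = insert k (I - insert k J)" using k by auto
    have fin: "finite (I - insert k J)" using I by simp
    note Xk = X[OF k(1)]
    have XJ[measurable]: "i \<in> J \<Longrightarrow> X i \<in> borel_measurable M" for i using k by auto
    \<comment> \<open>\<open>G\<close> collects everything except coordinate \<open>k\<close>:
      indicators for \<open>J\<close>, exponentials for the others. With only the frequency of
      \<open>k\<close> varying, the induction hypothesis is the factorisation required of the weight
      \<open>G\<close>.\<close>
    define G where "G \<omega> = (\<Prod>i\<in>J. indicator (A i) (X i \<omega>) :: complex) * iexp (\<Sum>i\<in>I - insert k J. t i * X i \<omega>)" for \<omega>
    have G[measurable]: "G \<in> borel_measurable M"
      unfolding G_def by measurable
    have G1: "cmod (G \<omega>) \<le> 1" for \<omega>
    proof -
      have "cmod (\<Prod>i\<in>J. indicator (A i) (X i \<omega>) :: complex) \<le> (\<Prod>i\<in>J. 1)"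
        unfolding prod_norm[symmetric] by (intro prod_mono) (auto simp: indicator_def)
      then show ?thesis unfolding G_def by (simp add: norm_mult del: of_real_sum)
    qed
    have FG: "F J (t(k := s)) \<omega> = G \<omega> * iexp (s * X k \<omega>)" for s \<omega>
    proof -
      have "(\<Sum>i\<in>I - J. (t(k := s)) i * X i \<omega>) = s * X k \<omega> + (\<Sum>i\<in>I - insert k J. t i * X i \<omega>)"
        unfolding IJ using fin by (auto intro!: sum.cong)
      then show ?thesis unfolding F_def G_def
        by (simp add: exp_add distrib_left mult.assoc mult.commute)
    qed
    have IH: "(CLINT \<omega>|M. G \<omega> * iexp (s * X k \<omega>)) = (\<Prod>i\<in>J. measure (\<mu> i) (A i)) * (\<Prod>i\<in>I - insert k J. char (\<mu> i) (t i)) * char (\<mu> k) s" for s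
    proof -
      have "(\<Prod>i\<in>I - J. char (\<mu> i) ((t(k := s)) i)) = char (\<mu> k) s * (\<Prod>i\<in>I - insert k J. char (\<mu> i) (t i))"
        unfolding IJ using fin by (auto intro!: prod.cong)
      then show ?thesis using insert.IH[OF k(3), of "t(k := s)"] unfolding FG by (simp add: mult_ac)
    qed
    have EG: "(CLINT \<omega>|M. G \<omega>) = (\<Prod>i\<in>J. measure (\<mu> i) (A i)) * (\<Prod>i\<in>I - insert k J. char (\<mu> i) (t i))"
      using IH[of 0] by (simp add: \<mu>k.char_zero)
    \<comment> \<open>Setting all other frequencies to zero gives the marginal characteristic
      function.\<close>
    have char_k: "(CLINT \<omega>|M. iexp (s * X k \<omega>)) = char (\<mu> k) s" for s
    proof -
      have "(\<Sum>i\<in>I. (if i = k then s else 0) * X i \<omega>) = s * X k \<omega>" for \<omega>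
        using I k by (simp add: if_distrib[of "\<lambda>a. a * _"] sum.delta cong: if_cong)
      moreover have "(\<Prod>i\<in>I. char (\<mu> i) (if i = k then s else 0)) = (\<Prod>i\<in>I. if i = k then char (\<mu> k) s else 1)"
        by (intro prod.cong) (auto simp: real_distribution.char_zero[OF \<mu>])
      ultimately show ?thesis using char[of "\<lambda>i. if i = k then s else 0"] I k by (simp add: prod.delta)
    qed
    have "(CLINT \<omega>|M. F (insert k J) t \<omega>) = (CLINT \<omega>|M. G \<omega> * indicator (A k) (X k \<omega>))"
      unfolding F_def G_def using insert by (intro Bochner_Integration.integral_cong) (auto simp: mult_ac)
    also have "\<dots> = (CLINT \<omega>|M. G \<omega>) * measure (\<mu> k) (A k)"
      using IH EG by (intro complex_weight_char_factor[OF Xk G G1 \<mu> _ char_k A]) simp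
    finally show ?case unfolding EG using insert by (simp add: mult_ac)
  qed
  from this[OF I subset_refl, of "\<lambda>_. 0"]
  have "(CLINT \<omega>|M. F I (\<lambda>_. 0) \<omega>) = of_real (\<Prod>i\<in>I. measure (\<mu> i) (A i))" by simp
  moreover have "F I (\<lambda>_. 0) \<omega> = of_real (\<Prod>i\<in>I. indicator (A i) (X i \<omega>))" for \<omega>
    unfolding F_def by (auto simp: indicator_def intro!: prod.cong)
  ultimately show ?thesis by (simp only: integral_complex_of_real of_real_eq_iff)
qed

text \<open>Rectangles determine a finite product measure, and \<open>prob_Inter_char_prod\<close>
  gives their probabilities. This serves as the multivariate uniqueness theorem for joint
  characteristic functions that factor.\<close>

lemma distr_eq_PiM_char_prod:
  fixes X :: "'i \<Rightarrow> 'a \<Rightarrow> real"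
  assumes I: "finite I" and X[measurable]: "\<And>i. i \<in> I \<Longrightarrow> X i \<in> borel_measurable M"
    and \<mu>: "\<And>i. real_distribution (\<mu> i)"
    and char: "\<And>t. (CLINT \<omega>|M. iexp (\<Sum>i\<in>I. t i * X i \<omega>)) = (\<Prod>i\<in>I. char (\<mu> i) (t i))"
  shows "distr M (\<Pi>\<^sub>M i\<in>I. borel) (\<lambda>\<omega>. \<lambda>i\<in>I. X i \<omega>) = PiM I \<mu>"
proof -
  have s: "sets (\<mu> i) = sets borel" for i using \<mu>[of i] by (simp add: real_distribution_def real_distribution_axioms_def)
  interpret PM: product_prob_space \<mu> I
    by (intro product_prob_spaceI) (use \<mu> in \<open>auto simp: real_distribution_def\<close>)
  show ?thesis
  proof (rule PM.PiM_eqI[OF I])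
    show "sets (distr M (\<Pi>\<^sub>M i\<in>I. borel) (\<lambda>\<omega>. \<lambda>i\<in>I. X i \<omega>)) = sets (PiM I \<mu>)"
      by (auto intro!: sets_PiM_cong simp: s)
    fix A assume A: "\<And>i. i \<in> I \<Longrightarrow> A i \<in> sets (\<mu> i)"
    \<comment> \<open>Outside \<open>I\<close> nothing is known about \<open>A\<close>; the empty
      set makes every \<open>B i\<close> measurable.\<close>
    define B where "B i = (if i \<in> I then A i else {})" for i
    have B[measurable]: "B i \<in> sets borel" for i using A by (auto simp: B_def s)
    have "emeasure (distr M (\<Pi>\<^sub>M i\<in>I. borel) (\<lambda>\<omega>. \<lambda>i\<in>I. X i \<omega>)) (Pi\<^sub>E I A)
        = emeasure M {\<omega>\<in>space M. \<forall>i\<in>I. X i \<omega> \<in> B i}"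
    proof (subst emeasure_distr)
      show "Pi\<^sub>E I A \<in> sets (\<Pi>\<^sub>M i\<in>I. borel)" using A s I by (intro sets_PiM_I_finite) auto
    qed (auto intro!: arg_cong[where f="emeasure M"] simp: B_def)
    also have "\<dots> = ennreal (measure M {\<omega>\<in>space M. \<forall>i\<in>I. X i \<omega> \<in> B i})"
      by (simp add: emeasure_eq_measure)
    also have "measure M {\<omega>\<in>space M. \<forall>i\<in>I. X i \<omega> \<in> B i} = expectation (indicator {\<omega>\<in>space M. \<forall>i\<in>I. X i \<omega> \<in> B i})"
    proof -
      have "{\<omega>\<in>space M. \<forall>i\<in>I. X i \<omega> \<in> B i} \<in> sets M" using I by measurable
      then show ?thesis by simp
    qed
    also have "\<dots> = expectation (\<lambda>\<omega>. \<Prod>i\<in>I. indicator (B i) (X i \<omega>))"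
    proof (intro Bochner_Integration.integral_cong refl)
      fix \<omega> assume "\<omega> \<in> space M"
      then show "indicator {\<omega>\<in>space M. \<forall>i\<in>I. X i \<omega> \<in> B i} \<omega> = (\<Prod>i\<in>I. indicator (B i) (X i \<omega>) :: real)"
        using I by (auto simp: indicator_def)
    qed
    also have "\<dots> = (\<Prod>i\<in>I. measure (\<mu> i) (B i))"
      by (rule prob_Inter_char_prod[OF I X \<mu> char B])
    also have "ennreal \<dots> = (\<Prod>i\<in>I. emeasure (\<mu> i) (A i))"
      by (subst prod_ennreal[symmetric])
         (auto simp: B_def PM.M.emeasure_eq_measure intro!: prod.cong)
    finally show "emeasure (distr M (\<Pi>\<^sub>M i\<in>I. borel) (\<lambda>\<omega>. \<lambda>i\<in>I. X i \<omega>)) (Pi\<^sub>E I A) = (\<Prod>i\<in>I. emeasure (\<mu> i) (A i))" .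
  qed
qed

end

section \<open>Gram-Schmidt regression\<close>

definition ip :: "nat \<Rightarrow> (nat \<Rightarrow> real) \<Rightarrow> (nat \<Rightarrow> real) \<Rightarrow> real" where
  "ip n u v = (\<Sum>i<n. u i * v i)"

text \<open>Gram-Schmidt regression of \<open>v\<close> on the first \<open>k\<close> columns of \<open>Z\<close>, with residual \<open>res n Z k v\<close> and
  coefficients \<open>coef n Z k v\<close>; only the entries \<open>i < n\<close> matter. Because \<open>x / 0 = 0\<close>, columns that
  depend linearly on their predecessors are skipped.\<close>

primrec res :: "nat \<Rightarrow> (nat \<Rightarrow> nat \<Rightarrow> real) \<Rightarrow> nat \<Rightarrow> (nat \<Rightarrow> real) \<Rightarrow> nat \<Rightarrow> real" where
  "res n Z 0 v = v"
| "res n Z (Suc k) v = (\<lambda>i. res n Z k v i -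
     ip n (res n Z k v) (res n Z k (Z k)) / ip n (res n Z k (Z k)) (res n Z k (Z k)) * res n Z k (Z k) i)"

text \<open>The coefficient of column \<open>k\<close> in the regression on the columns up to and
  including \<open>k\<close>. Only what the earlier columns do not explain in \<open>v\<close> and
  in \<open>Z k\<close> enters.\<close>

definition kap :: "nat \<Rightarrow> (nat \<Rightarrow> nat \<Rightarrow> real) \<Rightarrow> nat \<Rightarrow> (nat \<Rightarrow> real) \<Rightarrow> real" where
  "kap n Z k v = ip n (res n Z k v) (res n Z k (Z k)) / ip n (res n Z k (Z k)) (res n Z k (Z k))"

primrec coef :: "nat \<Rightarrow> (nat \<Rightarrow> nat \<Rightarrow> real) \<Rightarrow> nat \<Rightarrow> (nat \<Rightarrow> real) \<Rightarrow> nat \<Rightarrow> real" where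
  "coef n Z 0 v = (\<lambda>_. 0)"
| "coef n Z (Suc k) v = (coef n Z k (\<lambda>i. v i - kap n Z k v * Z k i))(k := kap n Z k v)"

text \<open>Linear independence of the first \<open>k\<close> columns, restricted to the entries
  below \<open>n\<close>; see \<open>nondeg_independent\<close> and
  \<open>not_nondeg_dependent\<close>.\<close>

definition nondeg :: "nat \<Rightarrow> (nat \<Rightarrow> nat \<Rightarrow> real) \<Rightarrow> nat \<Rightarrow> bool" where
  "nondeg n Z k \<longleftrightarrow> (\<forall>j<k. ip n (res n Z j (Z j)) (res n Z j (Z j)) \<noteq> 0)"

lemma ip_commute: "ip n u v = ip n v u"
  by (simp add: ip_def mult.commute)

lemma ip_add_left: "ip n (\<lambda>i. u i + v i) w = ip n u w + ip n v w"
  and ip_diff_left: "ip n (\<lambda>i. u i - v i) w = ip n u w - ip n v w"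
  and ip_scale_left: "ip n (\<lambda>i. a * u i) w = a * ip n u w"
  and ip_add_right: "ip n w (\<lambda>i. u i + v i) = ip n w u + ip n w v"
  and ip_diff_right: "ip n w (\<lambda>i. u i - v i) = ip n w u - ip n w v"
  and ip_scale_right: "ip n w (\<lambda>i. a * u i) = a * ip n w u"
  by (simp_all add: ip_def algebra_simps sum.distrib sum_subtractf sum_distrib_left)

lemma ip_sum_right: "ip n w (\<lambda>i. \<Sum>j\<in>J. f j i) = (\<Sum>j\<in>J. ip n w (f j))"
  unfolding ip_def by (subst sum.swap) (simp add: sum_distrib_left)

lemmas ip_linear = ip_add_left ip_diff_left ip_scale_left ip_add_right ip_diff_right ip_scale_right

lemma ip_self_nonneg: "ip n u u \<ge> 0"
  by (simp add: ip_def sum_nonneg)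

lemma ip_self_eq_0_iff: "ip n u u = 0 \<longleftrightarrow> (\<forall>i<n. u i = 0)"
  unfolding ip_def by (subst sum_nonneg_eq_0_iff) auto

lemma ip_cong:
  "(\<And>i. i < n \<Longrightarrow> u i = u' i) \<Longrightarrow> (\<And>i. i < n \<Longrightarrow> v i = v' i) \<Longrightarrow> ip n u v = ip n u' v'"
  by (simp add: ip_def)

lemma res_linear:
  "res n Z k (\<lambda>i. a * u i + b * v i) = (\<lambda>i. a * res n Z k u i + b * res n Z k v i)"
proof (induction k)
  case (Suc k)
  show ?case unfolding res.simps Suc
    by (simp add: ip_linear add_divide_distrib distrib_right right_diff_distrib mult.assoc fun_eq_iff)
qed simp

lemma res_diff_scale:
  "res n Z k (\<lambda>i. u i - b * v i) = (\<lambda>i. res n Z k u i - b * res n Z k v i)"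
  using res_linear[of n Z k 1 u "- b" v] by simp

lemma res_sum:
  "finite J \<Longrightarrow> res n Z k (\<lambda>i. \<Sum>j\<in>J. c j * f j i) = (\<lambda>i. \<Sum>j\<in>J. c j * res n Z k (f j) i)"
proof (induction J rule: finite_induct)
  case empty
  then show ?case using res_linear[of n Z k 0 "\<lambda>_. 0" 0 "\<lambda>_. 0"] by simp
next
  case (insert x F)
  then show ?case using res_linear[of n Z k "c x" "f x" 1 "\<lambda>i. \<Sum>j\<in>F. c j * f j i"] by simp
qed

lemma res_Suc_kap: "res n Z (Suc k) v = (\<lambda>i. res n Z k v i - kap n Z k v * res n Z k (Z k) i)"
  by (simp add: kap_def)

lemma kap_linear: "kap n Z k (\<lambda>i. a * u i + b * v i) = a * kap n Z k u + b * kap n Z k v"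
  by (simp add: kap_def res_linear ip_linear add_divide_distrib)

lemma coef_linear:
  "coef n Z k (\<lambda>i. a * u i + b * v i) j = a * coef n Z k u j + b * coef n Z k v j"
proof (induction k arbitrary: u v)
  case (Suc k)
  have "(\<lambda>i. a * u i + b * v i - kap n Z k (\<lambda>i. a * u i + b * v i) * Z k i)
     = (\<lambda>i. a * (u i - kap n Z k u * Z k i) + b * (v i - kap n Z k v * Z k i))"
    by (auto simp: kap_linear algebra_simps)
  then show ?case using Suc by (simp add: kap_linear)
qed simp

text \<open>Dependent columns are included. In the induction step, subtracting \<open>kap\<close>
  times the new column leaves a vector whose residual after \<open>k\<close> columns is the residual
  of \<open>v\<close> after \<open>Suc k\<close>.\<close>

lemma coef_decomp: "v i = (\<Sum>j<k. coef n Z k v j * Z j i) + res n Z k v i"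
proof (induction k arbitrary: v)
  case (Suc k)
  have "v i - kap n Z k v * Z k i = (\<Sum>j<k. coef n Z k (\<lambda>i. v i - kap n Z k v * Z k i) j * Z j i)
      + res n Z k (\<lambda>i. v i - kap n Z k v * Z k i) i"
    by (rule Suc)
  then show ?case by (simp add: res_Suc_kap res_diff_scale del: res.simps)
qed simp

lemma res_orthogonal: "j < k \<Longrightarrow> ip n (res n Z k u) (Z j) = 0"
proof (induction k arbitrary: u j)
  case (Suc k)
  let ?r = "res n Z k (Z k)"
  show ?case
  proof (cases "j = k")
    case False
    then show ?thesis using Suc by (simp add: res_Suc_kap ip_linear del: res.simps)
  next
    case True
    \<comment> \<open>\<open>Z k\<close> and its residual differ by earlier columns, to which
      residuals are orthogonal by the induction hypothesis.\<close>
    have "ip n (res n Z k u) (Z k) = ip n (res n Z k u) ?r" for u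
    proof -
      have "ip n (res n Z k u) (Z k) = ip n (res n Z k u) (\<lambda>i. (\<Sum>j<k. coef n Z k (Z k) j * Z j i) + ?r i)"
        using coef_decomp[of "Z k" _ n Z k] by (intro ip_cong) auto
      also have "\<dots> = ip n (res n Z k u) ?r"
        by (simp add: ip_linear ip_sum_right Suc.IH)
      finally show ?thesis .
    qed
    then have "ip n (res n Z (Suc k) u) (Z k) = ip n (res n Z k u) ?r - ip n (res n Z k u) ?r / ip n ?r ?r * ip n ?r ?r"
      unfolding res_Suc_kap ip_linear by (simp add: kap_def)
    also have "\<dots> = 0"
    \<comment> \<open>For a dependent column the residual \<open>?r\<close> is zero below
      \<open>n\<close>, and both terms vanish.\<close>
    proof (cases "ip n ?r ?r = 0")
      case True
      then have "ip n (res n Z k u) ?r = ip n (\<lambda>_. 0) (\<lambda>_. 0)"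
        by (simp add: ip_self_eq_0_iff) (simp add: ip_def)
      then show ?thesis by (simp add: ip_def)
    qed simp
    finally show ?thesis using True by simp
  qed
qed simp

text \<open>Together with \<open>ip_res_left\<close>, the residual map is self-adjoint: the fitted
  part of \<open>v\<close> is a combination of columns, to which residuals are orthogonal.\<close>

lemma ip_res_right: "ip n (res n Z k u) v = ip n (res n Z k u) (res n Z k v)"
proof -
  have "ip n (res n Z k u) v = ip n (res n Z k u) (\<lambda>i. (\<Sum>j<k. coef n Z k v j * Z j i) + res n Z k v i)"
    using coef_decomp[of v _ n Z k] by (intro ip_cong) auto
  then show ?thesis by (simp add: ip_linear ip_sum_right res_orthogonal)
qed

lemma ip_res_left: "ip n u (res n Z k v) = ip n (res n Z k u) (res n Z k v)"
  using ip_res_right[of n Z k v u] by (simp add: ip_commute)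

text \<open>The residual of a column has the same inner product with itself as with the column, and
  the latter is zero by orthogonality.\<close>

lemma res_column: "j < k \<Longrightarrow> i < n \<Longrightarrow> res n Z k (Z j) i = 0"
  using ip_res_right[of n Z k "Z j" "Z j"] res_orthogonal[of j k n Z "Z j"]
  by (simp add: ip_self_eq_0_iff)

lemma res_span: "i < n \<Longrightarrow> l \<le> k \<Longrightarrow> res n Z k (\<lambda>i. \<Sum>j<l. c j * Z j i) i = 0"
  by (simp add: res_sum res_column)

lemma res_idem: "i < n \<Longrightarrow> res n Z k (res n Z k v) i = res n Z k v i"
proof -
  assume i: "i < n"
  have "res n Z k v = (\<lambda>i. v i - 1 * (\<Sum>j<k. coef n Z k v j * Z j i))"
    using coef_decomp[of v _ n Z k] by (auto simp: fun_eq_iff)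
  then have "res n Z k (res n Z k v) = (\<lambda>i. res n Z k v i - 1 * res n Z k (\<lambda>i. \<Sum>j<k. coef n Z k v j * Z j i) i)"
    using res_diff_scale[of n Z k v 1] by metis
  then show ?thesis using i by (simp add: res_span)
qed

lemma coef_orthogonal: "(\<And>j. j < k \<Longrightarrow> ip n v (Z j) = 0) \<Longrightarrow> coef n Z k v j = 0"
proof (induction k)
  case (Suc k)
  have "ip n (res n Z k v) (res n Z k (Z k)) = ip n v (res n Z k (Z k))"
    by (rule ip_res_left[symmetric])
  also have "\<dots> = ip n v (\<lambda>i. Z k i - (\<Sum>j<k. coef n Z k (Z k) j * Z j i))"
    using coef_decomp[of "Z k" _ n Z k] by (intro ip_cong) (auto simp: algebra_simps)
  also have "\<dots> = 0" using Suc.prems by (simp add: ip_linear ip_sum_right)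
  finally have "kap n Z k v = 0" by (simp add: kap_def)
  then show ?case using Suc by simp
qed simp

lemma coef_res: "coef n Z k (res n Z k v) j = 0"
  by (rule coef_orthogonal) (rule res_orthogonal)

lemma res_cong:
  assumes "\<And>i. i < n \<Longrightarrow> u i = v i" "\<And>j i. j < k \<Longrightarrow> i < n \<Longrightarrow> Z j i = Z' j i" "i < n"
  shows "res n Z k u i = res n Z' k v i"
  using assms
proof (induction k arbitrary: u v i)
  case (Suc k)
  have 1: "res n Z k u i = res n Z' k v i" if "i < n" for i
    using that Suc.prems by (intro Suc.IH) auto
  have 2: "res n Z k (Z k) i = res n Z' k (Z' k) i" if "i < n" for i
    using that Suc.prems by (intro Suc.IH) auto
  have "ip n (res n Z k u) (res n Z k (Z k)) = ip n (res n Z' k v) (res n Z' k (Z' k))"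
    "ip n (res n Z k (Z k)) (res n Z k (Z k)) = ip n (res n Z' k (Z' k)) (res n Z' k (Z' k))"
    using 1 2 by (auto intro!: ip_cong)
  then show ?case using 1 2 Suc.prems by simp
qed simp

lemma kap_cong:
  assumes "\<And>i. i < n \<Longrightarrow> u i = v i" "\<And>j i. j \<le> k \<Longrightarrow> i < n \<Longrightarrow> Z j i = Z' j i"
  shows "kap n Z k u = kap n Z' k v"
proof -
  have "ip n (res n Z k u) (res n Z k (Z k)) = ip n (res n Z' k v) (res n Z' k (Z' k))"
    "ip n (res n Z k (Z k)) (res n Z k (Z k)) = ip n (res n Z' k (Z' k)) (res n Z' k (Z' k))"
    using assms by (auto intro!: ip_cong res_cong)
  then show ?thesis by (simp add: kap_def)
qed

lemma coef_cong:
  assumes "\<And>i. i < n \<Longrightarrow> u i = v i" "\<And>j i. j < k \<Longrightarrow> i < n \<Longrightarrow> Z j i = Z' j i"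
  shows "coef n Z k u j = coef n Z' k v j"
  using assms
proof (induction k arbitrary: u v)
  case (Suc k)
  have k: "kap n Z k u = kap n Z' k v" using Suc.prems by (intro kap_cong) auto
  then have "coef n Z k (\<lambda>i. u i - kap n Z k u * Z k i) j = coef n Z' k (\<lambda>i. v i - kap n Z' k v * Z' k i) j"
    using Suc.prems by (intro Suc.IH) auto
  then show ?case using k by simp
qed simp

lemma nondeg_cong:
  assumes "\<And>j i. j < k \<Longrightarrow> i < n \<Longrightarrow> Z j i = Z' j i"
  shows "nondeg n Z k = nondeg n Z' k"
proof -
  have "ip n (res n Z j (Z j)) (res n Z j (Z j)) = ip n (res n Z' j (Z' j)) (res n Z' j (Z' j))" if "j < k" for j
    using that assms by (auto intro!: ip_cong res_cong)
  then show ?thesis by (simp add: nondeg_def)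
qed

lemma coef_norm_Suc:
  "(\<Sum>j<Suc k. (coef n Z (Suc k) v j)\<^sup>2)
    = (kap n Z k v)\<^sup>2 + (\<Sum>j<k. (coef n Z k (\<lambda>i. v i - kap n Z k v * Z k i) j)\<^sup>2)"
  by (simp add: add.commute)

text \<open>Pythagoras for fit and residual; it makes the exponents of two independent Gaussian
  parts add up to that of one standard normal vector.\<close>

lemma ip_minus_res:
  "ip n (\<lambda>i. s i - res n Z k s i) (\<lambda>i. s i - res n Z k s i) + ip n (res n Z k s) (res n Z k s) = ip n s s"
  by (simp add: ip_linear ip_res_left[of n s Z k s] ip_res_right[of n Z k s s])

text \<open>Taking residuals after \<open>k\<close> columns annihilates the earlier columns and
  leaves \<open>c k\<close> times the nonzero residual of column \<open>k\<close>. So the last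
  coefficient vanishes, and induction handles the others.\<close>

lemma nondeg_independent:
  assumes "nondeg n Z k" "\<And>i. i < n \<Longrightarrow> (\<Sum>j<k. c j * Z j i) = 0" "j < k"
  shows "c j = 0"
  using assms
proof (induction k)
  case (Suc k)
  let ?r = "res n Z k (Z k)"
  have "c k = 0"
  proof (rule ccontr)
    assume "c k \<noteq> 0"
    have "?r i = 0" if i: "i < n" for i
    proof -
      have "res n Z k (\<lambda>i. \<Sum>j<Suc k. c j * Z j i) i = res n Z k (\<lambda>_. 0) i"
        using Suc.prems(2) i by (intro res_cong) auto
      moreover have "res n Z k (\<lambda>_. 0) i = 0" using res_sum[of "{}" n Z k] by simp
      moreover have "res n Z k (\<lambda>i. \<Sum>j<Suc k. c j * Z j i) i = c k * ?r i"
        using i by (subst res_sum) (auto simp: res_column)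
      ultimately show ?thesis using \<open>c k \<noteq> 0\<close> by simp
    qed
    then show False using Suc.prems(1) by (auto simp: nondeg_def ip_self_eq_0_iff)
  qed
  then show ?case using Suc by (auto simp: nondeg_def less_Suc_eq)
qed simp

lemma not_nondeg_dependent:
  assumes "\<not> nondeg n Z k"
  obtains c where "\<And>i. i < n \<Longrightarrow> (\<Sum>j<k. c j * Z j i) = 0" "\<exists>j<k. c j \<noteq> 0"
proof -
  from assms obtain l where l: "l < k" and r: "\<forall>i<n. res n Z l (Z l) i = 0"
    by (auto simp: nondeg_def ip_self_eq_0_iff)
  \<comment> \<open>Column \<open>l\<close> minus its fit on the earlier columns, read as a linear
    relation with coefficient 1 at \<open>l\<close>.\<close>
  define c where "c j = (if j < l then - coef n Z l (Z l) j else if j = l then 1 else 0)" for j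
  have "(\<Sum>j<k. c j * Z j i) = 0" if "i < n" for i
  proof -
    have "(\<Sum>j<k. c j * Z j i) = (\<Sum>j<Suc l. c j * Z j i)"
      using l by (intro sum.mono_neutral_right) (auto simp: c_def)
    also have "\<dots> = Z l i - (\<Sum>j<l. coef n Z l (Z l) j * Z j i)"
      by (simp add: c_def sum_negf)
    also have "\<dots> = res n Z l (Z l) i" using coef_decomp[of "Z l" i n Z l] by simp
    finally show ?thesis using r that by simp
  qed
  moreover have "\<exists>j<k. c j \<noteq> 0" using l by (auto simp: c_def intro!: exI[of _ l])
  ultimately show thesis by (rule that)
qed

text \<open>The residual is orthogonal to the columns, so a change of coefficients contributes its
  own square. This holds for dependent columns as well.\<close>

lemma least_squares_decomp:
  "(\<Sum>i<n. (v i - (\<Sum>j<k. b j * Z j i))\<^sup>2)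
   = ip n (res n Z k v) (res n Z k v) + (\<Sum>i<n. (\<Sum>j<k. (coef n Z k v j - b j) * Z j i)\<^sup>2)"
proof -
  define w where "w i = (\<Sum>j<k. (coef n Z k v j - b j) * Z j i)" for i
  have "ip n (res n Z k v) w = 0"
    unfolding w_def by (simp add: ip_linear ip_sum_right res_orthogonal)
  moreover have "v i - (\<Sum>j<k. b j * Z j i) = res n Z k v i + w i" for i
    using coef_decomp[of v i n Z k] unfolding w_def by (simp add: left_diff_distrib sum_subtractf)
  moreover have "(\<Sum>i<n. (res n Z k v i + w i)\<^sup>2)
      = ip n (res n Z k v) (res n Z k v) + 2 * ip n (res n Z k v) w + (\<Sum>i<n. (w i)\<^sup>2)"
    by (simp add: ip_def power2_sum power2_eq_square sum.distrib sum_distrib_left algebra_simps)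
  ultimately show ?thesis unfolding w_def[symmetric] by simp
qed

section \<open>Standard normal vectors\<close>

lemma prob_std_normal: "prob_space std_normal_distribution"
  using prob_space_normal_density by auto

definition normal_vec :: "'i set \<Rightarrow> ('i \<Rightarrow> real) measure" where
  "normal_vec I = PiM I (\<lambda>_. std_normal_distribution)"

lemma sets_normal_vec [measurable_cong]: "sets (normal_vec I) = sets (\<Pi>\<^sub>M i\<in>I. borel)"
  unfolding normal_vec_def by (intro sets_PiM_cong) auto

lemma space_normal_vec: "space (normal_vec I) = extensional I"
  by (simp add: normal_vec_def space_PiM PiE_def)

lemma prob_space_normal_vec: "prob_space (normal_vec I)"
  unfolding normal_vec_def by (intro prob_space_PiM prob_std_normal)

interpretation normal_vec: prob_space "normal_vec I" for I
  by (rule prob_space_normal_vec)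

interpretation normal_vec_pair: pair_prob_space "normal_vec I" "normal_vec J" for I J ..

lemma normal_vec_iexp:
  fixes t :: "'i \<Rightarrow> real"
  assumes I: "finite I"
  shows "(CLINT x|normal_vec I. iexp (\<Sum>i\<in>I. t i * x i)) = of_real (exp (- (\<Sum>i\<in>I. (t i)\<^sup>2) / 2))"
proof -
  interpret product_prob_space "\<lambda>_::'i. std_normal_distribution" I
    by (intro product_prob_spaceI prob_std_normal)
  have "(CLINT x|normal_vec I. iexp (\<Sum>i\<in>I. t i * x i)) = (CLINT x|normal_vec I. (\<Prod>i\<in>I. iexp (t i * x i)))"
    by (intro Bochner_Integration.integral_cong refl) (simp add: exp_sum[OF I] sum_distrib_left)
  also have "\<dots> = (\<Prod>i\<in>I. char std_normal_distribution (t i))"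
    unfolding normal_vec_def char_def by (intro product_integral_prod I prob_space.integrable_iexp[OF prob_std_normal]) auto
  also have "\<dots> = of_real (exp (\<Sum>i\<in>I. - ((t i)\<^sup>2) / 2))"
    unfolding char_std_normal_distribution by (simp add: exp_sum[OF I])
  also have "(\<Sum>i\<in>I. - ((t i)\<^sup>2) / 2) = - (\<Sum>i\<in>I. (t i)\<^sup>2) / 2"
    by (simp add: sum_divide_distrib sum_negf)
  finally show ?thesis .
qed

text \<open>The criterion by which standard normal vectors are recognised from the variances of
  their linear combinations; it is used for the orthogonal split, for rotations and for appending a
  column.\<close>

lemma (in prob_space) distr_eq_normal_vec:
  fixes X :: "'i \<Rightarrow> 'a \<Rightarrow> real"
  assumes I: "finite I" and X: "\<And>i. i \<in> I \<Longrightarrow> X i \<in> borel_measurable M"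
    and char: "\<And>t. (CLINT \<omega>|M. iexp (\<Sum>i\<in>I. t i * X i \<omega>)) = of_real (exp (- (\<Sum>i\<in>I. (t i)\<^sup>2) / 2))"
  shows "distr M (\<Pi>\<^sub>M i\<in>I. borel) (\<lambda>\<omega>. \<lambda>i\<in>I. X i \<omega>) = normal_vec I"
  unfolding normal_vec_def
proof (rule distr_eq_PiM_char_prod[OF I X])
  fix t :: "'i \<Rightarrow> real"
  have "(\<Sum>i\<in>I. - ((t i)\<^sup>2) / 2) = - (\<Sum>i\<in>I. (t i)\<^sup>2) / 2"
    by (simp add: sum_divide_distrib sum_negf)
  then show "(CLINT \<omega>|M. iexp (\<Sum>i\<in>I. t i * X i \<omega>)) = (\<Prod>i\<in>I. char std_normal_distribution (t i))"
    unfolding char char_std_normal_distribution of_real_prod[symmetric] exp_sum[OF I, symmetric] by simp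
qed (auto simp: real_dist_normal_dist)

text \<open>\<open>h_cong\<close> mediates between the extensional functions of the product space
  and the total functions built from \<open>X\<close>.\<close>

lemma (in prob_space) nn_integral_normal_vec:
  fixes X :: "nat \<Rightarrow> 'a \<Rightarrow> real"
  assumes X[measurable]: "\<And>i. i < n \<Longrightarrow> X i \<in> borel_measurable M"
    and char: "\<And>t. (CLINT \<omega>|M. iexp (\<Sum>i<n. t i * X i \<omega>)) = of_real (exp (- (\<Sum>i<n. (t i)\<^sup>2) / 2))"
    and h[measurable]: "h \<in> borel_measurable (normal_vec {..<n})"
    and h_cong: "\<And>u v. (\<And>i. i < n \<Longrightarrow> u i = v i) \<Longrightarrow> h u = h v"
  shows "(\<integral>\<^sup>+\<omega>. h (\<lambda>i. X i \<omega>) \<partial>M) = (\<integral>\<^sup>+v. h v \<partial>normal_vec {..<n})"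
proof -
  have "(\<integral>\<^sup>+v. h v \<partial>normal_vec {..<n}) = (\<integral>\<^sup>+v. h v \<partial>distr M (\<Pi>\<^sub>M i\<in>{..<n}. borel) (\<lambda>\<omega>. \<lambda>i\<in>{..<n}. X i \<omega>))"
    by (subst distr_eq_normal_vec[OF _ _ char]) auto
  also have "\<dots> = (\<integral>\<^sup>+\<omega>. h (\<lambda>i\<in>{..<n}. X i \<omega>) \<partial>M)"
    by (rule nn_integral_distr) (auto simp: measurable_cong_sets[OF sets_normal_vec refl, symmetric])
  also have "\<dots> = (\<integral>\<^sup>+\<omega>. h (\<lambda>i. X i \<omega>) \<partial>M)"
    by (intro nn_integral_cong h_cong) auto
  finally show ?thesis ..
qed

lemma normal_vec_pair_iexp_sum:
  fixes a :: "'i \<Rightarrow> real" and b :: "'j \<Rightarrow> real"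
  assumes I: "finite I" and J: "finite J"
  shows "(CLINT \<omega>|normal_vec I \<Otimes>\<^sub>M normal_vec J. iexp ((\<Sum>i\<in>I. a i * fst \<omega> i) + (\<Sum>j\<in>J. b j * snd \<omega> j)))
    = of_real (exp (- ((\<Sum>i\<in>I. (a i)\<^sup>2) + (\<Sum>j\<in>J. (b j)\<^sup>2)) / 2))"
proof -
  define A where "A x = (\<Sum>i\<in>I. a i * x i)" for x :: "'i \<Rightarrow> real"
  define B where "B x = (\<Sum>i\<in>J. b i * x i)" for x :: "'j \<Rightarrow> real"
  have A[measurable]: "A \<in> borel_measurable (normal_vec I)" unfolding A_def by measurable
  have B[measurable]: "B \<in> borel_measurable (normal_vec J)" unfolding B_def by measurable
  have "(CLINT \<omega>|normal_vec I \<Otimes>\<^sub>M normal_vec J. iexp (A (fst \<omega>) + B (snd \<omega>)))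
    = (CLINT x|normal_vec I. CLINT y|normal_vec J. iexp (A x + B y))"
    by (subst normal_vec_pair.integral_fst'[symmetric])
      (auto intro!: normal_vec_pair.P.integrable_iexp)
  also have "\<dots> = (CLINT x|normal_vec I. iexp (A x) * (CLINT y|normal_vec J. iexp (B y)))"
    by (subst integral_mult_right_zero[symmetric]) (simp add: distrib_left exp_add)
  also have "\<dots> = of_real (exp (- (\<Sum>i\<in>I. (a i)\<^sup>2) / 2)) * of_real (exp (- (\<Sum>j\<in>J. (b j)\<^sup>2) / 2))"
    unfolding A_def B_def by (simp only: integral_mult_left_zero normal_vec_iexp[OF I] normal_vec_iexp[OF J])
  also have "\<dots> = of_real (exp (- ((\<Sum>i\<in>I. (a i)\<^sup>2) + (\<Sum>j\<in>J. (b j)\<^sup>2)) / 2))"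
    by (simp add: exp_add[symmetric] add_divide_distrib flip: of_real_mult)
  finally show ?thesis unfolding A_def B_def .
qed

lemma normal_vec_pair_iexp:
  "(CLINT \<omega>|normal_vec {..<n} \<Otimes>\<^sub>M normal_vec {..<n}. iexp (ip n a (fst \<omega>) + ip n b (snd \<omega>)))
    = of_real (exp (- (ip n a a + ip n b b) / 2))"
  using normal_vec_pair_iexp_sum[of "{..<n}" "{..<n}" a b] by (simp add: ip_def power2_eq_square)

section \<open>Measurability of the regression quantities\<close>

lemma measurable_ip:
  assumes "\<And>i. i < n \<Longrightarrow> (\<lambda>x. u x i) \<in> borel_measurable M" "\<And>i. i < n \<Longrightarrow> (\<lambda>x. v x i) \<in> borel_measurable M"
  shows "(\<lambda>x. ip n (u x) (v x)) \<in> borel_measurable M"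
  unfolding ip_def using assms by (intro borel_measurable_sum borel_measurable_times) auto

lemma measurable_res:
  assumes "\<And>i. i < n \<Longrightarrow> (\<lambda>x. v x i) \<in> borel_measurable M"
    "\<And>j i. j < k \<Longrightarrow> i < n \<Longrightarrow> (\<lambda>x. Z x j i) \<in> borel_measurable M" "i < n"
  shows "(\<lambda>x. res n (Z x) k (v x) i) \<in> borel_measurable M"
  using assms
proof (induction k arbitrary: v i)
  case (Suc k)
  have [measurable]: "(\<lambda>x. res n (Z x) k (v x) i) \<in> borel_measurable M"
    "(\<lambda>x. res n (Z x) k (Z x k) i) \<in> borel_measurable M" if "i < n" for i
    using that Suc.prems by (auto intro!: Suc.IH)
  have [measurable]: "(\<lambda>x. ip n (res n (Z x) k (v x)) (res n (Z x) k (Z x k))) \<in> borel_measurable M"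
    "(\<lambda>x. ip n (res n (Z x) k (Z x k)) (res n (Z x) k (Z x k))) \<in> borel_measurable M"
    by (rule measurable_ip; simp)+
  show ?case using Suc.prems(3) unfolding res.simps by measurable
qed simp

lemma measurable_kap:
  assumes "\<And>i. i < n \<Longrightarrow> (\<lambda>x. v x i) \<in> borel_measurable M"
    "\<And>j i. j \<le> k \<Longrightarrow> i < n \<Longrightarrow> (\<lambda>x. Z x j i) \<in> borel_measurable M"
  shows "(\<lambda>x. kap n (Z x) k (v x)) \<in> borel_measurable M"
  unfolding kap_def using assms
  by (intro borel_measurable_divide measurable_ip measurable_res) auto

lemma measurable_coef:
  assumes "\<And>i. i < n \<Longrightarrow> (\<lambda>x. v x i) \<in> borel_measurable M"
    "\<And>j i. j < k \<Longrightarrow> i < n \<Longrightarrow> (\<lambda>x. Z x j i) \<in> borel_measurable M"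
  shows "(\<lambda>x. coef n (Z x) k (v x) j) \<in> borel_measurable M"
  using assms
proof (induction k arbitrary: v)
  case (Suc k)
  have [measurable]: "(\<lambda>x. kap n (Z x) k (v x)) \<in> borel_measurable M"
    by (rule measurable_kap) (use Suc.prems in auto)
  have "(\<lambda>x. coef n (Z x) k (\<lambda>i. v x i - kap n (Z x) k (v x) * Z x k i) j) \<in> borel_measurable M"
    using Suc.prems by (intro Suc.IH borel_measurable_diff borel_measurable_times) auto
  then show ?case by (cases "j = k") auto
qed simp

lemma measurable_component_normal_vec:
  "i \<in> I \<Longrightarrow> f \<in> M \<rightarrow>\<^sub>M normal_vec I \<Longrightarrow> (\<lambda>x. f x i) \<in> borel_measurable M"
  unfolding measurable_cong_sets[OF refl sets_normal_vec]
  by (rule measurable_compose[OF _ measurable_component_singleton])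

lemma component_normal_vec [measurable (raw)]: "i \<in> I \<Longrightarrow> (\<lambda>v. v i) \<in> borel_measurable (normal_vec I)"
  by (rule measurable_component_normal_vec) auto

lemma components_normal_vec_pair [measurable (raw)]:
  "i \<in> I \<Longrightarrow> (\<lambda>x. fst x i) \<in> borel_measurable (normal_vec I \<Otimes>\<^sub>M M)"
  "i \<in> I \<Longrightarrow> (\<lambda>x. snd x i) \<in> borel_measurable (M \<Otimes>\<^sub>M normal_vec I)"
  by (rule measurable_component_normal_vec, assumption, rule measurable_fst measurable_snd)+

lemma nn_integral_normal_vec_pair:
  fixes X :: "nat \<Rightarrow> (nat \<Rightarrow> real) \<times> (nat \<Rightarrow> real) \<Rightarrow> real" and n :: nat
  defines "N \<equiv> normal_vec {..<n}"
  assumes X: "\<And>i. i < n \<Longrightarrow> X i \<in> borel_measurable (N \<Otimes>\<^sub>M N)"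
    and char: "\<And>t. (CLINT \<omega>|N \<Otimes>\<^sub>M N. iexp (\<Sum>i<n. t i * X i \<omega>)) = of_real (exp (- (\<Sum>i<n. (t i)\<^sup>2) / 2))"
    and h: "h \<in> borel_measurable N"
    and h_cong: "\<And>u v. (\<And>i. i < n \<Longrightarrow> u i = v i) \<Longrightarrow> h u = h v"
  shows "(\<integral>\<^sup>+v. h v \<partial>N) = (\<integral>\<^sup>+v. \<integral>\<^sup>+w. h (\<lambda>i. X i (v, w)) \<partial>N \<partial>N)"
proof -
  have "(\<lambda>\<omega>. \<lambda>i\<in>{..<n}. X i \<omega>) \<in> N \<Otimes>\<^sub>M N \<rightarrow>\<^sub>M N"
    using X unfolding N_def measurable_cong_sets[OF refl sets_normal_vec] by (intro measurable_restrict) auto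
  then have "(\<lambda>\<omega>. h (\<lambda>i\<in>{..<n}. X i \<omega>)) \<in> borel_measurable (N \<Otimes>\<^sub>M N)"
    using h by (rule measurable_compose)
  also have "(\<lambda>\<omega>. h (\<lambda>i\<in>{..<n}. X i \<omega>)) = (\<lambda>\<omega>. h (\<lambda>i. X i \<omega>))"
    by (intro ext h_cong) auto
  finally have hX: "(\<lambda>\<omega>. h (\<lambda>i. X i \<omega>)) \<in> borel_measurable (N \<Otimes>\<^sub>M N)" .
  have "(\<integral>\<^sup>+v. h v \<partial>N) = (\<integral>\<^sup>+\<omega>. h (\<lambda>i. X i \<omega>) \<partial>(N \<Otimes>\<^sub>M N))"
    using normal_vec_pair.P.nn_integral_normal_vec[OF X[unfolded N_def] char[unfolded N_def] h[unfolded N_def] h_cong]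
    unfolding N_def by simp
  also have "\<dots> = (\<integral>\<^sup>+v. \<integral>\<^sup>+w. h (\<lambda>i. X i (v, w)) \<partial>N \<partial>N)"
    using hX unfolding N_def by (rule normal_vec.nn_integral_fst[symmetric])
  finally show ?thesis .
qed

text \<open>The fitted part and the residual of a standard normal vector are independent.\<close>

lemma nn_integral_split_res:
  assumes h: "h \<in> borel_measurable (normal_vec {..<n})"
    and h_cong: "\<And>u v. (\<And>i. i < n \<Longrightarrow> u i = v i) \<Longrightarrow> h u = h v"
  shows "(\<integral>\<^sup>+v. h v \<partial>normal_vec {..<n}) =
    (\<integral>\<^sup>+v. \<integral>\<^sup>+w. h (\<lambda>i. v i - res n Z k v i + res n Z k w i) \<partial>normal_vec {..<n} \<partial>normal_vec {..<n})"
proof -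
  let ?N = "normal_vec {..<n}"
  let ?X = "\<lambda>i \<omega>. fst \<omega> i - res n Z k (fst \<omega>) i + res n Z k (snd \<omega>) i"
  have X[measurable]: "i < n \<Longrightarrow> ?X i \<in> borel_measurable (?N \<Otimes>\<^sub>M ?N)" for i
    by (intro borel_measurable_add borel_measurable_diff measurable_res) auto
  have char: "(CLINT \<omega>|?N \<Otimes>\<^sub>M ?N. iexp (\<Sum>i<n. t i * ?X i \<omega>)) = of_real (exp (- (\<Sum>i<n. (t i)\<^sup>2) / 2))" for t
  proof -
    \<comment> \<open>Self-adjointness moves both projections from the random vectors to
      \<open>t\<close>; \<open>ip_minus_res\<close> then adds the two variances to the squared norm
      of \<open>t\<close>.\<close>
    have "(\<Sum>i<n. t i * ?X i \<omega>) = ip n (\<lambda>i. t i - res n Z k t i) (fst \<omega>) + ip n (res n Z k t) (snd \<omega>)" for \<omega>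
    proof -
      have "(\<Sum>i<n. t i * ?X i \<omega>) = ip n t (\<lambda>i. fst \<omega> i - res n Z k (fst \<omega>) i + res n Z k (snd \<omega>) i)"
        by (simp add: ip_def)
      also have "\<dots> = ip n t (fst \<omega>) - ip n t (res n Z k (fst \<omega>)) + ip n t (res n Z k (snd \<omega>))"
        by (simp add: ip_linear)
      also have "\<dots> = ip n (\<lambda>i. t i - res n Z k t i) (fst \<omega>) + ip n (res n Z k t) (snd \<omega>)"
        unfolding ip_linear ip_res_left[of n t] ip_res_right[of n Z k t "fst \<omega>"] ip_res_right[of n Z k t "snd \<omega>"] ..
      finally show ?thesis .
    qed
    then show ?thesis
      by (simp only: normal_vec_pair_iexp ip_minus_res) (simp add: ip_def power2_eq_square)
  qed
  show ?thesis
    using nn_integral_normal_vec_pair[OF X char h h_cong] by simp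
qed

text \<open>For fixed \<open>c\<close> the entries of \<open>v - c * z\<close> are independent with
  variance \<open>1 + c\<^sup>2\<close>. In the application \<open>c\<close> is the coefficient of
  the last column, after it has been made independent of \<open>v\<close> and
  \<open>z\<close>.\<close>

lemma nn_integral_combine:
  fixes c :: real and n :: nat
  assumes h: "h \<in> borel_measurable (normal_vec {..<n})"
    and h_cong: "\<And>u v. (\<And>i. i < n \<Longrightarrow> u i = v i) \<Longrightarrow> h u = h v"
  shows "(\<integral>\<^sup>+z. \<integral>\<^sup>+v. h (\<lambda>i. (v i - c * z i) / sqrt (1 + c\<^sup>2)) \<partial>normal_vec {..<n} \<partial>normal_vec {..<n})
    = (\<integral>\<^sup>+v. h v \<partial>normal_vec {..<n})"
proof -
  let ?N = "normal_vec {..<n}"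
  let ?X = "\<lambda>i \<omega>. (snd \<omega> i - c * fst \<omega> i) / sqrt (1 + c\<^sup>2)"
  have c: "1 + c\<^sup>2 > 0" by (simp add: add_pos_nonneg)
  have X[measurable]: "i < n \<Longrightarrow> ?X i \<in> borel_measurable (?N \<Otimes>\<^sub>M ?N)" for i
    by measurable
  have char: "(CLINT \<omega>|?N \<Otimes>\<^sub>M ?N. iexp (\<Sum>i<n. t i * ?X i \<omega>)) = of_real (exp (- (\<Sum>i<n. (t i)\<^sup>2) / 2))" for t
  proof -
    let ?s = "1 / sqrt (1 + c\<^sup>2)"
    have "(\<Sum>i<n. t i * ?X i \<omega>) = ip n (\<lambda>i. (- c * ?s) * t i) (fst \<omega>) + ip n (\<lambda>i. ?s * t i) (snd \<omega>)" for \<omega>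
      unfolding ip_def sum.distrib[symmetric] by (intro sum.cong refl) (simp add: add_divide_distrib[symmetric] diff_divide_distrib algebra_simps)
    moreover have "ip n (\<lambda>i. (- c * ?s) * t i) (\<lambda>i. (- c * ?s) * t i) + ip n (\<lambda>i. ?s * t i) (\<lambda>i. ?s * t i)
        = (c * c + 1) * (?s * ?s) * ip n t t"
      unfolding ip_scale_left ip_scale_right by (simp only: algebra_simps mult_minus_left mult_minus_right minus_minus)
    moreover have "(c * c + 1) * (?s * ?s) = 1"
      using c by (simp add: power2_eq_square)
    ultimately show ?thesis
      by (simp only: normal_vec_pair_iexp) (simp add: ip_def power2_eq_square)
  qed
  show ?thesis
    using nn_integral_normal_vec_pair[OF X char h h_cong] by simp
qed

lemma nn_integral_ip:
  assumes f[measurable]: "f \<in> borel_measurable borel" and r: "ip n r r = 1"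
  shows "(\<integral>\<^sup>+v. f (ip n v r) \<partial>normal_vec {..<n}) = (\<integral>\<^sup>+g. f g \<partial>std_normal_distribution)"
proof -
  let ?N = "normal_vec {..<n}"
  have m[measurable]: "(\<lambda>v. ip n v r) \<in> borel_measurable ?N" unfolding ip_def by measurable
  have "distr ?N borel (\<lambda>v. ip n v r) = std_normal_distribution"
  proof (rule Levy_uniqueness[OF normal_vec.real_distribution_distr[OF m] real_dist_normal_dist], rule ext)
    fix t
    have "char (distr ?N borel (\<lambda>v. ip n v r)) t = (CLINT v|?N. iexp (\<Sum>i<n. (t * r i) * v i))"
      unfolding char_def by (subst integral_distr) (auto simp: ip_def sum_distrib_left mult_ac)
    also have "\<dots> = of_real (exp (- (t\<^sup>2 * ip n r r) / 2))"
      unfolding normal_vec_iexp[OF finite_lessThan]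
      by (simp add: ip_def power_mult_distrib sum_distrib_left power2_eq_square mult_ac)
    finally show "char (distr ?N borel (\<lambda>v. ip n v r)) t = char std_normal_distribution t"
      by (simp add: r char_std_normal_distribution)
  qed
  then have "(\<integral>\<^sup>+g. f g \<partial>std_normal_distribution) = (\<integral>\<^sup>+g. f g \<partial>distr ?N borel (\<lambda>v. ip n v r))" by simp
  also have "\<dots> = (\<integral>\<^sup>+v. f (ip n v r) \<partial>?N)" by (rule nn_integral_distr[OF m]) (simp add: f)
  finally show ?thesis ..
qed

section \<open>Residual sums of squares and Gaussian tilting\<close>

definition rss :: "nat \<Rightarrow> (nat \<Rightarrow> nat \<Rightarrow> real) \<Rightarrow> nat \<Rightarrow> (nat \<Rightarrow> real) \<Rightarrow> real" where
  "rss n Z k v = ip n (res n Z k v) (res n Z k v)"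

lemma rss_nonneg [simp]: "rss n Z k v \<ge> 0"
  by (simp add: rss_def ip_self_nonneg)

lemma measurable_rss:
  assumes "\<And>i. i < n \<Longrightarrow> (\<lambda>x. v x i) \<in> borel_measurable M"
    "\<And>j i. j < k \<Longrightarrow> i < n \<Longrightarrow> (\<lambda>x. Z x j i) \<in> borel_measurable M"
  shows "(\<lambda>x. rss n (Z x) k (v x)) \<in> borel_measurable M"
proof -
  have r: "(\<lambda>x. res n (Z x) k (v x) i) \<in> borel_measurable M" if "i < n" for i
    using assms that by (rule measurable_res)
  show ?thesis unfolding rss_def by (rule measurable_ip[OF r r])
qed

lemma rss_cong:
  assumes "\<And>i. i < n \<Longrightarrow> u i = v i" "\<And>j i. j < k \<Longrightarrow> i < n \<Longrightarrow> Z j i = Z' j i"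
  shows "rss n Z k u = rss n Z' k v"
  unfolding rss_def using assms by (intro ip_cong res_cong) auto

lemma rss_normal_vec [measurable]: "(\<lambda>v. rss n Z k v) \<in> borel_measurable (normal_vec {..<n})"
  by (rule measurable_rss[where v="\<lambda>v. v"]) auto

lemma ip_normal_vec: "(\<lambda>v. ip n v r) \<in> borel_measurable (normal_vec {..<n})"
  by (rule measurable_ip[where u="\<lambda>v. v"]) auto

lemma ip_self_normal_vec: "(\<lambda>v. ip n v v) \<in> borel_measurable (normal_vec {..<n})"
  by (rule measurable_ip[where u="\<lambda>v. v" and v="\<lambda>v. v"]) auto

text \<open>A normal density times a Gaussian weight is again normal: the precision 1 becomes
  \<open>1 + l\<close>. Negative \<open>l\<close> is included because upper tails call for
  it.\<close>

lemma std_normal_tilt: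
  fixes l :: real
  assumes l: "l > -1"
  shows "density std_normal_distribution (\<lambda>x. ennreal (sqrt (1 + l) * exp (- l * x\<^sup>2 / 2)))
    = distr std_normal_distribution std_normal_distribution (\<lambda>x. x / sqrt (1 + l))"
proof -
  interpret prob_space std_normal_distribution by (rule prob_std_normal)
  define s where "s = sqrt (1 + l)"
  have s: "s > 0" "s\<^sup>2 = 1 + l" using l by (auto simp: s_def)
  have "distributed std_normal_distribution lborel (\<lambda>x. x) std_normal_density"
    unfolding distributed_def by (auto simp: distr_id2)
  from normal_density_affine[OF this, of "1 / s" 0] s
  have "distr std_normal_distribution lborel (\<lambda>x. x / s) = density lborel (normal_density 0 (1 / s))"
    by (simp add: distributed_def)
  moreover have "distr std_normal_distribution lborel (\<lambda>x. x / s) = distr std_normal_distribution std_normal_distribution (\<lambda>x. x / s)"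
    by (rule distr_cong) auto
  moreover have "density std_normal_distribution (\<lambda>x. ennreal (s * exp (- l * x\<^sup>2 / 2))) = density lborel (normal_density 0 (1 / s))"
  proof -
    have "std_normal_density x * (s * exp (- l * x\<^sup>2 / 2)) = normal_density 0 (1 / s) x" for x
    proof -
      have "exp (- x\<^sup>2 / 2) * exp (- l * x\<^sup>2 / 2) = exp (- (x\<^sup>2 * s\<^sup>2) / 2)"
        unfolding s(2) exp_add[symmetric] by (simp add: field_simps)
      then show ?thesis using s(1)
        by (simp add: normal_density_def real_sqrt_mult real_sqrt_divide power_divide field_simps)
    qed
    then show ?thesis
      by (subst density_density_eq) (auto simp: ennreal_mult'[symmetric])
  qed
  ultimately show ?thesis by (simp add: s_def)
qed

text \<open>The weight factors over the entries, so each entry is tilted by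
  \<open>std_normal_tilt\<close>; in law this divides the whole vector by
  \<open>sqrt (1 + l)\<close>.\<close>

lemma nn_integral_normal_vec_tilt:
  fixes l :: real and n :: nat
  assumes l: "l > -1" and h[measurable]: "h \<in> borel_measurable (normal_vec {..<n})"
    and h_cong: "\<And>u v. (\<And>i. i < n \<Longrightarrow> u i = v i) \<Longrightarrow> h u = h v"
  shows "(\<integral>\<^sup>+z. h z * ennreal (exp (- l * ip n z z / 2)) \<partial>normal_vec {..<n})
    = ennreal ((1 + l) powr (- n / 2)) * (\<integral>\<^sup>+z. h (\<lambda>i. z i / sqrt (1 + l)) \<partial>normal_vec {..<n})"
proof -
  let ?N = "std_normal_distribution" and ?I = "{..<n}"
  define s where "s = sqrt (1 + l)"
  have s: "s > 0" using l by (simp add: s_def)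
  define g where "g x = ennreal (s * exp (- l * x\<^sup>2 / 2))" for x :: real
  have g[measurable]: "g \<in> borel_measurable borel" unfolding g_def by measurable
  interpret N: product_prob_space "\<lambda>_::nat. ?N" ?I by (intro product_prob_spaceI prob_std_normal)
  have D: "density ?N g = distr ?N ?N (\<lambda>x. x / s)"
    unfolding g_def s_def by (rule std_normal_tilt[OF l])
  have pD: "prob_space (density ?N g)"
    unfolding D by (intro prob_space.prob_space_distr prob_std_normal) auto
  interpret D: product_prob_space "\<lambda>_::nat. density ?N g" ?I by (intro product_prob_spaceI pD)
  have Ds: "sets (normal_vec ?I) = sets (Pi\<^sub>M ?I (\<lambda>_. density ?N g))"
    unfolding normal_vec_def by (intro sets_PiM_cong) auto
  have 1: "density (normal_vec ?I) (\<lambda>z. \<Prod>i\<in>?I. g (z i)) = PiM ?I (\<lambda>_. density ?N g)"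
  proof (rule D.PiM_eqI)
    fix A assume A: "\<And>i. i \<in> ?I \<Longrightarrow> A i \<in> sets (density ?N g)"
    then have A'[measurable]: "\<And>i. i \<in> ?I \<Longrightarrow> A i \<in> sets borel" by simp
    have "Pi\<^sub>E ?I A \<in> sets (Pi\<^sub>M ?I (\<lambda>_. density ?N g))" using A by (intro sets_PiM_I_finite) auto
    then have PA: "Pi\<^sub>E ?I A \<in> sets (normal_vec ?I)" unfolding Ds .
    have "emeasure (density (normal_vec ?I) (\<lambda>z. \<Prod>i\<in>?I. g (z i))) (Pi\<^sub>E ?I A)
        = (\<integral>\<^sup>+z. (\<Prod>i\<in>?I. g (z i)) * indicator (Pi\<^sub>E ?I A) z \<partial>normal_vec ?I)"
      using PA by (intro emeasure_density) auto
    also have "\<dots> = (\<integral>\<^sup>+z. (\<Prod>i\<in>?I. g (z i) * indicator (A i) (z i)) \<partial>normal_vec ?I)"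
    proof (intro nn_integral_cong)
      fix z assume "z \<in> space (normal_vec ?I)"
      then have "indicator (Pi\<^sub>E ?I A) z = (\<Prod>i\<in>?I. indicator (A i) (z i) :: ennreal)"
        by (auto simp: space_normal_vec indicator_def PiE_iff)
      then show "(\<Prod>i\<in>?I. g (z i)) * indicator (Pi\<^sub>E ?I A) z = (\<Prod>i\<in>?I. g (z i) * indicator (A i) (z i))"
        by (simp add: prod.distrib)
    qed
    also have "\<dots> = (\<Prod>i\<in>?I. \<integral>\<^sup>+x. g x * indicator (A i) x \<partial>?N)"
      unfolding normal_vec_def by (intro N.product_nn_integral_prod) auto
    also have "\<dots> = (\<Prod>i\<in>?I. emeasure (density ?N g) (A i))"
      by (intro prod.cong refl emeasure_density[symmetric]) auto
    finally show "emeasure (density (normal_vec ?I) (\<lambda>z. \<Prod>i\<in>?I. g (z i))) (Pi\<^sub>E ?I A)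
      = (\<Prod>i\<in>?I. emeasure (density ?N g) (A i))" .
  qed (auto simp: Ds)
  have 2: "PiM ?I (\<lambda>_. density ?N g) = distr (normal_vec ?I) (normal_vec ?I) (compose ?I (\<lambda>x. x / s))"
    unfolding D normal_vec_def
    by (rule distr_PiM_finite_prob_space[symmetric]) (auto intro: product_prob_spaceI prob_std_normal)
  have cm: "compose ?I (\<lambda>x. x / s) \<in> normal_vec ?I \<rightarrow>\<^sub>M normal_vec ?I"
    unfolding measurable_cong_sets[OF refl sets_normal_vec] compose_def
    by (intro measurable_restrict) auto
  have prod_g: "(\<Prod>i\<in>?I. g (z i)) = ennreal (s ^ n) * ennreal (exp (- l * ip n z z / 2))" for z
  proof -
    have "(\<Prod>i\<in>?I. g (z i)) = ennreal (\<Prod>i\<in>?I. s * exp (- l * (z i)\<^sup>2 / 2))"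
      unfolding g_def using s by (intro prod_ennreal) auto
    also have "(\<Prod>i\<in>?I. s * exp (- l * (z i)\<^sup>2 / 2)) = s ^ n * exp (\<Sum>i\<in>?I. - l * (z i)\<^sup>2 / 2)"
      by (simp add: prod.distrib exp_sum)
    also have "(\<Sum>i\<in>?I. - l * (z i)\<^sup>2 / 2) = - l * ip n z z / 2"
      by (simp add: ip_def sum_distrib_left sum_divide_distrib power2_eq_square mult.assoc)
    finally show ?thesis using s by (simp add: ennreal_mult)
  qed
  define q where "q z = ip n z z" for z
  have q: "q \<in> borel_measurable (normal_vec ?I)"
    unfolding q_def by (rule ip_self_normal_vec)
  have hm: "(\<lambda>z. h z * ennreal (exp (- l * q z / 2))) \<in> borel_measurable (normal_vec ?I)"
    using q by measurable
  have gm: "(\<lambda>z. \<Prod>i\<in>?I. g (z i)) \<in> borel_measurable (normal_vec ?I)"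
    by (intro borel_measurable_prod_ennreal measurable_compose[OF component_normal_vec g]) auto
  have "ennreal (s ^ n) * (\<integral>\<^sup>+z. h z * ennreal (exp (- l * q z / 2)) \<partial>normal_vec ?I)
      = (\<integral>\<^sup>+z. ennreal (s ^ n) * (h z * ennreal (exp (- l * q z / 2))) \<partial>normal_vec ?I)"
    by (rule nn_integral_cmult[symmetric, OF hm])
  also have "\<dots> = (\<integral>\<^sup>+z. (\<Prod>i\<in>?I. g (z i)) * h z \<partial>normal_vec ?I)"
    unfolding prod_g q_def by (simp only: mult_ac)
  also have "\<dots> = (\<integral>\<^sup>+z. h z \<partial>density (normal_vec ?I) (\<lambda>z. \<Prod>i\<in>?I. g (z i)))"
    by (rule nn_integral_density[symmetric, OF gm h])
  also have "\<dots> = (\<integral>\<^sup>+z. h (compose ?I (\<lambda>x. x / s) z) \<partial>normal_vec ?I)"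
    unfolding 1 2 by (rule nn_integral_distr[OF cm]) (simp add: h)
  also have "\<dots> = (\<integral>\<^sup>+z. h (\<lambda>i. z i / s) \<partial>normal_vec ?I)"
    by (intro nn_integral_cong h_cong) (auto simp: compose_def)
  finally have *: "ennreal (s ^ n) * (\<integral>\<^sup>+z. h z * ennreal (exp (- l * q z / 2)) \<partial>normal_vec ?I)
    = (\<integral>\<^sup>+z. h (\<lambda>i. z i / s) \<partial>normal_vec ?I)" .
  have "(1 + l) powr (- n / 2) * s ^ n = 1"
    using l s by (simp add: s_def powr_half_sqrt[symmetric] powr_powr powr_minus flip: powr_realpow)
  then have "ennreal ((1 + l) powr (- n / 2)) * ennreal (s ^ n) = 1"
    using s by (subst ennreal_mult[symmetric]) auto
  then show ?thesis unfolding s_def[symmetric] q_def[symmetric] *[symmetric] mult.assoc[symmetric] by simp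
qed

lemma nn_integral_std_normal_exp:
  assumes l: "l > -1"
  shows "(\<integral>\<^sup>+g. ennreal (exp (- l * g\<^sup>2 / 2)) \<partial>std_normal_distribution) = ennreal ((1 + l) powr (- 1 / 2))"
proof -
  have "(\<integral>\<^sup>+g. ennreal (exp (- l * g\<^sup>2 / 2)) \<partial>std_normal_distribution)
      = (\<integral>\<^sup>+v. ennreal (exp (- l * (ip 1 v (\<lambda>_. 1))\<^sup>2 / 2)) \<partial>normal_vec {..<1})"
    by (rule nn_integral_ip[symmetric]) (auto simp: ip_def)
  also have "\<dots> = ennreal ((1 + l) powr (- 1 / 2))"
    using nn_integral_normal_vec_tilt[OF l, of "\<lambda>_. 1" 1] normal_vec.emeasure_space_1[of "{..<1::nat}"]
    by (simp add: ip_def power2_eq_square)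
  finally show ?thesis .
qed

text \<open>Column \<open>k\<close> removes the squared component along its residual. If that
  residual vanishes, the quotient is zero by \<open>x / 0 = 0\<close> and both sums agree.\<close>

lemma rss_Suc: "rss n Z k v = rss n Z (Suc k) v + (ip n v (res n Z k (Z k)))\<^sup>2 / rss n Z k (Z k)"
proof (cases "rss n Z k (Z k) = 0")
  case True
  then show ?thesis by (simp add: rss_def)
next
  case False
  let ?r = "res n Z k (Z k)"
  have e: "ip n v ?r = ip n (res n Z k v) ?r" by (rule ip_res_left)
  show ?thesis using False unfolding e rss_def res_Suc_kap ip_linear kap_def ip_commute[of n ?r "res n Z k v"]
    by (simp add: power2_eq_square)
qed

text \<open>Evaluation at the recombined vector of \<open>nn_integral_split_res\<close>, made of the
  fit of \<open>v\<close> and the residual of \<open>w\<close>: the squared norm is a sum over the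
  two parts, and the quantities in the next lemmas see only one of them.\<close>

lemma ip_fit_residual:
  "ip n (\<lambda>i. v i - res n Z k v i + res n Z k w i) (\<lambda>i. v i - res n Z k v i + res n Z k w i)
    = ip n (\<lambda>i. v i - res n Z k v i) (\<lambda>i. v i - res n Z k v i) + rss n Z k w"
proof -
  have 0: "ip n (\<lambda>i. v i - res n Z k v i) (res n Z k w) = 0"
    unfolding ip_linear ip_res_left[of n v] by simp
  then have "ip n (res n Z k w) (\<lambda>i. v i - res n Z k v i) = 0"
    by (simp only: ip_commute)
  with 0 show ?thesis unfolding rss_def ip_add_left ip_add_right by simp
qed

lemma res_fit_residual:
  "i < n \<Longrightarrow> res n Z k (\<lambda>i. v i - res n Z k v i + res n Z k w i) i = res n Z k w i"
  using res_linear[of n Z k 1 "\<lambda>i. v i - 1 * res n Z k v i" 1 "res n Z k w"]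
  unfolding res_diff_scale by (simp add: res_idem)

lemma rss_fit_residual:
  "rss n Z k (\<lambda>i. v i - res n Z k v i + res n Z k w i) = rss n Z k w"
  unfolding rss_def by (intro ip_cong res_fit_residual)

text \<open>The residual of column \<open>k\<close> lies in the span of the first
  \<open>Suc k\<close> columns, hence is orthogonal to every residual after them.\<close>

lemma ip_fit_residual_column:
  "ip n (\<lambda>i. v i - res n Z (Suc k) v i + res n Z (Suc k) w i) (res n Z k (Z k)) = ip n v (res n Z k (Z k))"
proof -
  have 0: "ip n (res n Z (Suc k) u) (res n Z k (Z k)) = 0" for u
  proof -
    have "ip n (res n Z (Suc k) u) (res n Z k (Z k)) = ip n (res n Z (Suc k) u) (\<lambda>i. Z k i - (\<Sum>j<k. coef n Z k (Z k) j * Z j i))"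
      using coef_decomp[of "Z k" _ n Z k] by (intro ip_cong) (auto simp: algebra_simps)
    then show ?thesis unfolding ip_linear ip_sum_right
      using res_orthogonal[of _ "Suc k" n Z u] by (simp del: res.simps)
  qed
  show ?thesis unfolding ip_linear 0 by simp
qed

lemma ennreal_mult_right_cancel:
  fixes a b c :: ennreal
  assumes "a * b = c * b" "b \<noteq> 0" "b \<noteq> \<top>"
  shows "a = c"
proof -
  have "a = a * b / b" "c = c * b / b"
    using assms(2,3) by (simp_all add: mult_divide_eq_ennreal)
  then show ?thesis using assms(1) by simp
qed

lemma ennreal_exp_add: "ennreal (exp (a + b)) = ennreal (exp a) * ennreal (exp b)"
  by (simp add: exp_add ennreal_mult')
text \<open>The Laplace transform of a chi-square law with \<open>n - k\<close> degrees of freedom.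
  A further column splits off the square of an independent standard normal variable, whose factor
  \<open>(1 + l) powr (- 1 / 2)\<close> is cancelled from the transform for
  \<open>k\<close>.\<close>

lemma nn_integral_exp_rss:
  assumes l: "l > -1" and Z: "nondeg n Z k"
  shows "(\<integral>\<^sup>+v. ennreal (exp (- l * rss n Z k v / 2)) \<partial>normal_vec {..<n})
    = ennreal ((1 + l) powr (- (real n - real k) / 2))"
  using Z
proof (induction k)
  case 0
  then show ?case
    using nn_integral_normal_vec_tilt[OF l, of "\<lambda>_. 1" n] by (simp add: rss_def normal_vec.emeasure_space_1)
next
  case (Suc k)
  let ?N = "normal_vec {..<n}" and ?r = "res n Z k (Z k)"
  define a where "a v = ip n v ?r" for v
  have [measurable]: "a \<in> borel_measurable ?N"
    unfolding a_def by (rule ip_normal_vec)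
  have Zk: "nondeg n Z k" and r: "rss n Z k (Z k) > 0"
    using Suc.prems ip_self_nonneg[of n ?r] by (auto simp: nondeg_def rss_def less_le)
  define \<rho> where "\<rho> = rss n Z k (Z k)"
  have \<rho>: "\<rho> > 0" using r by (simp add: \<rho>_def)
  define A where "A = (\<integral>\<^sup>+w. ennreal (exp (- l * rss n Z (Suc k) w / 2)) \<partial>?N)"
  have "ennreal ((1 + l) powr (- (real n - real k) / 2)) = (\<integral>\<^sup>+v. ennreal (exp (- l * rss n Z k v / 2)) \<partial>?N)"
    using Suc.IH[OF Zk] ..
  also have "\<dots> = (\<integral>\<^sup>+v. ennreal (exp (- l * ((a v)\<^sup>2 / \<rho>) / 2)) * ennreal (exp (- l * rss n Z (Suc k) v / 2)) \<partial>?N)"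
  proof (intro nn_integral_cong)
    fix v
    have "- l * rss n Z k v / 2 = - l * ((a v)\<^sup>2 / \<rho>) / 2 + - l * rss n Z (Suc k) v / 2"
      unfolding rss_Suc[of n Z k v] \<rho>_def[symmetric] a_def by (simp only: add_divide_distrib[symmetric] distrib_left) (simp only: add.commute)
    then show "ennreal (exp (- l * rss n Z k v / 2))
      = ennreal (exp (- l * ((a v)\<^sup>2 / \<rho>) / 2)) * ennreal (exp (- l * rss n Z (Suc k) v / 2))"
      by (simp only: ennreal_exp_add)
  qed
  \<comment> \<open>\<open>a\<close> depends on the fitted part and the other factor on the residual
    with respect to \<open>Suc k\<close> columns; these parts are independent, so the integral
    becomes a product.\<close>
  also have "\<dots> = (\<integral>\<^sup>+v. \<integral>\<^sup>+w. ennreal (exp (- l * ((a v)\<^sup>2 / \<rho>) / 2)) * ennreal (exp (- l * rss n Z (Suc k) w / 2)) \<partial>?N \<partial>?N)"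
  proof -
    have h: "(\<lambda>v. ennreal (exp (- l * ((a v)\<^sup>2 / \<rho>) / 2)) * ennreal (exp (- l * rss n Z (Suc k) v / 2))) \<in> borel_measurable ?N"
      by measurable
    have cg: "ennreal (exp (- l * ((a u)\<^sup>2 / \<rho>) / 2)) * ennreal (exp (- l * rss n Z (Suc k) u / 2))
        = ennreal (exp (- l * ((a v)\<^sup>2 / \<rho>) / 2)) * ennreal (exp (- l * rss n Z (Suc k) v / 2))"
      if uv: "\<And>i. i < n \<Longrightarrow> u i = v i" for u v
    proof -
      have "a u = a v" unfolding a_def using uv by (intro ip_cong) auto
      moreover have "rss n Z (Suc k) u = rss n Z (Suc k) v" using uv by (intro rss_cong) auto
      ultimately show ?thesis by (simp only:)
    qed
    have fit: "a (\<lambda>i. v i - res n Z (Suc k) v i + res n Z (Suc k) w i) = a v" for v w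
      unfolding a_def by (rule ip_fit_residual_column)
    show ?thesis
      using nn_integral_split_res[OF h cg, where Z=Z and k="Suc k"] by (simp only: rss_fit_residual fit)
  qed
  also have "\<dots> = (\<integral>\<^sup>+v. ennreal (exp (- l * ((a v)\<^sup>2 / \<rho>) / 2)) \<partial>?N) * A"
    unfolding A_def by (simp add: nn_integral_cmult nn_integral_multc)
  also have "(\<integral>\<^sup>+v. ennreal (exp (- l * ((a v)\<^sup>2 / \<rho>) / 2)) \<partial>?N) = ennreal ((1 + l) powr (- 1 / 2))"
  proof -
    have "(\<integral>\<^sup>+v. ennreal (exp (- l * ((a v)\<^sup>2 / \<rho>) / 2)) \<partial>?N)
        = (\<integral>\<^sup>+v. ennreal (exp (- l * (ip n v (\<lambda>i. (1 / sqrt \<rho>) * ?r i))\<^sup>2 / 2)) \<partial>?N)"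
      unfolding ip_scale_right a_def using \<rho> by (simp add: power_divide)
    also have "\<dots> = (\<integral>\<^sup>+g. ennreal (exp (- l * g\<^sup>2 / 2)) \<partial>std_normal_distribution)"
    proof (rule nn_integral_ip)
      show "ip n (\<lambda>i. (1 / sqrt \<rho>) * ?r i) (\<lambda>i. (1 / sqrt \<rho>) * ?r i) = 1"
        unfolding ip_scale_left ip_scale_right using \<rho> by (simp add: \<rho>_def[unfolded rss_def, symmetric])
    qed auto
    finally show ?thesis using nn_integral_std_normal_exp[OF l] by simp
  qed
  finally have *: "ennreal ((1 + l) powr (- (real n - real k) / 2)) = ennreal ((1 + l) powr (- 1 / 2)) * A" .
  have "ennreal ((1 + l) powr (1 / 2)) * ennreal ((1 + l) powr (- 1 / 2)) = 1"
    using l by (simp flip: ennreal_mult' powr_add)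
  then have "A = ennreal ((1 + l) powr (1 / 2)) * (ennreal ((1 + l) powr (- 1 / 2)) * A)"
    by (simp add: mult.assoc[symmetric])
  also have "\<dots> = ennreal ((1 + l) powr (- (real n - real (Suc k)) / 2))"
    unfolding *[symmetric] using l by (simp add: field_simps flip: ennreal_mult' powr_add)
  finally show ?case unfolding A_def .
qed

text \<open>This replaces the chi-square density: under the weight, the residual sum of squares is
  divided by \<open>1 + l\<close> in law. The proof tilts the whole vector, whose squared norm is
  the residual sum of squares plus that of the fitted part.\<close>

lemma nn_integral_rss_tilt:
  assumes l: "l > -1" and Z: "nondeg n Z k" and f[measurable]: "f \<in> borel_measurable borel"
  shows "(\<integral>\<^sup>+v. f (rss n Z k v) * ennreal (exp (- l * rss n Z k v / 2)) \<partial>normal_vec {..<n})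
    = ennreal ((1 + l) powr (- (real n - real k) / 2)) * (\<integral>\<^sup>+v. f (rss n Z k v / (1 + l)) \<partial>normal_vec {..<n})"
proof -
  let ?N = "normal_vec {..<n}"
  let ?p = "\<lambda>v i. v i - res n Z k v i"
  have pm: "(\<lambda>v. ip n (?p v) (?p v)) \<in> borel_measurable ?N"
    by (rule measurable_ip; rule borel_measurable_diff; (rule measurable_res)?; simp)
  define q where "q v = ip n (?p v) (?p v)" for v
  have q[measurable]: "q \<in> borel_measurable ?N"
    unfolding q_def by (rule pm)
  define s where "s v = ip n v v" for v
  have s[measurable]: "s \<in> borel_measurable ?N"
    unfolding s_def by (rule ip_self_normal_vec)
  define B where "B = (\<integral>\<^sup>+v. ennreal (exp (- l * q v / 2)) \<partial>?N)"
  have split: "(\<integral>\<^sup>+v. f (rss n Z k v) * ennreal (exp (- l * rss n Z k v / 2)) \<partial>?N) * B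
      = ennreal ((1 + l) powr (- n / 2)) * (\<integral>\<^sup>+v. f (rss n Z k v / (1 + l)) \<partial>?N)"
    if f[measurable]: "f \<in> borel_measurable borel" for f
  proof -
    have "(\<integral>\<^sup>+v. f (rss n Z k v) * ennreal (exp (- l * s v / 2)) \<partial>?N)
       = (\<integral>\<^sup>+v. \<integral>\<^sup>+w. f (rss n Z k w) * ennreal (exp (- l * (q v + rss n Z k w) / 2)) \<partial>?N \<partial>?N)"
    proof -
      have h: "(\<lambda>v. f (rss n Z k v) * ennreal (exp (- l * s v / 2))) \<in> borel_measurable ?N"
        by measurable
      have cg: "f (rss n Z k u) * ennreal (exp (- l * s u / 2)) = f (rss n Z k v) * ennreal (exp (- l * s v / 2))"
        if uv: "\<And>i. i < n \<Longrightarrow> u i = v i" for u v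
      proof -
        have "s u = s v" unfolding s_def using uv by (intro ip_cong) auto
        moreover have "rss n Z k u = rss n Z k v" using uv by (intro rss_cong) auto
        ultimately show ?thesis by (simp only:)
      qed
      have fit: "s (\<lambda>i. v i - res n Z k v i + res n Z k w i) = q v + rss n Z k w" for v w
        unfolding s_def q_def by (rule ip_fit_residual)
      show ?thesis
        using nn_integral_split_res[OF h cg, where Z=Z and k=k] by (simp only: rss_fit_residual fit)
    qed
    also have "\<dots> = (\<integral>\<^sup>+v. \<integral>\<^sup>+w. ennreal (exp (- l * q v / 2)) * (f (rss n Z k w) * ennreal (exp (- l * rss n Z k w / 2))) \<partial>?N \<partial>?N)"
    proof (intro nn_integral_cong)
      fix v w
      have "ennreal (exp (- l * (q v + rss n Z k w) / 2))
        = ennreal (exp (- l * q v / 2)) * ennreal (exp (- l * rss n Z k w / 2))"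
        unfolding ennreal_exp_add[symmetric] by (simp only: add_divide_distrib distrib_left)
      then show "f (rss n Z k w) * ennreal (exp (- l * (q v + rss n Z k w) / 2))
        = ennreal (exp (- l * q v / 2)) * (f (rss n Z k w) * ennreal (exp (- l * rss n Z k w / 2)))"
        by (simp only: mult_ac)
    qed
    also have "\<dots> = B * (\<integral>\<^sup>+v. f (rss n Z k v) * ennreal (exp (- l * rss n Z k v / 2)) \<partial>?N)"
      unfolding B_def by (simp add: nn_integral_cmult nn_integral_multc)
    finally have "(\<integral>\<^sup>+v. f (rss n Z k v) * ennreal (exp (- l * rss n Z k v / 2)) \<partial>?N) * B
        = (\<integral>\<^sup>+v. f (rss n Z k v) * ennreal (exp (- l * s v / 2)) \<partial>?N)"
      by (simp add: mult.commute)
    also have "\<dots> = ennreal ((1 + l) powr (- n / 2)) * (\<integral>\<^sup>+v. f (rss n Z k (\<lambda>i. v i / sqrt (1 + l))) \<partial>?N)"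
      unfolding s_def
    proof (rule nn_integral_normal_vec_tilt[OF l])
      fix u v :: "nat \<Rightarrow> real" assume uv: "\<And>i. i < n \<Longrightarrow> u i = v i"
      have "rss n Z k u = rss n Z k v" using uv by (auto intro!: rss_cong)
      then show "f (rss n Z k u) = f (rss n Z k v)" by simp
    qed measurable
    also have "(\<lambda>v. f (rss n Z k (\<lambda>i. v i / sqrt (1 + l)))) = (\<lambda>v. f (rss n Z k v / (1 + l)))"
    proof
      fix v
      have "res n Z k (\<lambda>i. v i / sqrt (1 + l)) = (\<lambda>i. (1 / sqrt (1 + l)) * res n Z k v i)"
        using res_linear[of n Z k "1 / sqrt (1 + l)" v 0 v] by simp
      then have "rss n Z k (\<lambda>i. v i / sqrt (1 + l)) = rss n Z k v / (1 + l)"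
        unfolding rss_def by (simp only: ip_scale_left ip_scale_right) (use l in simp)
      then show "f (rss n Z k (\<lambda>i. v i / sqrt (1 + l))) = f (rss n Z k v / (1 + l))" by simp
    qed
    finally show ?thesis .
  qed
  \<comment> \<open>Taking \<open>f = 1\<close> identifies the contribution \<open>B\<close> of the
    fitted part, which is then cancelled.\<close>
  have one: "ennreal ((1 + l) powr (- (real n - real k) / 2)) * B = ennreal ((1 + l) powr (- n / 2))"
    using split[of "\<lambda>_. 1"] nn_integral_exp_rss[OF l Z] by (simp add: normal_vec.emeasure_space_1)
  have B: "B \<noteq> 0" "B \<noteq> \<top>"
    using one l by (auto simp: ennreal_mult_top ennreal_eq_0_iff split: if_splits)
  have "(\<integral>\<^sup>+v. f (rss n Z k v) * ennreal (exp (- l * rss n Z k v / 2)) \<partial>?N) * B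
    = (ennreal ((1 + l) powr (- (real n - real k) / 2)) * (\<integral>\<^sup>+v. f (rss n Z k v / (1 + l)) \<partial>?N)) * B"
    unfolding split[OF f] one[symmetric] by (simp add: mult_ac)
  then show ?thesis using B by (rule ennreal_mult_right_cancel)
qed

section \<open>The law of the regression coefficients\<close>

text \<open>The exponential in \<open>nn_integral_exp_rss\<close> is 1 where the residual vanishes.
  So the probability of that event is at most \<open>(1 + l) powr (- d)\<close> for every positive
  \<open>l\<close>, and this tends to zero.\<close>

lemma AE_rss_pos:
  assumes Z: "nondeg n Z k" and kn: "k < n"
  shows "AE z in normal_vec {..<n}. rss n Z k z > 0"
proof -
  let ?N = "normal_vec {..<n}"
  let ?S = "{z \<in> space ?N. rss n Z k z = 0}"
  have S[measurable]: "?S \<in> sets ?N" by measurable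
  define d where "d = (real n - real k) / 2"
  have d: "d > 0" using kn by (simp add: d_def)
  have le: "measure ?N ?S \<le> (1 + l) powr (- d)" if l: "l > 0" for l
  proof -
    have "ennreal (measure ?N ?S) = (\<integral>\<^sup>+z. indicator ?S z \<partial>?N)"
      by (simp add: normal_vec.emeasure_eq_measure)
    also have "\<dots> \<le> (\<integral>\<^sup>+z. ennreal (exp (- l * rss n Z k z / 2)) \<partial>?N)"
      by (intro nn_integral_mono) (auto simp: indicator_def)
    also have "\<dots> = ennreal ((1 + l) powr (- d))"
      unfolding d_def minus_divide_left using l by (intro nn_integral_exp_rss Z) auto
    finally show ?thesis by (simp add: ennreal_le_iff)
  qed
  have "((\<lambda>l. (1 + l) powr (- d)) \<longlongrightarrow> 0) at_top"
    using d by (intro tendsto_neg_powr filterlim_tendsto_add_at_top[OF tendsto_const] filterlim_ident) auto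
  then have "measure ?N ?S \<le> 0"
    by (rule tendsto_lowerbound) (auto intro: eventually_mono[OF eventually_gt_at_top[of 0]] le)
  then have "emeasure ?N ?S = 0"
    by (simp add: normal_vec.emeasure_eq_measure measure_le_0_iff)
  then have "AE z in ?N. rss n Z k z \<noteq> 0"
    using AE_iff_measurable[OF S, of "\<lambda>z. rss n Z k z \<noteq> 0"] by auto
  then show ?thesis by eventually_elim (simp add: less_le)
qed

lemma kap_upd: "kap n (Z(k := z)) k v = ip n v (res n Z k z) / rss n Z k z"
proof -
  have "res n (Z(k := z)) k u i = res n Z k u i" if "i < n" for u i
    using that by (intro res_cong) auto
  then have "ip n (res n (Z(k := z)) k u) (res n (Z(k := z)) k w) = ip n (res n Z k u) (res n Z k w)" for u w
    by (intro ip_cong) auto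
  then show ?thesis by (simp add: kap_def rss_def ip_res_left[of n v])
qed

text \<open>For fixed \<open>z\<close> the coefficient is normal with mean 0 and variance
  \<open>1 / rss n Z k z\<close>. Its density is written so that \<open>nn_integral_rss_tilt\<close>
  applies with \<open>l = w\<^sup>2\<close> once \<open>z\<close> is integrated out.\<close>

lemma nn_integral_kap_fixed:
  assumes G[measurable]: "G \<in> borel_measurable borel" and \<rho>: "rss n Z k z > 0"
  shows "(\<integral>\<^sup>+v. G (kap n (Z(k := z)) k v) \<partial>normal_vec {..<n})
    = (\<integral>\<^sup>+w. G w * (ennreal (1 / sqrt (2 * pi)) * (ennreal (sqrt (rss n Z k z)) * ennreal (exp (- (w\<^sup>2) * rss n Z k z / 2)))) \<partial>lborel)"
proof -
  let ?N = "normal_vec {..<n}"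
  define r where "r = res n Z k z"
  define s where "s = sqrt (rss n Z k z)"
  have s: "s > 0" "s\<^sup>2 = rss n Z k z" using \<rho> by (auto simp: s_def)
  have rr: "ip n r r = s\<^sup>2" by (simp add: s r_def rss_def)
  have "(\<integral>\<^sup>+v. G (kap n (Z(k := z)) k v) \<partial>?N) = (\<integral>\<^sup>+v. G (ip n v (\<lambda>i. (1 / s) * r i) / s) \<partial>?N)"
    unfolding kap_upd ip_scale_right s(2)[symmetric] r_def[symmetric] by (simp add: power2_eq_square)
  also have "\<dots> = (\<integral>\<^sup>+g. G (g / s) \<partial>std_normal_distribution)"
  proof (rule nn_integral_ip)
    show "ip n (\<lambda>i. (1 / s) * r i) (\<lambda>i. (1 / s) * r i) = 1"
      unfolding ip_scale_left ip_scale_right rr using s(1) by (simp add: power2_eq_square)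
  qed measurable
  also have "\<dots> = (\<integral>\<^sup>+g. ennreal (std_normal_density g) * G (g / s) \<partial>lborel)"
    by (rule nn_integral_density) auto
  also have "\<dots> = ennreal \<bar>s\<bar> * (\<integral>\<^sup>+w. ennreal (std_normal_density (0 + s * w)) * G ((0 + s * w) / s) \<partial>lborel)"
    using s by (intro nn_integral_real_affine) auto
  also have "\<dots> = (\<integral>\<^sup>+w. ennreal \<bar>s\<bar> * (ennreal (std_normal_density (0 + s * w)) * G ((0 + s * w) / s)) \<partial>lborel)"
    by (rule nn_integral_cmult[symmetric]) measurable
  also have "\<dots> = (\<integral>\<^sup>+w. G w * (ennreal (1 / sqrt (2 * pi)) * (ennreal s * ennreal (exp (- (w\<^sup>2) * s\<^sup>2 / 2)))) \<partial>lborel)"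
  proof (intro nn_integral_cong)
    fix w :: real
    have "std_normal_density (0 + s * w) = 1 / sqrt (2 * pi) * exp (- (w\<^sup>2) * s\<^sup>2 / 2)"
      by (simp add: std_normal_density_def power_mult_distrib mult.commute)
    then have "ennreal (std_normal_density (0 + s * w)) = ennreal (1 / sqrt (2 * pi)) * ennreal (exp (- (w\<^sup>2) * s\<^sup>2 / 2))"
      by (simp only: ennreal_mult[OF _ exp_ge_zero, of "1 / sqrt (2 * pi)"] pi_ge_zero real_sqrt_ge_zero divide_nonneg_nonneg
          zero_le_one mult_nonneg_nonneg zero_le_numeral)
    moreover have "(0 + s * w) / s = w" "\<bar>s\<bar> = s" using s by auto
    ultimately show "ennreal \<bar>s\<bar> * (ennreal (std_normal_density (0 + s * w)) * G ((0 + s * w) / s))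
      = G w * (ennreal (1 / sqrt (2 * pi)) * (ennreal s * ennreal (exp (- (w\<^sup>2) * s\<^sup>2 / 2))))"
      by (simp only: mult_ac)
  qed
  finally show ?thesis unfolding s_def unfolding s(2)[unfolded s_def] .
qed

text \<open>The last regression coefficient has a Student distribution, up to scale.\<close>

lemma nn_integral_kap:
  fixes n k :: nat
  defines "t \<equiv> \<lambda>w. ennreal ((1 + w\<^sup>2) powr (- (real n - real k + 1) / 2))"
  assumes Z: "nondeg n Z k" and kn: "k < n" and G[measurable]: "G \<in> borel_measurable borel"
  shows "(\<integral>\<^sup>+z. \<integral>\<^sup>+v. G (kap n (Z(k := z)) k v) \<partial>normal_vec {..<n} \<partial>normal_vec {..<n})
    = (\<integral>\<^sup>+w. G w * t w \<partial>lborel) / (\<integral>\<^sup>+w. t w \<partial>lborel)"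
    and "(\<integral>\<^sup>+w. t w \<partial>lborel) \<noteq> 0" "(\<integral>\<^sup>+w. t w \<partial>lborel) \<noteq> \<top>"
proof -
  let ?N = "normal_vec {..<n}"
  interpret P: pair_sigma_finite ?N lborel ..
  \<comment> \<open>The mean of a chi variable enters only as a constant; it is determined at the
    end by \<open>G = 1\<close>, where the total mass is 1.\<close>
  define C where "C = (\<integral>\<^sup>+z. ennreal (sqrt (rss n Z k z)) \<partial>?N)"
  define K where "K = ennreal (1 / sqrt (2 * pi)) * C"
  have t[measurable]: "t \<in> borel_measurable borel" unfolding t_def by measurable
  have eq: "(\<integral>\<^sup>+z. \<integral>\<^sup>+v. G (kap n (Z(k := z)) k v) \<partial>?N \<partial>?N) = (\<integral>\<^sup>+w. G w * t w \<partial>lborel) * K"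
    if G[measurable]: "G \<in> borel_measurable borel" for G
  proof -
    have "(\<integral>\<^sup>+z. \<integral>\<^sup>+v. G (kap n (Z(k := z)) k v) \<partial>?N \<partial>?N)
      = (\<integral>\<^sup>+z. \<integral>\<^sup>+w. G w * (ennreal (1 / sqrt (2 * pi)) * (ennreal (sqrt (rss n Z k z)) * ennreal (exp (- (w\<^sup>2) * rss n Z k z / 2)))) \<partial>lborel \<partial>?N)"
      using AE_rss_pos[OF Z kn] by (intro nn_integral_cong_AE) (auto elim!: eventually_mono simp: nn_integral_kap_fixed[OF G])
    \<comment> \<open>With \<open>w\<close> fixed, the integral over \<open>z\<close> is a tilted
      one with \<open>l = w\<^sup>2\<close>; its normalising factor and the one released by
      \<open>sqrt\<close> combine into \<open>t w\<close>.\<close>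
    also have "\<dots> = (\<integral>\<^sup>+w. \<integral>\<^sup>+z. G w * (ennreal (1 / sqrt (2 * pi)) * (ennreal (sqrt (rss n Z k z)) * ennreal (exp (- (w\<^sup>2) * rss n Z k z / 2)))) \<partial>?N \<partial>lborel)"
      by (rule P.Fubini'[symmetric]) measurable
    also have "\<dots> = (\<integral>\<^sup>+w. G w * t w * K \<partial>lborel)"
    proof (intro nn_integral_cong)
      fix w :: real
      have w: "1 + w\<^sup>2 > 0" by (simp add: add_pos_nonneg)
      have "(\<integral>\<^sup>+z. G w * (ennreal (1 / sqrt (2 * pi)) * (ennreal (sqrt (rss n Z k z)) * ennreal (exp (- (w\<^sup>2) * rss n Z k z / 2)))) \<partial>?N)
        = G w * (ennreal (1 / sqrt (2 * pi)) * (\<integral>\<^sup>+z. ennreal (sqrt (rss n Z k z)) * ennreal (exp (- (w\<^sup>2) * rss n Z k z / 2)) \<partial>?N))"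
        by (subst nn_integral_cmult, measurable)+
      also have "(\<integral>\<^sup>+z. ennreal (sqrt (rss n Z k z)) * ennreal (exp (- (w\<^sup>2) * rss n Z k z / 2)) \<partial>?N)
        = ennreal ((1 + w\<^sup>2) powr (- (real n - real k) / 2)) * (\<integral>\<^sup>+z. ennreal (sqrt (rss n Z k z / (1 + w\<^sup>2))) \<partial>?N)"
      proof -
        have "w\<^sup>2 > -1" using zero_le_power2[of w] by linarith
        moreover have "(\<lambda>x. ennreal (sqrt x)) \<in> borel_measurable borel" by measurable
        ultimately show ?thesis by (rule nn_integral_rss_tilt[OF _ Z])
      qed
      also have "(\<integral>\<^sup>+z. ennreal (sqrt (rss n Z k z / (1 + w\<^sup>2))) \<partial>?N) = (\<integral>\<^sup>+z. ennreal ((1 + w\<^sup>2) powr (- 1 / 2)) * ennreal (sqrt (rss n Z k z)) \<partial>?N)"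
      proof (intro nn_integral_cong)
        fix z
        have "sqrt (rss n Z k z / (1 + w\<^sup>2)) = (1 + w\<^sup>2) powr (- 1 / 2) * sqrt (rss n Z k z)"
        proof -
          have "(1 + w\<^sup>2) powr (- 1 / 2) = inverse ((1 + w\<^sup>2) powr (1 / 2))"
            unfolding powr_minus[symmetric] minus_divide_left ..
          also have "\<dots> = inverse (sqrt (1 + w\<^sup>2))"
            using w by (subst powr_half_sqrt) auto
          finally have e: "(1 + w\<^sup>2) powr (- 1 / 2) = inverse (sqrt (1 + w\<^sup>2))" .
          show ?thesis unfolding e unfolding real_sqrt_divide by (simp add: divide_inverse)
        qed
        then show "ennreal (sqrt (rss n Z k z / (1 + w\<^sup>2))) = ennreal ((1 + w\<^sup>2) powr (- 1 / 2)) * ennreal (sqrt (rss n Z k z))"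
          by (simp only: ennreal_mult' powr_ge_zero)
      qed
      also have "\<dots> = ennreal ((1 + w\<^sup>2) powr (- 1 / 2)) * C"
        unfolding C_def by (rule nn_integral_cmult) measurable
      also have "ennreal ((1 + w\<^sup>2) powr (- (real n - real k) / 2)) * (ennreal ((1 + w\<^sup>2) powr (- 1 / 2)) * C) = t w * C"
      proof -
        have "(1 + w\<^sup>2) powr (- (real n - real k) / 2) * (1 + w\<^sup>2) powr (- 1 / 2)
          = (1 + w\<^sup>2) powr (- (real n - real k + 1) / 2)"
        proof -
          have e: "- (real n - real k) / 2 + - 1 / 2 = - (real n - real k + 1) / 2" by (simp add: field_simps)
          show ?thesis unfolding powr_add[symmetric] e ..
        qed
        then show ?thesis unfolding t_def mult.assoc[symmetric]
          by (simp only: ennreal_mult[OF powr_ge_zero powr_ge_zero, symmetric])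
      qed
      finally show "(\<integral>\<^sup>+z. G w * (ennreal (1 / sqrt (2 * pi)) * (ennreal (sqrt (rss n Z k z)) * ennreal (exp (- (w\<^sup>2) * rss n Z k z / 2)))) \<partial>?N)
        = G w * t w * K" unfolding K_def by (simp only: mult_ac)
    qed
    also have "\<dots> = (\<integral>\<^sup>+w. G w * t w \<partial>lborel) * K"
      by (rule nn_integral_multc) measurable
    finally show ?thesis .
  qed
  have one: "(\<integral>\<^sup>+w. t w \<partial>lborel) * K = 1"
    using eq[of "\<lambda>_. 1"] by (simp add: normal_vec.emeasure_space_1)
  then show nz: "(\<integral>\<^sup>+w. t w \<partial>lborel) \<noteq> 0" and nt: "(\<integral>\<^sup>+w. t w \<partial>lborel) \<noteq> \<top>"
    by (auto simp: ennreal_top_mult split: if_splits)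
  have "K = K * (\<integral>\<^sup>+w. t w \<partial>lborel) / (\<integral>\<^sup>+w. t w \<partial>lborel)"
    using nz nt by (simp add: mult_divide_eq_ennreal)
  then have "K = 1 / (\<integral>\<^sup>+w. t w \<partial>lborel)"
    using one by (simp add: mult.commute)
  then show "(\<integral>\<^sup>+z. \<integral>\<^sup>+v. G (kap n (Z(k := z)) k v) \<partial>?N \<partial>?N)
    = (\<integral>\<^sup>+w. G w * t w \<partial>lborel) / (\<integral>\<^sup>+w. t w \<partial>lborel)"
    using eq[OF G] by (simp add: ennreal_times_divide)
qed

section \<open>Arrays of independent standard normal columns\<close>

definition columns :: "nat \<Rightarrow> nat \<Rightarrow> (nat \<times> nat \<Rightarrow> real) measure" where
  "columns n k = normal_vec ({..<k} \<times> {..<n})"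

lemma component_columns [measurable (raw)]: "j < k \<Longrightarrow> i < n \<Longrightarrow> (\<lambda>A. A (j, i)) \<in> borel_measurable (columns n k)"
  unfolding columns_def by (rule component_normal_vec) auto

lemma curry_columns: "j < k \<Longrightarrow> i < n \<Longrightarrow> (\<lambda>A. curry A j i) \<in> borel_measurable (columns n k)"
  unfolding curry_def by (rule component_columns)

text \<open>Tonelli for the last column. The product space consists of extensional functions,
  whereas \<open>(curry A)(k := z)\<close> is a total array; \<open>F_cong\<close> bridges the
  difference.\<close>

lemma nn_integral_columns_Suc:
  assumes F: "(\<lambda>A. F (curry A)) \<in> borel_measurable (columns n (Suc k))"
    and F_cong: "\<And>Z Z'. (\<And>j i. j < Suc k \<Longrightarrow> i < n \<Longrightarrow> Z j i = Z' j i) \<Longrightarrow> F Z = F Z'"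
  shows "(\<integral>\<^sup>+A. F (curry A) \<partial>columns n (Suc k))
    = (\<integral>\<^sup>+A. \<integral>\<^sup>+z. F ((curry A)(k := z)) \<partial>normal_vec {..<n} \<partial>columns n k)"
proof -
  let ?I = "{..<k} \<times> {..<n}" and ?S = "{..<Suc k} \<times> {..<n}"
  let ?M = "normal_vec ?I \<Otimes>\<^sub>M normal_vec {..<n}"
  define X where "X p \<omega> = (if fst p = k then snd \<omega> (snd p) else fst \<omega> p)" for p :: "nat \<times> nat" and \<omega> :: "(nat \<times> nat \<Rightarrow> real) \<times> (nat \<Rightarrow> real)"
  have X: "X p \<in> borel_measurable ?M" if "p \<in> ?S" for p
  proof (cases "fst p = k")
    case True
    then have "X p = (\<lambda>\<omega>. snd \<omega> (snd p))" by (auto simp: X_def)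
    moreover have "(\<lambda>\<omega>. snd \<omega> (snd p)) \<in> borel_measurable ?M"
      using that by (intro components_normal_vec_pair) auto
    ultimately show ?thesis by simp
  next
    case False
    then have "X p = (\<lambda>\<omega>. fst \<omega> p)" by (auto simp: X_def)
    moreover have "(\<lambda>\<omega>. fst \<omega> p) \<in> borel_measurable ?M"
      using that False by (intro components_normal_vec_pair) auto
    ultimately show ?thesis by simp
  qed
  have split: "(\<Sum>p\<in>?S. g p) = (\<Sum>p\<in>?I. g p) + (\<Sum>i<n. g (k, i))" for g :: "nat \<times> nat \<Rightarrow> real"
  proof -
    have "?S = ?I \<union> Pair k ` {..<n}" by (auto simp: less_Suc_eq)
    moreover have "?I \<inter> Pair k ` {..<n} = {}" by auto
    ultimately have "(\<Sum>p\<in>?S. g p) = (\<Sum>p\<in>?I. g p) + (\<Sum>p\<in>Pair k ` {..<n}. g p)"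
      by (simp add: sum.union_disjoint)
    also have "(\<Sum>p\<in>Pair k ` {..<n}. g p) = (\<Sum>i<n. g (k, i))"
      by (subst sum.reindex) (auto simp: inj_on_def)
    finally show ?thesis .
  qed
  have char: "(CLINT \<omega>|?M. iexp (\<Sum>p\<in>?S. t p * X p \<omega>)) = of_real (exp (- (\<Sum>p\<in>?S. (t p)\<^sup>2) / 2))" for t
  proof -
    have "(\<Sum>p\<in>?S. t p * X p \<omega>) = (\<Sum>p\<in>?I. t p * fst \<omega> p) + (\<Sum>i<n. t (k, i) * snd \<omega> i)" for \<omega>
      unfolding split X_def by (auto intro!: arg_cong2[where f="(+)"] sum.cong)
    then show ?thesis
      by (simp only: normal_vec_pair_iexp_sum[OF finite_SigmaI[OF finite_lessThan finite_lessThan] finite_lessThan] split)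
  qed
  have law: "distr ?M (\<Pi>\<^sub>M p\<in>?S. borel) (\<lambda>\<omega>. \<lambda>p\<in>?S. X p \<omega>) = normal_vec ?S"
    by (rule normal_vec_pair.P.distr_eq_normal_vec[OF _ X char]) auto
  have mX: "(\<lambda>\<omega>. \<lambda>p\<in>?S. X p \<omega>) \<in> ?M \<rightarrow>\<^sub>M (\<Pi>\<^sub>M p\<in>?S. borel)"
    by (intro measurable_restrict X) auto
  have F': "(\<lambda>A. F (curry A)) \<in> borel_measurable (\<Pi>\<^sub>M p\<in>?S. borel)"
    using F unfolding columns_def measurable_cong_sets[OF sets_normal_vec refl] .
  have Fe: "F (curry (\<lambda>p\<in>?S. X p \<omega>)) = F ((curry (fst \<omega>))(k := snd \<omega>))" for \<omega>
    by (intro F_cong) (auto simp: X_def)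
  have "(\<integral>\<^sup>+A. F (curry A) \<partial>columns n (Suc k)) = (\<integral>\<^sup>+\<omega>. F (curry (\<lambda>p\<in>?S. X p \<omega>)) \<partial>?M)"
    unfolding columns_def law[symmetric] by (rule nn_integral_distr[OF mX]) (simp add: F')
  also have "\<dots> = (\<integral>\<^sup>+A. \<integral>\<^sup>+z. F (curry (\<lambda>p\<in>?S. X p (A, z))) \<partial>normal_vec {..<n} \<partial>normal_vec ?I)"
    by (rule normal_vec.nn_integral_fst[symmetric]) (rule measurable_compose[OF mX F'])
  finally show ?thesis unfolding Fe columns_def by simp
qed

lemma measurable_nondeg:
  assumes "\<And>j i. j < k \<Longrightarrow> i < n \<Longrightarrow> (\<lambda>x. Z x j i) \<in> borel_measurable M"
  shows "Measurable.pred M (\<lambda>x. nondeg n (Z x) k)"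
proof -
  have rssm: "(\<lambda>x. rss n (Z x) j (Z x j)) \<in> borel_measurable M" if "j < k" for j
  proof (rule measurable_rss)
    fix j' i assume "j' < j" "i < n"
    then show "(\<lambda>x. Z x j' i) \<in> borel_measurable M" using that by (intro assms) simp_all
  qed (rule assms[OF that])
  have "Measurable.pred borel (\<lambda>x. x \<noteq> (0::real))" by measurable
  then have "Measurable.pred M (\<lambda>x. rss n (Z x) j (Z x j) \<noteq> 0)" if "j \<in> {..<k}" for j
    using that by (intro measurable_compose[OF rssm]) simp_all
  then have "Measurable.pred M (\<lambda>x. \<forall>j\<in>{..<k}. rss n (Z x) j (Z x j) \<noteq> 0)"
    by (rule pred_intros_finite(3)[OF finite_lessThan])
  moreover have "nondeg n Z k = (\<forall>j\<in>{..<k}. rss n Z j (Z j) \<noteq> 0)" for Z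
    unfolding nondeg_def rss_def by blast
  ultimately show ?thesis by (simp only:)
qed

text \<open>Given \<open>k\<close> independent columns with \<open>k < n\<close>, the residual sum
  of squares of a fresh normal column is almost surely positive.\<close>

lemma AE_nondeg_columns:
  "k \<le> n \<Longrightarrow> AE A in columns n k. nondeg n (curry A) k"
proof (induction k)
  case 0
  then show ?case by (simp add: nondeg_def)
next
  case (Suc k)
  define F where "F Z = (indicator {False} (nondeg n Z (Suc k)) :: ennreal)" for Z
  have m: "Measurable.pred (columns n (Suc k)) (\<lambda>A. nondeg n (curry A) (Suc k))"
    by (rule measurable_nondeg) (rule curry_columns)
  have Fm: "(\<lambda>A. F (curry A)) \<in> borel_measurable (columns n (Suc k))"
    unfolding F_def by (rule measurable_compose[OF m]) simp
  have "(\<integral>\<^sup>+A. F (curry A) \<partial>columns n (Suc k)) = (\<integral>\<^sup>+A. \<integral>\<^sup>+z. F ((curry A)(k := z)) \<partial>normal_vec {..<n} \<partial>columns n k)"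
  proof (rule nn_integral_columns_Suc[OF Fm])
    fix Z Z' :: "nat \<Rightarrow> nat \<Rightarrow> real" assume "\<And>j i. j < Suc k \<Longrightarrow> i < n \<Longrightarrow> Z j i = Z' j i"
    then have "nondeg n Z (Suc k) = nondeg n Z' (Suc k)" by (rule nondeg_cong)
    then show "F Z = F Z'" by (simp only: F_def)
  qed
  also have "\<dots> = (\<integral>\<^sup>+A. 0 \<partial>columns n k)"
  proof (rule nn_integral_cong_AE)
    show "AE A in columns n k. (\<integral>\<^sup>+z. F ((curry A)(k := z)) \<partial>normal_vec {..<n}) = 0"
      using Suc.IH[OF Suc_leD[OF Suc.prems]]
    proof eventually_elim
      case (elim A)
      have kn: "k < n" using Suc.prems by simp
      then have nd: "nondeg n (curry A) k" using elim by blast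
      have "(\<integral>\<^sup>+z. F ((curry A)(k := z)) \<partial>normal_vec {..<n}) = (\<integral>\<^sup>+z. 0 \<partial>normal_vec {..<n})"
      proof (rule nn_integral_cong_AE)
        show "AE z in normal_vec {..<n}. F ((curry A)(k := z)) = 0"
          using AE_rss_pos[OF nd kn]
        proof eventually_elim
          case (elim z)
          then have r: "rss n (curry A) k z > 0" .
          have eq: "rss n ((curry A)(k := z)) j v = rss n (curry A) j v" if "j \<le> k" for j v
            using that by (intro rss_cong) auto
          have "nondeg n ((curry A)(k := z)) (Suc k)"
            using nd r eq unfolding nondeg_def rss_def[symmetric] by (auto simp: less_Suc_eq)
          then show ?case by (simp add: F_def del: res.simps)
        qed
      qed
      then show ?case by simp
    qed
  qed
  finally have "AE A in columns n (Suc k). F (curry A) = 0"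
    using nn_integral_0_iff_AE[OF Fm] by simp
  then show ?case 
  proof eventually_elim
    case (elim A)
    have "nondeg n Z (Suc k)" if "F Z = 0" for Z
      using that by (simp add: F_def indicator_def split: if_splits)
    then show ?case using elim .
  qed
qed

definition coef_sq :: "nat \<Rightarrow> (nat \<Rightarrow> nat \<Rightarrow> real) \<Rightarrow> nat \<Rightarrow> (nat \<Rightarrow> real) \<Rightarrow> real" where
  "coef_sq n Z k v = (\<Sum>j<k. (coef n Z k v j)\<^sup>2)"

lemma coef_sq_nonneg [simp]: "coef_sq n Z k v \<ge> 0"
  by (simp add: coef_sq_def sum_nonneg)

lemma coef_sq_Suc: "coef_sq n Z (Suc k) v = (kap n Z k v)\<^sup>2 + coef_sq n Z k (\<lambda>i. v i - kap n Z k v * Z k i)"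
  unfolding coef_sq_def by (rule coef_norm_Suc)

lemma coef_sq_cong:
  assumes "\<And>i. i < n \<Longrightarrow> u i = v i" "\<And>j i. j < k \<Longrightarrow> i < n \<Longrightarrow> Z j i = Z' j i"
  shows "coef_sq n Z k u = coef_sq n Z' k v"
proof -
  have "coef n Z k u j = coef n Z' k v j" for j using assms by (rule coef_cong)
  then show ?thesis by (simp add: coef_sq_def)
qed

lemma measurable_coef_sq:
  assumes "\<And>i. i < n \<Longrightarrow> (\<lambda>x. v x i) \<in> borel_measurable M"
    "\<And>j i. j < k \<Longrightarrow> i < n \<Longrightarrow> (\<lambda>x. Z x j i) \<in> borel_measurable M"
  shows "(\<lambda>x. coef_sq n (Z x) k (v x)) \<in> borel_measurable M"
proof -
  have [measurable]: "(\<lambda>x. coef n (Z x) k (v x) j) \<in> borel_measurable M" for j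
    using assms by (rule measurable_coef)
  show ?thesis unfolding coef_sq_def by measurable
qed

lemma coef_sq_normal_vec [measurable]: "coef_sq n Z k \<in> borel_measurable (normal_vec {..<n})"
  by (rule measurable_coef_sq[where v="\<lambda>v. v" and Z="\<lambda>_. Z"]) (auto intro: component_normal_vec)

lemma coef_diff_scale: "coef n Z k (\<lambda>i. v i - c * z i) j = coef n Z k v j - c * coef n Z k z j"
  using coef_linear[of n Z k 1 v "- c" z j] by simp

lemma coef_fit_residual: "coef n Z k (\<lambda>i. v i - res n Z k v i + res n Z k w i) j = coef n Z k v j"
  using coef_linear[of n Z k 1 "\<lambda>i. v i - 1 * res n Z k v i" 1 "res n Z k w" j]
  unfolding coef_diff_scale coef_res by simp

lemma ip_fit_residual_res: "ip n (\<lambda>i. v i - res n Z k v i + res n Z k w i) (res n Z k z) = ip n w (res n Z k z)"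
  unfolding ip_add_left ip_diff_left ip_res_left[of n v] ip_res_left[of n w] by simp

text \<open>In the regression on one more column, the coefficient \<open>\<kappa>\<close> of the new column depends only on
  residuals, hence is independent of the fitted parts of \<open>v\<close> and \<open>z\<close>; given \<open>\<kappa>\<close>, the vector
  \<open>v - \<kappa> z\<close> that determines the remaining coefficients is \<open>sqrt (1 + \<kappa>\<^sup>2)\<close> times standard normal.\<close>

lemma nn_integral_last_column:
  fixes \<Psi> :: "real \<Rightarrow> real \<Rightarrow> ennreal" and n k :: nat and Z :: "nat \<Rightarrow> nat \<Rightarrow> real"
  defines "N \<equiv> normal_vec {..<n}"
  defines "\<kappa> \<equiv> \<lambda>z v. kap n (Z(k := z)) k v"
  assumes \<Psi>: "(\<lambda>(a, b). \<Psi> a b) \<in> borel_measurable (borel \<Otimes>\<^sub>M borel)"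
  shows "(\<integral>\<^sup>+z. \<integral>\<^sup>+v. \<Psi> (\<kappa> z v) (coef_sq n Z k (\<lambda>i. v i - \<kappa> z v * z i)) \<partial>N \<partial>N)
    = (\<integral>\<^sup>+z. \<integral>\<^sup>+v. \<integral>\<^sup>+u. \<Psi> (\<kappa> z v) ((1 + (\<kappa> z v)\<^sup>2) * coef_sq n Z k u) \<partial>N \<partial>N \<partial>N)"
proof -
  interpret N: prob_space N unfolding N_def by (rule prob_space_normal_vec)
  interpret NN: pair_prob_space N N ..
  define C where "C j v = coef n Z k v j" for j v
  have C[measurable]: "C j \<in> borel_measurable N" for j
    unfolding C_def N_def
    by (rule measurable_coef[where v="\<lambda>v. v" and Z="\<lambda>_. Z"]) (auto intro: component_normal_vec)
  define Q where "Q c v z = (\<Sum>j<k. (C j v - c * C j z)\<^sup>2)" for c v z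
  have Q_eq: "coef_sq n Z k (\<lambda>i. v i - c * z i) = Q c v z" for c v z
    unfolding coef_sq_def Q_def C_def coef_diff_scale ..
  have Qm: "(\<lambda>(c, v, z). Q c v z) \<in> borel_measurable (borel \<Otimes>\<^sub>M N \<Otimes>\<^sub>M N)"
    unfolding Q_def by measurable
  have \<kappa>_eq: "\<kappa> z v = ip n v (res n Z k z) / rss n Z k z" for z v
    unfolding \<kappa>_def by (rule kap_upd)
  have \<kappa>m: "(\<lambda>(z, v). \<kappa> z v) \<in> borel_measurable (N \<Otimes>\<^sub>M N)"
  proof -
    have 1: "(\<lambda>\<omega>. fst \<omega> i) \<in> borel_measurable (N \<Otimes>\<^sub>M N)" "(\<lambda>\<omega>. snd \<omega> i) \<in> borel_measurable (N \<Otimes>\<^sub>M N)" if "i < n" for i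
      using that components_normal_vec_pair[of i "{..<n}"] unfolding N_def by auto
    have 2: "(\<lambda>\<omega>. res n Z k (fst \<omega>) i) \<in> borel_measurable (N \<Otimes>\<^sub>M N)" if "i < n" for i
      by (rule measurable_res[OF 1(1) _ that]) auto
    have 3: "(\<lambda>\<omega>. ip n (snd \<omega>) (res n Z k (fst \<omega>))) \<in> borel_measurable (N \<Otimes>\<^sub>M N)"
      by (rule measurable_ip[OF 1(2) 2])
    have 4: "(\<lambda>\<omega>. rss n Z k (fst \<omega>)) \<in> borel_measurable (N \<Otimes>\<^sub>M N)"
      by (rule measurable_rss[OF 1(1)]) auto
    show ?thesis unfolding case_prod_beta \<kappa>_eq using 3 4 by (rule borel_measurable_divide)
  qed
  have \<kappa>_cong: "\<kappa> z v = \<kappa> z' v'" if "\<And>i. i < n \<Longrightarrow> z i = z' i" "\<And>i. i < n \<Longrightarrow> v i = v' i" for z z' v v'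
    unfolding \<kappa>_def using that by (intro kap_cong) auto
  have C_cong: "C j v = C j v'" if "\<And>i. i < n \<Longrightarrow> v i = v' i" for j v v'
    unfolding C_def using that by (intro coef_cong) auto
  have C_fit: "C j (\<lambda>i. v i - res n Z k v i + res n Z k w i) = C j v" for j v w
    unfolding C_def by (rule coef_fit_residual)
  have \<kappa>_fit1: "\<kappa> (\<lambda>i. z i - res n Z k z i + res n Z k w i) v = \<kappa> w v" for z w v
  proof -
    have "ip n v (res n Z k (\<lambda>i. z i - res n Z k z i + res n Z k w i)) = ip n v (res n Z k w)"
      by (rule ip_cong[OF refl res_fit_residual])
    then show ?thesis unfolding \<kappa>_eq rss_fit_residual by (simp only:)
  qed
  have \<kappa>_fit2: "\<kappa> z (\<lambda>i. v i - res n Z k v i + res n Z k w i) = \<kappa> z w" for z v w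
    unfolding \<kappa>_eq ip_fit_residual_res ..
  \<comment> \<open>Both \<open>z\<close> and \<open>v\<close> occur in two roles, which get
    separate arguments: \<open>z\<close> and \<open>w\<close> enter through \<open>\<kappa>\<close>,
    \<open>v\<close> and \<open>z1\<close> through the regression on the earlier columns. The two
    splits below make the roles independent.\<close>
  define \<Phi> where "\<Phi> z w v z1 = \<Psi> (\<kappa> z w) (Q (\<kappa> z w) v z1)" for z w v z1
  have \<Phi>m: "(\<lambda>(z, w, v, z1). \<Phi> z w v z1) \<in> borel_measurable (N \<Otimes>\<^sub>M N \<Otimes>\<^sub>M N \<Otimes>\<^sub>M N)"
  proof -
    have [measurable]: "(\<lambda>\<omega>. \<kappa> (f \<omega>) (g \<omega>)) \<in> borel_measurable M"
      if "f \<in> M \<rightarrow>\<^sub>M N" "g \<in> M \<rightarrow>\<^sub>M N" for f g and M :: "((nat \<Rightarrow> real) \<times> (nat \<Rightarrow> real) \<times> (nat \<Rightarrow> real) \<times> (nat \<Rightarrow> real)) measure"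
      using measurable_compose[OF measurable_Pair[OF that] \<kappa>m] by simp
    have [measurable]: "(\<lambda>\<omega>. Q (c \<omega>) (f \<omega>) (g \<omega>)) \<in> borel_measurable M"
      if "c \<in> M \<rightarrow>\<^sub>M borel" "f \<in> M \<rightarrow>\<^sub>M N" "g \<in> M \<rightarrow>\<^sub>M N" for c f g and M :: "((nat \<Rightarrow> real) \<times> (nat \<Rightarrow> real) \<times> (nat \<Rightarrow> real) \<times> (nat \<Rightarrow> real)) measure"
      using measurable_compose[OF measurable_Pair[OF that(1) measurable_Pair[OF that(2,3)]] Qm] by simp
    have P: "(\<lambda>\<omega>. \<Psi> (a \<omega>) (b \<omega>)) \<in> borel_measurable M"
      if "a \<in> M \<rightarrow>\<^sub>M borel" "b \<in> M \<rightarrow>\<^sub>M borel" for a b and M :: "((nat \<Rightarrow> real) \<times> (nat \<Rightarrow> real) \<times> (nat \<Rightarrow> real) \<times> (nat \<Rightarrow> real)) measure"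
      using measurable_compose[OF measurable_Pair[OF that] \<Psi>] by simp
    show ?thesis unfolding \<Phi>_def case_prod_beta by (rule P) measurable
  qed
  have \<Phi>m'[measurable]: "(\<lambda>\<omega>. \<Phi> (a \<omega>) (b \<omega>) (c \<omega>) (d \<omega>)) \<in> borel_measurable M"
    if "a \<in> M \<rightarrow>\<^sub>M N" "b \<in> M \<rightarrow>\<^sub>M N" "c \<in> M \<rightarrow>\<^sub>M N" "d \<in> M \<rightarrow>\<^sub>M N" for a b c d and M :: "'m measure"
    using measurable_compose[OF measurable_Pair[OF that(1) measurable_Pair[OF that(2) measurable_Pair[OF that(3,4)]]] \<Phi>m] by simp
  \<comment> \<open>Splitting \<open>v\<close>: \<open>\<kappa>\<close> sees only its residual, the
    other coefficients only its fitted part.\<close>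
  have step1: "(\<integral>\<^sup>+v. \<Phi> z v v z \<partial>N) = (\<integral>\<^sup>+w. \<integral>\<^sup>+v. \<Phi> z w v z \<partial>N \<partial>N)" if z: "z \<in> space N" for z
  proof -
    have m: "(\<lambda>v. \<Phi> z v v z) \<in> borel_measurable (normal_vec {..<n})"
      using z unfolding N_def[symmetric] by (intro \<Phi>m') auto
    have cg: "\<Phi> z u u z = \<Phi> z v v z" if uv: "\<And>i. i < n \<Longrightarrow> u i = v i" for u v
    proof -
      have "\<kappa> z u = \<kappa> z v" using uv by (intro \<kappa>_cong) auto
      moreover have "C j u = C j v" for j using uv by (rule C_cong)
      ultimately show ?thesis unfolding \<Phi>_def Q_def by (simp only:)
    qed
    have "(\<integral>\<^sup>+v. \<Phi> z v v z \<partial>N) = (\<integral>\<^sup>+v. \<integral>\<^sup>+w. \<Phi> z w v z \<partial>N \<partial>N)"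
      using nn_integral_split_res[OF m cg, where Z=Z and k=k] unfolding N_def[symmetric] \<Phi>_def Q_def C_fit \<kappa>_fit2 .
    also have "\<dots> = (\<integral>\<^sup>+w. \<integral>\<^sup>+v. \<Phi> z w v z \<partial>N \<partial>N)"
      using z by (intro NN.Fubini'[symmetric]) (auto simp: case_prod_beta intro!: \<Phi>m')
    finally show ?thesis .
  qed
  have "(\<integral>\<^sup>+z. \<integral>\<^sup>+v. \<Psi> (\<kappa> z v) (coef_sq n Z k (\<lambda>i. v i - \<kappa> z v * z i)) \<partial>N \<partial>N) = (\<integral>\<^sup>+z. \<integral>\<^sup>+v. \<Phi> z v v z \<partial>N \<partial>N)"
    unfolding Q_eq \<Phi>_def ..
  also have "\<dots> = (\<integral>\<^sup>+z. \<integral>\<^sup>+w. \<integral>\<^sup>+v. \<Phi> z w v z \<partial>N \<partial>N \<partial>N)"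
    by (intro nn_integral_cong step1)
  \<comment> \<open>The same split for \<open>z\<close>.\<close>
  also have "\<dots> = (\<integral>\<^sup>+z1. \<integral>\<^sup>+z. \<integral>\<^sup>+w. \<integral>\<^sup>+v. \<Phi> z w v z1 \<partial>N \<partial>N \<partial>N \<partial>N)"
  proof -
    have m: "(\<lambda>z. \<integral>\<^sup>+w. \<integral>\<^sup>+v. \<Phi> z w v z \<partial>N \<partial>N) \<in> borel_measurable (normal_vec {..<n})"
      unfolding N_def[symmetric] by measurable
    have cg: "(\<integral>\<^sup>+w. \<integral>\<^sup>+v. \<Phi> z w v z \<partial>N \<partial>N) = (\<integral>\<^sup>+w. \<integral>\<^sup>+v. \<Phi> z' w v z' \<partial>N \<partial>N)"
      if uv: "\<And>i. i < n \<Longrightarrow> z i = z' i" for z z'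
    proof -
      have "\<kappa> z w = \<kappa> z' w" for w using uv by (intro \<kappa>_cong) auto
      moreover have "C j z = C j z'" for j using uv by (rule C_cong)
      ultimately show ?thesis unfolding \<Phi>_def Q_def by (simp only:)
    qed
    show ?thesis
      using nn_integral_split_res[OF m cg, where Z=Z and k=k] unfolding N_def[symmetric] \<Phi>_def Q_def C_fit \<kappa>_fit1 .
  qed
  \<comment> \<open>The arguments of \<open>\<kappa>\<close> move outside, so that
    \<open>\<kappa>\<close> becomes a constant for the two inner integrals.\<close>
  also have "\<dots> = (\<integral>\<^sup>+z. \<integral>\<^sup>+z1. \<integral>\<^sup>+w. \<integral>\<^sup>+v. \<Phi> z w v z1 \<partial>N \<partial>N \<partial>N \<partial>N)"
    by (rule NN.Fubini'[symmetric]) measurable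
  also have "\<dots> = (\<integral>\<^sup>+z. \<integral>\<^sup>+w. \<integral>\<^sup>+z1. \<integral>\<^sup>+v. \<Phi> z w v z1 \<partial>N \<partial>N \<partial>N \<partial>N)"
    by (intro nn_integral_cong NN.Fubini'[symmetric]) measurable
  also have "\<dots> = (\<integral>\<^sup>+z. \<integral>\<^sup>+w. \<integral>\<^sup>+u. \<Psi> (\<kappa> z w) ((1 + (\<kappa> z w)\<^sup>2) * coef_sq n Z k u) \<partial>N \<partial>N \<partial>N)"
  proof (rule nn_integral_cong, rule nn_integral_cong)
    fix z w
    define c where "c = \<kappa> z w"
    have c: "1 + c\<^sup>2 > 0" by (simp add: add_pos_nonneg)
    define h where "h u = \<Psi> c ((1 + c\<^sup>2) * coef_sq n Z k u)" for u
    have hm: "h \<in> borel_measurable (normal_vec {..<n})"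
    proof -
      have "(\<lambda>b. \<Psi> c b) \<in> borel_measurable borel"
        using measurable_compose[OF measurable_Pair1'[of c borel borel] \<Psi>] by simp
      from measurable_compose[OF borel_measurable_times[OF borel_measurable_const coef_sq_normal_vec] this]
      show ?thesis unfolding h_def .
    qed
    have cg: "h u = h v" if "\<And>i. i < n \<Longrightarrow> u i = v i" for u v
    proof -
      have "coef_sq n Z k u = coef_sq n Z k v" using that by (intro coef_sq_cong) auto
      then show ?thesis by (simp only: h_def)
    qed
    \<comment> \<open>\<open>coef_sq\<close> is homogeneous of degree two, so the normalisation of
      \<open>v - c * z1\<close> cancels the factor \<open>1 + c\<^sup>2\<close>.\<close>
    have hs: "h (\<lambda>i. (v i - c * z1 i) / sqrt (1 + c\<^sup>2)) = \<Phi> z w v z1" for v z1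
    proof -
      let ?s = "1 / sqrt (1 + c\<^sup>2)"
      have "coef n Z k (\<lambda>i. (v i - c * z1 i) / sqrt (1 + c\<^sup>2)) j = ?s * (C j v - c * C j z1)" for j
        using coef_linear[of n Z k ?s "\<lambda>i. v i - c * z1 i" 0 z1 j] by (simp add: coef_diff_scale C_def)
      then have "coef_sq n Z k (\<lambda>i. (v i - c * z1 i) / sqrt (1 + c\<^sup>2)) = ?s\<^sup>2 * Q c v z1"
        unfolding coef_sq_def Q_def sum_distrib_left by (simp only: power_mult_distrib)
      moreover have "(1 + c\<^sup>2) * (?s\<^sup>2 * Q c v z1) = Q c v z1"
        using c by (simp add: power_divide)
      ultimately show ?thesis unfolding h_def \<Phi>_def c_def[symmetric] by (simp only:)
    qed
    show "(\<integral>\<^sup>+z1. \<integral>\<^sup>+v. \<Phi> z w v z1 \<partial>N \<partial>N) = (\<integral>\<^sup>+u. \<Psi> (\<kappa> z w) ((1 + (\<kappa> z w)\<^sup>2) * coef_sq n Z k u) \<partial>N)"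
      using nn_integral_combine[OF hm cg, of c] unfolding hs unfolding h_def c_def N_def[symmetric] .
  qed
  finally show ?thesis .
qed

section \<open>Test functions for the squared coefficients\<close>

definition ratio_pow :: "real \<Rightarrow> real \<Rightarrow> real \<Rightarrow> real \<Rightarrow> real" where
  "ratio_pow h \<alpha> \<beta> x = ((1 + x) / (\<alpha> + \<beta> * x)) powr h"

lemma ratio_pow_measurable: "ratio_pow h \<alpha> \<beta> \<in> borel_measurable borel"
  unfolding ratio_pow_def by measurable

text \<open>The stability of the family under the recursion: one more column with coefficient
  \<open>w\<close> only changes the two parameters and releases a power of
  \<open>1 + w\<^sup>2\<close>.\<close>

lemma ratio_pow_compose:
  assumes "\<alpha> > 0" "\<beta> > 0" "x \<ge> 0"
  shows "ratio_pow h \<alpha> \<beta> (w\<^sup>2 + (1 + w\<^sup>2) * x)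
    = (1 + w\<^sup>2) powr h * ratio_pow h (\<alpha> + \<beta> * w\<^sup>2) (\<beta> * (1 + w\<^sup>2)) x"
proof -
  have w: "1 + w\<^sup>2 > 0" by (simp add: add_pos_nonneg)
  have d: "(\<alpha> + \<beta> * w\<^sup>2) + \<beta> * (1 + w\<^sup>2) * x > 0"
    using assms by (intro add_pos_nonneg mult_nonneg_nonneg) auto
  have "(1 + (w\<^sup>2 + (1 + w\<^sup>2) * x)) / (\<alpha> + \<beta> * (w\<^sup>2 + (1 + w\<^sup>2) * x))
    = (1 + w\<^sup>2) * ((1 + x) / ((\<alpha> + \<beta> * w\<^sup>2) + \<beta> * (1 + w\<^sup>2) * x))"
    by (simp add: algebra_simps)
  also have "\<dots> powr h = (1 + w\<^sup>2) powr h * ((1 + x) / ((\<alpha> + \<beta> * w\<^sup>2) + \<beta> * (1 + w\<^sup>2) * x)) powr h"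
    by (rule powr_mult)
  finally show ?thesis unfolding ratio_pow_def .
qed

lemma prob_space_columns: "prob_space (columns n k)"
  unfolding columns_def by (rule prob_space_normal_vec)

text \<open>Substituting \<open>sqrt (\<alpha> / \<beta>) * w\<close> for \<open>w\<close> turns the
  quadratic into \<open>\<alpha> * (1 + w\<^sup>2)\<close>, so the normalising integral of the
  Student law reappears.\<close>

lemma nn_integral_quadratic_powr:
  fixes m :: real
  assumes \<alpha>: "\<alpha> > 0" and \<beta>: "\<beta> > 0"
  shows "(\<integral>\<^sup>+w. ennreal ((\<alpha> + \<beta> * w\<^sup>2) powr (- m / 2)) \<partial>lborel)
    = ennreal (\<alpha> powr (- (m - 1) / 2) * \<beta> powr (- 1 / 2)) * (\<integral>\<^sup>+w. ennreal ((1 + w\<^sup>2) powr (- m / 2)) \<partial>lborel)"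
proof -
  define c where "c = sqrt (\<alpha> / \<beta>)"
  have c: "c > 0" "c\<^sup>2 = \<alpha> / \<beta>" using assms by (auto simp: c_def)
  have "(\<integral>\<^sup>+w. ennreal ((\<alpha> + \<beta> * w\<^sup>2) powr (- m / 2)) \<partial>lborel)
    = ennreal \<bar>c\<bar> * (\<integral>\<^sup>+w. ennreal ((\<alpha> + \<beta> * (0 + c * w)\<^sup>2) powr (- m / 2)) \<partial>lborel)"
    using c by (intro nn_integral_real_affine) auto
  also have "(\<lambda>w. ennreal ((\<alpha> + \<beta> * (0 + c * w)\<^sup>2) powr (- m / 2)))
    = (\<lambda>w. ennreal (\<alpha> powr (- m / 2)) * ennreal ((1 + w\<^sup>2) powr (- m / 2)))"
  proof
    fix w :: real
    have "\<alpha> + \<beta> * (0 + c * w)\<^sup>2 = \<alpha> * (1 + w\<^sup>2)"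
      using \<beta> by (simp add: power_mult_distrib c(2) field_simps)
    then have "(\<alpha> + \<beta> * (0 + c * w)\<^sup>2) powr (- m / 2) = \<alpha> powr (- m / 2) * (1 + w\<^sup>2) powr (- m / 2)"
      by (simp only: powr_mult)
    then show "ennreal ((\<alpha> + \<beta> * (0 + c * w)\<^sup>2) powr (- m / 2)) = ennreal (\<alpha> powr (- m / 2)) * ennreal ((1 + w\<^sup>2) powr (- m / 2))"
      by (simp only: ennreal_mult[OF powr_ge_zero powr_ge_zero])
  qed
  also have "(\<integral>\<^sup>+w. ennreal (\<alpha> powr (- m / 2)) * ennreal ((1 + w\<^sup>2) powr (- m / 2)) \<partial>lborel)
    = ennreal (\<alpha> powr (- m / 2)) * (\<integral>\<^sup>+w. ennreal ((1 + w\<^sup>2) powr (- m / 2)) \<partial>lborel)"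
    by (rule nn_integral_cmult) measurable
  also have "ennreal \<bar>c\<bar> * (ennreal (\<alpha> powr (- m / 2)) * (\<integral>\<^sup>+w. ennreal ((1 + w\<^sup>2) powr (- m / 2)) \<partial>lborel))
    = ennreal (c * \<alpha> powr (- m / 2)) * (\<integral>\<^sup>+w. ennreal ((1 + w\<^sup>2) powr (- m / 2)) \<partial>lborel)"
  proof -
    have "ennreal \<bar>c\<bar> * ennreal (\<alpha> powr (- m / 2)) = ennreal (c * \<alpha> powr (- m / 2))"
      using c(1) by (subst ennreal_mult[symmetric]) auto
    then show ?thesis by (simp only: mult.assoc[symmetric])
  qed
  also have "c * \<alpha> powr (- m / 2) = \<alpha> powr (- (m - 1) / 2) * \<beta> powr (- 1 / 2)"
  proof -
    have "c = (\<alpha> / \<beta>) powr (1 / 2)" using assms by (simp add: c_def powr_half_sqrt)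
    also have "\<dots> = \<alpha> powr (1 / 2) * \<beta> powr (- (1 / 2))"
      by (simp only: powr_divide powr_minus divide_inverse[of "\<alpha> powr (1 / 2)"])
    finally have "c * \<alpha> powr (- m / 2) = (\<alpha> powr (1 / 2) * \<alpha> powr (- m / 2)) * \<beta> powr (- (1 / 2))"
      by (simp only: mult_ac)
    also have "\<alpha> powr (1 / 2) * \<alpha> powr (- m / 2) = \<alpha> powr (- (m - 1) / 2)"
    proof -
      have e: "1 / 2 + - m / 2 = - (m - 1) / 2" by (simp add: field_simps)
      show ?thesis unfolding powr_add[symmetric] e ..
    qed
    finally show ?thesis unfolding minus_divide_left .
  qed
  finally show ?thesis .
qed

text \<open>The right-hand side is what one gets when \<open>coef_sq\<close> is replaced by a ratio of independent
  chi-square variables with \<open>k\<close> and \<open>n + 1 - k\<close> degrees of freedom.\<close>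

lemma nn_integral_ratio_pow_coef_sq:
  fixes n k :: nat
  assumes "k \<le> n" "\<alpha> > 0" "\<beta> > 0"
  shows "(\<integral>\<^sup>+A. \<integral>\<^sup>+v. ennreal (ratio_pow ((real n + 1) / 2) \<alpha> \<beta> (coef_sq n (curry A) k v)) \<partial>normal_vec {..<n} \<partial>columns n k)
    = ennreal (\<alpha> powr (- (real n + 1 - real k) / 2) * \<beta> powr (- real k / 2))"
  using assms
proof (induction k arbitrary: \<alpha> \<beta>)
  case 0
  have "ratio_pow ((real n + 1) / 2) \<alpha> \<beta> 0 = (1 / \<alpha>) powr ((real n + 1) / 2)"
    unfolding ratio_pow_def by simp
  also have "\<dots> = \<alpha> powr (- ((real n + 1) / 2))"
    by (simp only: powr_divide powr_one_eq_one powr_minus inverse_eq_divide)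
  finally have r: "ratio_pow ((real n + 1) / 2) \<alpha> \<beta> 0 = \<alpha> powr (- ((real n + 1) / 2))" .
  have e: "\<alpha> powr (- (real n + 1 - real 0) / 2) * \<beta> powr (- real 0 / 2) = \<alpha> powr (- ((real n + 1) / 2))"
  proof -
    have e0: "- (real n + 1 - real 0) / 2 = - ((real n + 1) / 2)" by (simp add: field_simps)
    show ?thesis unfolding e0 using 0 by simp
  qed
  have z: "coef_sq n Z 0 v = 0" for Z v by (simp add: coef_sq_def)
  show ?case unfolding z r e
    by (simp only: nn_integral_const normal_vec.emeasure_space_1 prob_space.emeasure_space_1[OF prob_space_columns] mult_1_right)
next
  case (Suc k)
  define N where "N = normal_vec {..<n}"
  define h where "h = (real n + 1) / 2"
  define m where "m = real n + 1 - real k"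
  interpret N: prob_space N unfolding N_def by (rule prob_space_normal_vec)
  interpret C: prob_space "columns n k" by (rule prob_space_columns)
  interpret CL: pair_sigma_finite "columns n k" lborel ..
  have kn: "k < n" using Suc.prems by simp
  define \<phi> where "\<phi> x = ennreal (ratio_pow h \<alpha> \<beta> x)" for x
  have \<phi>[measurable]: "\<phi> \<in> borel_measurable borel"
    unfolding \<phi>_def using ratio_pow_measurable by (rule measurable_compose) simp
  have x_joint: "(\<lambda>\<omega>. coef_sq n (curry (fst \<omega>)) l (snd \<omega>)) \<in> borel_measurable (columns n l \<Otimes>\<^sub>M N)" for l
  proof (rule measurable_coef_sq)
    show "(\<lambda>x. snd x i) \<in> borel_measurable (columns n l \<Otimes>\<^sub>M N)" if "i < n" for i
      unfolding N_def using that by (intro components_normal_vec_pair) simp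
    show "(\<lambda>x. curry (fst x) j i) \<in> borel_measurable (columns n l \<Otimes>\<^sub>M N)" if "j < l" "i < n" for j i
      using measurable_compose[OF measurable_fst curry_columns[OF that]] .
  qed
  define t where "t w = ennreal ((1 + w\<^sup>2) powr (- (real n - real k + 1) / 2))" for w :: real
  have t[measurable]: "t \<in> borel_measurable borel" unfolding t_def by measurable
  define I where "I = (\<integral>\<^sup>+w. t w \<partial>lborel)"
  define F where "F Z = (\<integral>\<^sup>+v. \<phi> (coef_sq n Z (Suc k) v) \<partial>N)" for Z
  define X where "X = (\<lambda>\<omega>. coef_sq n (curry (fst \<omega>)) k (snd \<omega>))"
  have X: "X \<in> borel_measurable (columns n k \<Otimes>\<^sub>M N)" unfolding X_def by (rule x_joint)
  \<comment> \<open>The average of the test function over the remaining coefficients when the last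
    one equals \<open>w\<close>.\<close>
  define G where "G A w = (\<integral>\<^sup>+u. \<phi> (w\<^sup>2 + (1 + w\<^sup>2) * coef_sq n (curry A) k u) \<partial>N)" for A w
  have Gm: "(\<lambda>(A, w). G A w) \<in> borel_measurable (columns n k \<Otimes>\<^sub>M lborel)"
  proof -
    have "(\<lambda>\<omega>. X (fst (fst \<omega>), snd \<omega>)) \<in> borel_measurable ((columns n k \<Otimes>\<^sub>M lborel) \<Otimes>\<^sub>M N)"
      by (rule measurable_compose[OF _ X]) measurable
    then have [measurable]: "(\<lambda>\<omega>. coef_sq n (curry (fst (fst \<omega>))) k (snd \<omega>)) \<in> borel_measurable ((columns n k \<Otimes>\<^sub>M lborel) \<Otimes>\<^sub>M N)"
      by (simp add: X_def)
    have "(\<lambda>\<omega>. \<phi> ((snd (fst \<omega>))\<^sup>2 + (1 + (snd (fst \<omega>))\<^sup>2) * coef_sq n (curry (fst (fst \<omega>))) k (snd \<omega>)))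
        \<in> borel_measurable ((columns n k \<Otimes>\<^sub>M lborel) \<Otimes>\<^sub>M N)" by measurable
    from N.borel_measurable_nn_integral_fst[OF this]
    show ?thesis unfolding G_def case_prod_beta by simp
  qed
  have G1: "G A \<in> borel_measurable borel" if "A \<in> space (columns n k)" for A
    using measurable_compose[OF measurable_Pair1'[OF that] Gm] by simp
  have Fm: "(\<lambda>A. F (curry A)) \<in> borel_measurable (columns n (Suc k))"
  proof -
    have "(\<lambda>\<omega>. \<phi> (coef_sq n (curry (fst \<omega>)) (Suc k) (snd \<omega>))) \<in> borel_measurable (columns n (Suc k) \<Otimes>\<^sub>M N)"
      using x_joint \<phi> by (rule measurable_compose)
    from N.borel_measurable_nn_integral_fst[OF this] show ?thesis unfolding F_def by simp
  qed
  have "(\<integral>\<^sup>+A. F (curry A) \<partial>columns n (Suc k)) = (\<integral>\<^sup>+A. \<integral>\<^sup>+z. F ((curry A)(k := z)) \<partial>N \<partial>columns n k)"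
    unfolding N_def
  proof (rule nn_integral_columns_Suc[OF Fm])
    fix Z Z' :: "nat \<Rightarrow> nat \<Rightarrow> real" assume "\<And>j i. j < Suc k \<Longrightarrow> i < n \<Longrightarrow> Z j i = Z' j i"
    then have "coef_sq n Z (Suc k) v = coef_sq n Z' (Suc k) v" for v by (rule coef_sq_cong[OF refl])
    then show "F Z = F Z'" by (simp only: F_def)
  qed
  also have "\<dots> = (\<integral>\<^sup>+A. (\<integral>\<^sup>+w. G A w * t w \<partial>lborel) / I \<partial>columns n k)"
  proof (rule nn_integral_cong_AE)
    show "AE A in columns n k. (\<integral>\<^sup>+z. F ((curry A)(k := z)) \<partial>N) = (\<integral>\<^sup>+w. G A w * t w \<partial>lborel) / I"
      using AE_nondeg_columns[OF less_imp_le[OF kn]] AE_space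
    proof eventually_elim
      case (elim A)
      let ?Z = "curry A" and ?\<kappa> = "\<lambda>z v. kap n ((curry A)(k := z)) k v"
      have "(\<integral>\<^sup>+z. F (?Z(k := z)) \<partial>N) = (\<integral>\<^sup>+z. \<integral>\<^sup>+v. \<phi> ((?\<kappa> z v)\<^sup>2 + coef_sq n ?Z k (\<lambda>i. v i - ?\<kappa> z v * z i)) \<partial>N \<partial>N)"
      proof -
        have "coef_sq n (?Z(k := z)) k u = coef_sq n ?Z k u" for z u
          by (rule coef_sq_cong) auto
        then show ?thesis unfolding F_def coef_sq_Suc by simp
      qed
      also have "\<dots> = (\<integral>\<^sup>+z. \<integral>\<^sup>+v. \<integral>\<^sup>+u. \<phi> ((?\<kappa> z v)\<^sup>2 + (1 + (?\<kappa> z v)\<^sup>2) * coef_sq n ?Z k u) \<partial>N \<partial>N \<partial>N)"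
        unfolding N_def by (rule nn_integral_last_column[where \<Psi>="\<lambda>a b. \<phi> (a\<^sup>2 + b)"]) measurable
      also have "\<dots> = (\<integral>\<^sup>+z. \<integral>\<^sup>+v. G A (?\<kappa> z v) \<partial>N \<partial>N)"
        unfolding G_def ..
      also have "\<dots> = (\<integral>\<^sup>+w. G A w * t w \<partial>lborel) / I"
        unfolding I_def t_def N_def by (rule nn_integral_kap(1)[OF elim(1) kn G1[OF elim(2)]])
      finally show ?case .
    qed
  qed
  also have "\<dots> = (\<integral>\<^sup>+A. \<integral>\<^sup>+w. G A w * t w \<partial>lborel \<partial>columns n k) / I"
    by (rule nn_integral_divide) (use Gm in measurable)
  \<comment> \<open>After the interchange the induction hypothesis applies for each fixed
    \<open>w\<close>, with the parameters produced by \<open>ratio_pow_compose\<close>; hence the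
    induction has \<open>\<alpha>\<close> and \<open>\<beta>\<close> arbitrary.\<close>
  also have "(\<integral>\<^sup>+A. \<integral>\<^sup>+w. G A w * t w \<partial>lborel \<partial>columns n k) = (\<integral>\<^sup>+w. \<integral>\<^sup>+A. G A w * t w \<partial>columns n k \<partial>lborel)"
    by (rule CL.Fubini'[symmetric]) (use Gm in measurable)
  also have "\<dots> = (\<integral>\<^sup>+w. ennreal (\<beta> powr (- real k / 2)) * ennreal ((\<alpha> + \<beta> * w\<^sup>2) powr (- m / 2)) \<partial>lborel)"
  proof (rule nn_integral_cong)
    fix w :: real
    have w: "1 + w\<^sup>2 > 0" by (simp add: add_pos_nonneg)
    have pos: "\<alpha> + \<beta> * w\<^sup>2 > 0" "\<beta> * (1 + w\<^sup>2) > 0"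
      using Suc.prems w by (auto intro: add_pos_nonneg)
    have Gw: "(\<lambda>A. G A w) \<in> borel_measurable (columns n k)"
      using measurable_compose[OF measurable_Pair2'[of w lborel "columns n k"] Gm] by simp
    have GA: "G A w = ennreal ((1 + w\<^sup>2) powr h) * (\<integral>\<^sup>+u. ennreal (ratio_pow h (\<alpha> + \<beta> * w\<^sup>2) (\<beta> * (1 + w\<^sup>2)) (coef_sq n (curry A) k u)) \<partial>N)" for A
    proof -
      have "\<phi> (w\<^sup>2 + (1 + w\<^sup>2) * coef_sq n (curry A) k u)
        = ennreal ((1 + w\<^sup>2) powr h) * ennreal (ratio_pow h (\<alpha> + \<beta> * w\<^sup>2) (\<beta> * (1 + w\<^sup>2)) (coef_sq n (curry A) k u))" for u
        unfolding \<phi>_def ratio_pow_compose[OF Suc.prems(2,3) coef_sq_nonneg]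
        by (rule ennreal_mult) (auto simp: ratio_pow_def)
      moreover have "(\<lambda>u. ennreal (ratio_pow h (\<alpha> + \<beta> * w\<^sup>2) (\<beta> * (1 + w\<^sup>2)) (coef_sq n (curry A) k u))) \<in> borel_measurable N"
        unfolding N_def using coef_sq_normal_vec ratio_pow_measurable
        by (intro measurable_compose[OF _ measurable_ennreal] measurable_compose[OF coef_sq_normal_vec ratio_pow_measurable])
      ultimately show ?thesis unfolding G_def by (simp only: nn_integral_cmult)
    qed
    have m1: "(\<lambda>A. \<integral>\<^sup>+u. ennreal (ratio_pow h (\<alpha> + \<beta> * w\<^sup>2) (\<beta> * (1 + w\<^sup>2)) (coef_sq n (curry A) k u)) \<partial>N) \<in> borel_measurable (columns n k)"
    proof -
      have "(\<lambda>\<omega>. ennreal (ratio_pow h (\<alpha> + \<beta> * w\<^sup>2) (\<beta> * (1 + w\<^sup>2)) (X \<omega>))) \<in> borel_measurable (columns n k \<Otimes>\<^sub>M N)"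
        by (rule measurable_compose[OF measurable_compose[OF X ratio_pow_measurable] measurable_ennreal])
      from N.borel_measurable_nn_integral_fst[OF this] show ?thesis unfolding X_def by simp
    qed
    have "(\<integral>\<^sup>+A. G A w * t w \<partial>columns n k) = (\<integral>\<^sup>+A. G A w \<partial>columns n k) * t w"
      by (rule nn_integral_multc[OF Gw])
    also have "(\<integral>\<^sup>+A. G A w \<partial>columns n k) = ennreal ((1 + w\<^sup>2) powr h) * ennreal ((\<alpha> + \<beta> * w\<^sup>2) powr (- m / 2) * (\<beta> * (1 + w\<^sup>2)) powr (- real k / 2))"
      unfolding GA nn_integral_cmult[OF m1] using Suc.IH[OF less_imp_le[OF kn] pos]
      unfolding N_def[symmetric] h_def[symmetric] m_def[symmetric] by (simp only:)
    also have "\<dots> * t w = ennreal ((1 + w\<^sup>2) powr h * ((\<alpha> + \<beta> * w\<^sup>2) powr (- m / 2) * (\<beta> * (1 + w\<^sup>2)) powr (- real k / 2)) * (1 + w\<^sup>2) powr (- (real n - real k + 1) / 2))"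
      unfolding t_def by (subst (2 1) ennreal_mult) auto
    also have "(1 + w\<^sup>2) powr h * ((\<alpha> + \<beta> * w\<^sup>2) powr (- m / 2) * (\<beta> * (1 + w\<^sup>2)) powr (- real k / 2)) * (1 + w\<^sup>2) powr (- (real n - real k + 1) / 2)
      = \<beta> powr (- real k / 2) * (\<alpha> + \<beta> * w\<^sup>2) powr (- m / 2)"
    proof -
      have 1: "(\<beta> * (1 + w\<^sup>2)) powr (- real k / 2) = \<beta> powr (- real k / 2) * (1 + w\<^sup>2) powr (- real k / 2)"
        by (rule powr_mult)
      \<comment> \<open>The exponent \<open>(real n + 1) / 2\<close> of the test function is the one
        for which the powers of \<open>1 + w\<^sup>2\<close> from the recursion, the induction
        hypothesis and the Student density cancel.\<close>
      have 2: "(1 + w\<^sup>2) powr h * ((1 + w\<^sup>2) powr (- real k / 2) * (1 + w\<^sup>2) powr (- (real n - real k + 1) / 2)) = 1"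
      proof -
        have e: "h + (- real k / 2 + - (real n - real k + 1) / 2) = 0" unfolding h_def by (simp add: field_simps)
        show ?thesis unfolding powr_add[symmetric] e using w by simp
      qed
      have 3: "a * (g * (b * c)) * d = (a * (c * d)) * (b * g)" for a b c d g :: real
        by (simp only: mult_ac)
      show ?thesis unfolding 1 3 2 mult_1_left ..
    qed
    finally show "(\<integral>\<^sup>+A. G A w * t w \<partial>columns n k) = ennreal (\<beta> powr (- real k / 2)) * ennreal ((\<alpha> + \<beta> * w\<^sup>2) powr (- m / 2))"
      by (simp only: ennreal_mult[OF powr_ge_zero powr_ge_zero])
  qed
  also have "\<dots> = ennreal (\<beta> powr (- real k / 2)) * (\<integral>\<^sup>+w. ennreal ((\<alpha> + \<beta> * w\<^sup>2) powr (- m / 2)) \<partial>lborel)"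
    by (rule nn_integral_cmult) measurable
  also have "\<dots> = ennreal (\<beta> powr (- real k / 2)) * (ennreal (\<alpha> powr (- (m - 1) / 2) * \<beta> powr (- 1 / 2)) * I)"
  proof -
    have "t = (\<lambda>w. ennreal ((1 + w\<^sup>2) powr (- m / 2)))"
      unfolding t_def m_def by (simp add: algebra_simps)
    then show ?thesis unfolding I_def by (simp only: nn_integral_quadratic_powr[OF Suc.prems(2,3)])
  qed
  also have "\<dots> / I = ennreal (\<beta> powr (- real k / 2)) * ennreal (\<alpha> powr (- (m - 1) / 2) * \<beta> powr (- 1 / 2))"
  proof -
    \<comment> \<open>\<open>nn_integral_kap\<close> shows \<open>I\<close> to be positive and
      finite in the presence of a nondegenerate array; one exists because almost every array is
      nondegenerate.\<close>
    have "\<exists>A. nondeg n (curry A) k"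
    proof (rule ccontr)
      assume "\<nexists>A. nondeg n (curry A) k"
      then have "AE A in columns n k. False" using AE_nondeg_columns[OF less_imp_le[OF kn]] by simp
      then show False by simp
    qed
    then obtain A where "nondeg n (curry A) k" ..
    from nn_integral_kap(2,3)[OF this kn, of "\<lambda>_. 0"] have "I \<noteq> 0" "I \<noteq> \<top>"
      unfolding I_def t_def by auto
    then show ?thesis unfolding mult.assoc[symmetric] by (rule mult_divide_eq_ennreal)
  qed
  also have "\<dots> = ennreal (\<alpha> powr (- (real n + 1 - real (Suc k)) / 2) * \<beta> powr (- real (Suc k) / 2))"
  proof -
    have e1: "- (m - 1) / 2 = - (real n + 1 - real (Suc k)) / 2" by (simp add: m_def)
    have e2: "- real k / 2 + - 1 / 2 = - real (Suc k) / 2" by (simp add: field_simps)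
    have "\<beta> powr (- real k / 2) * (\<alpha> powr (- (m - 1) / 2) * \<beta> powr (- 1 / 2))
      = \<alpha> powr (- (real n + 1 - real (Suc k)) / 2) * \<beta> powr (- real (Suc k) / 2)"
      unfolding e1 e2[symmetric] powr_add by (simp only: mult_ac)
    then show ?thesis by (subst ennreal_mult[symmetric]) auto
  qed
  finally show ?case unfolding F_def \<phi>_def h_def N_def .
qed

section \<open>Tail bounds\<close>

text \<open>The left-hand side is the rate in the chi-square upper tail, the right-hand side has the
  shape of \<open>Psi\<close>. The difference vanishes at 0 and has derivative
  \<open>x / (1 + x) * (1 - 1 / (1 + x)\<^sup>2)\<close>.\<close>

lemma diff_ln_one_plus_ge:
  fixes t :: real
  assumes "t \<ge> 0"
  shows "t - ln (1 + t) \<ge> (t / (1 + t))\<^sup>2 / 2"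
proof -
  define f where "f x = x - ln (1 + x) - (x / (1 + x))\<^sup>2 / 2" for x :: real
  have "f 0 \<le> f t"
  proof (rule DERIV_nonneg_imp_nondecreasing[OF assms])
    fix x :: real assume x: "0 \<le> x" "x \<le> t"
    have d1: "((\<lambda>x. x / (1 + x)) has_real_derivative 1 / (1 + x)\<^sup>2) (at x)"
      using x by (auto intro!: derivative_eq_intros simp: power2_eq_square)
    have d2: "((\<lambda>x. ln (1 + x)) has_real_derivative 1 / (1 + x)) (at x)"
      using x by (auto intro!: derivative_eq_intros)
    have d3: "((\<lambda>x. (x / (1 + x))\<^sup>2 / 2) has_real_derivative x / (1 + x) * (1 / (1 + x)\<^sup>2)) (at x)"
      by (rule DERIV_cong[OF DERIV_cdivide[OF DERIV_power[OF d1, of 2], of 2]]) simp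
    have "(f has_real_derivative 1 - 1 / (1 + x) - x / (1 + x) * (1 / (1 + x)\<^sup>2)) (at x)"
      unfolding f_def by (rule DERIV_diff[OF DERIV_diff[OF DERIV_ident d2] d3])
    moreover have "1 - 1 / (1 + x) - x / (1 + x) * (1 / (1 + x)\<^sup>2) = x / (1 + x) * (1 - 1 / (1 + x)\<^sup>2)"
    proof -
      have "1 - 1 / (1 + x) = x / (1 + x)" using x by (simp add: field_simps)
      then show ?thesis by (simp only: right_diff_distrib mult_1_right)
    qed
    moreover have "x / (1 + x) * (1 - 1 / (1 + x)\<^sup>2) \<ge> 0"
      using x by (intro mult_nonneg_nonneg) (auto simp: divide_le_eq)
    ultimately show "\<exists>y. (f has_real_derivative y) (at x) \<and> 0 \<le> y" by metis
  qed
  then show ?thesis by (simp add: f_def)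
qed

text \<open>The rate in the chi-square lower tail; the difference of the two sides vanishes at 0 and
  has derivative \<open>x\<^sup>2 / (1 - x)\<close>.\<close>

lemma minus_ln_one_minus_ge:
  fixes t :: real
  assumes "t \<ge> 0" "t < 1"
  shows "- ln (1 - t) - t \<ge> t\<^sup>2 / 2"
proof -
  define f where "f x = - ln (1 - x) - x - x\<^sup>2 / 2" for x :: real
  have "f 0 \<le> f t"
  proof (rule DERIV_nonneg_imp_nondecreasing[OF assms(1)])
    fix x :: real assume x: "0 \<le> x" "x \<le> t"
    have "(f has_real_derivative x\<^sup>2 / (1 - x)) (at x)"
      unfolding f_def using x assms(2)
      by (auto intro!: derivative_eq_intros simp: divide_simps power2_eq_square) (simp_all add: algebra_simps)
    moreover have "x\<^sup>2 / (1 - x) \<ge> 0" using x assms(2) by auto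
    ultimately show "\<exists>y. (f has_real_derivative y) (at x) \<and> 0 \<le> y" by blast
  qed
  then show ?thesis by (simp add: f_def)
qed

lemma frac_mono:
  fixes s t :: real
  assumes "0 \<le> s" "s \<le> t"
  shows "s / (1 + s) \<le> t / (1 + t)"
  using assms by (simp add: divide_simps algebra_simps)

lemma emeasure_le_nn_integral:
  assumes "{\<omega> \<in> space M. P \<omega>} \<in> sets M" "\<And>\<omega>. \<omega> \<in> space M \<Longrightarrow> P \<omega> \<Longrightarrow> 1 \<le> g \<omega>"
  shows "emeasure M {\<omega> \<in> space M. P \<omega>} \<le> (\<integral>\<^sup>+\<omega>. g \<omega> \<partial>M)"
proof -
  have "emeasure M {\<omega> \<in> space M. P \<omega>} = (\<integral>\<^sup>+\<omega>. indicator {\<omega> \<in> space M. P \<omega>} \<omega> \<partial>M)"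
    using assms(1) by simp
  also have "\<dots> \<le> (\<integral>\<^sup>+\<omega>. g \<omega> \<partial>M)"
    using assms(2) by (intro nn_integral_mono) (auto simp: indicator_def)
  finally show ?thesis .
qed

section \<open>Chernoff bounds for the standardised array\<close>

definition array_law :: "nat \<Rightarrow> nat \<Rightarrow> ((nat \<times> nat \<Rightarrow> real) \<times> (nat \<Rightarrow> real)) measure" where
  "array_law n p = columns n p \<Otimes>\<^sub>M normal_vec {..<n}"

lemma prob_space_array_law: "prob_space (array_law n p)"
proof -
  interpret C: prob_space "columns n p" by (rule prob_space_columns)
  interpret pair_prob_space "columns n p" "normal_vec {..<n}" ..
  show ?thesis unfolding array_law_def by (rule P.prob_space_axioms)
qed

interpretation array_law: prob_space "array_law n p" for n p
  by (rule prob_space_array_law)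

lemma nn_integral_array_law:
  assumes "f \<in> borel_measurable (array_law n p)"
  shows "(\<integral>\<^sup>+\<omega>. f \<omega> \<partial>array_law n p) = (\<integral>\<^sup>+A. \<integral>\<^sup>+v. f (A, v) \<partial>normal_vec {..<n} \<partial>columns n p)"
  using assms unfolding array_law_def by (rule normal_vec.nn_integral_fst[symmetric])

lemma array_law_entries:
  "i < n \<Longrightarrow> (\<lambda>\<omega>. snd \<omega> i) \<in> borel_measurable (array_law n p)"
  "j < p \<Longrightarrow> i < n \<Longrightarrow> (\<lambda>\<omega>. curry (fst \<omega>) j i) \<in> borel_measurable (array_law n p)"
proof -
  show "(\<lambda>\<omega>. snd \<omega> i) \<in> borel_measurable (array_law n p)" if "i < n"
    unfolding array_law_def using that by (intro components_normal_vec_pair) simp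
  show "(\<lambda>\<omega>. curry (fst \<omega>) j i) \<in> borel_measurable (array_law n p)" if "j < p" "i < n"
    unfolding array_law_def using measurable_compose[OF measurable_fst curry_columns[OF that]] .
qed

abbreviation "array_rss n p \<omega> \<equiv> rss n (curry (fst \<omega>)) p (snd \<omega>)"
abbreviation "array_coef_sq n p \<omega> \<equiv> coef_sq n (curry (fst \<omega>)) p (snd \<omega>)"

lemma array_law_rss [measurable]: "(\<lambda>\<omega>. array_rss n p \<omega>) \<in> borel_measurable (array_law n p)"
  by (rule measurable_rss[OF array_law_entries])

lemma array_law_coef_sq [measurable]: "(\<lambda>\<omega>. array_coef_sq n p \<omega>) \<in> borel_measurable (array_law n p)"
  by (rule measurable_coef_sq[OF array_law_entries])

lemma nn_integral_array_exp_rss: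
  assumes p: "p \<le> n" and l: "l > -1" and C: "C \<ge> 0"
  shows "(\<integral>\<^sup>+\<omega>. ennreal (exp (- l * array_rss n p \<omega> / 2) * C) \<partial>array_law n p)
    = ennreal (exp (- (real n - real p) / 2 * ln (1 + l)) * C)"
proof -
  interpret C: prob_space "columns n p" by (rule prob_space_columns)
  define a where "a = ennreal ((1 + l) powr (- (real n - real p) / 2))"
  have "(\<integral>\<^sup>+\<omega>. ennreal (exp (- l * array_rss n p \<omega> / 2) * C) \<partial>array_law n p)
    = (\<integral>\<^sup>+\<omega>. ennreal (exp (- l * array_rss n p \<omega> / 2)) * ennreal C \<partial>array_law n p)"
    using C by (intro nn_integral_cong ennreal_mult) auto
  also have "\<dots> = (\<integral>\<^sup>+\<omega>. ennreal (exp (- l * array_rss n p \<omega> / 2)) \<partial>array_law n p) * ennreal C"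
    by (rule nn_integral_multc) measurable
  also have "(\<integral>\<^sup>+\<omega>. ennreal (exp (- l * array_rss n p \<omega> / 2)) \<partial>array_law n p)
    = (\<integral>\<^sup>+A. \<integral>\<^sup>+v. ennreal (exp (- l * rss n (curry A) p v / 2)) \<partial>normal_vec {..<n} \<partial>columns n p)"
  proof -
    have m: "(\<lambda>\<omega>. ennreal (exp (- l * array_rss n p \<omega> / 2))) \<in> borel_measurable (array_law n p)"
      by measurable
    show ?thesis unfolding nn_integral_array_law[OF m] fst_conv snd_conv ..
  qed
  also have "\<dots> = (\<integral>\<^sup>+A. a \<partial>columns n p)"
  proof (rule nn_integral_cong_AE)
    show "AE A in columns n p. (\<integral>\<^sup>+v. ennreal (exp (- l * rss n (curry A) p v / 2)) \<partial>normal_vec {..<n}) = a"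
      using AE_nondeg_columns[OF p] unfolding a_def by eventually_elim (rule nn_integral_exp_rss[OF l])
  qed
  also have "\<dots> = a" by (simp add: C.emeasure_space_1)
  also have "a * ennreal C = ennreal (exp (- (real n - real p) / 2 * ln (1 + l)) * C)"
    unfolding a_def using l C by (subst ennreal_mult[symmetric]) (auto simp: powr_def)
  finally show ?thesis .
qed

lemma array_rss_upper:
  assumes p: "p < n" and t: "t > 0"
  defines "k \<equiv> real n - real p"
  shows "measure (array_law n p) {\<omega> \<in> space (array_law n p). array_rss n p \<omega> > k * (1 + t)}
    \<le> exp (- k * (t / (1 + t))\<^sup>2 / 4)"
proof -
  have k: "k > 0" using p by (simp add: k_def)
  \<comment> \<open>The Chernoff exponent is least where \<open>1 + l = 1 / (1 + t)\<close>; the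
    resulting \<open>l\<close> is negative, as an upper tail requires.\<close>
  define l where "l = - t / (1 + t)"
  have l: "l > -1" "l \<le> 0" "1 + l = 1 / (1 + t)" using t by (auto simp: l_def divide_simps)
  have lt: "l * (k * (1 + t)) = - (k * t)" using t by (simp add: l_def field_simps)
  have ln: "ln (1 + l) = - ln (1 + t)" unfolding l(3) using t by (simp add: ln_div)
  have "ennreal (measure (array_law n p) {\<omega> \<in> space (array_law n p). array_rss n p \<omega> > k * (1 + t)})
      \<le> (\<integral>\<^sup>+\<omega>. ennreal (exp (- l * array_rss n p \<omega> / 2) * exp (l * (k * (1 + t)) / 2)) \<partial>array_law n p)"
    unfolding array_law.emeasure_eq_measure[symmetric]
  proof (rule emeasure_le_nn_integral)
    fix \<omega> assume "array_rss n p \<omega> > k * (1 + t)"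
    then have "0 \<le> - l * (array_rss n p \<omega> - k * (1 + t)) / 2"
      using l by (intro divide_nonneg_nonneg mult_nonneg_nonneg) auto
    also have "\<dots> = - l * array_rss n p \<omega> / 2 + l * (k * (1 + t)) / 2" by (simp add: field_simps)
    finally show "1 \<le> ennreal (exp (- l * array_rss n p \<omega> / 2) * exp (l * (k * (1 + t)) / 2))"
      unfolding exp_add[symmetric] by (simp add: ennreal_ge_1)
  qed measurable
  also have "\<dots> = ennreal (exp (- k / 2 * ln (1 + l)) * exp (l * (k * (1 + t)) / 2))"
    unfolding k_def using p l by (intro nn_integral_array_exp_rss) auto
  also have "exp (- k / 2 * ln (1 + l)) * exp (l * (k * (1 + t)) / 2) = exp (- (k / 2 * (t - ln (1 + t))))"
    unfolding exp_add[symmetric] ln lt by (simp add: algebra_simps)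
  finally have "measure (array_law n p) {\<omega> \<in> space (array_law n p). array_rss n p \<omega> > k * (1 + t)}
      \<le> exp (- (k / 2 * (t - ln (1 + t))))" by (simp only: ennreal_le_iff exp_ge_zero)
  also have "\<dots> \<le> exp (- k * (t / (1 + t))\<^sup>2 / 4)"
  proof -
    have "k / 2 * ((t / (1 + t))\<^sup>2 / 2) \<le> k / 2 * (t - ln (1 + t))"
      using diff_ln_one_plus_ge[of t] t k by (intro mult_left_mono) auto
    then show ?thesis by simp
  qed
  finally show ?thesis .
qed

lemma array_rss_lower:
  assumes p: "p < n" and t: "t > 0"
  defines "k \<equiv> real n - real p"
  shows "measure (array_law n p) {\<omega> \<in> space (array_law n p). array_rss n p \<omega> < k * (1 - t)}
    \<le> exp (- k * (t / (1 + t))\<^sup>2 / 4)"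
proof (cases "t < 1")
  \<comment> \<open>For \<open>t\<close> at least 1 the threshold is not positive and the event is
    empty.\<close>
  case False
  have k: "k > 0" using p by (simp add: k_def)
  have "\<not> array_rss n p \<omega> < k * (1 - t)" for \<omega>
  proof -
    have "k * (1 - t) \<le> 0" using k False by (simp add: mult_nonneg_nonpos)
    then show ?thesis using rss_nonneg[of n "curry (fst \<omega>)" p "snd \<omega>"] by linarith
  qed
  then show ?thesis by simp
next
  case True
  have k: "k > 0" using p by (simp add: k_def)
  \<comment> \<open>The minimiser again: \<open>1 + l = 1 / (1 - t)\<close>.\<close>
  define l where "l = t / (1 - t)"
  have l: "l > -1" "l \<ge> 0" "1 + l = 1 / (1 - t)" using t True by (auto simp: l_def divide_simps)
  have lt: "l * (k * (1 - t)) = k * t" using t True by (simp add: l_def field_simps)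
  have ln: "ln (1 + l) = - ln (1 - t)" unfolding l(3) using t True by (simp add: ln_div)
  have "ennreal (measure (array_law n p) {\<omega> \<in> space (array_law n p). array_rss n p \<omega> < k * (1 - t)})
      \<le> (\<integral>\<^sup>+\<omega>. ennreal (exp (- l * array_rss n p \<omega> / 2) * exp (l * (k * (1 - t)) / 2)) \<partial>array_law n p)"
    unfolding array_law.emeasure_eq_measure[symmetric]
  proof (rule emeasure_le_nn_integral)
    fix \<omega> assume "array_rss n p \<omega> < k * (1 - t)"
    then have "0 \<le> l * (k * (1 - t) - array_rss n p \<omega>) / 2"
      using l by (intro divide_nonneg_nonneg mult_nonneg_nonneg) auto
    also have "\<dots> = - l * array_rss n p \<omega> / 2 + l * (k * (1 - t)) / 2" by (simp add: field_simps)
    finally show "1 \<le> ennreal (exp (- l * array_rss n p \<omega> / 2) * exp (l * (k * (1 - t)) / 2))"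
      unfolding exp_add[symmetric] by (simp add: ennreal_ge_1)
  qed measurable
  also have "\<dots> = ennreal (exp (- k / 2 * ln (1 + l)) * exp (l * (k * (1 - t)) / 2))"
    unfolding k_def using p l by (intro nn_integral_array_exp_rss) auto
  also have "exp (- k / 2 * ln (1 + l)) * exp (l * (k * (1 - t)) / 2) = exp (- (k / 2 * (- ln (1 - t) - t)))"
    unfolding exp_add[symmetric] ln lt by (simp add: algebra_simps)
  finally have "measure (array_law n p) {\<omega> \<in> space (array_law n p). array_rss n p \<omega> < k * (1 - t)}
      \<le> exp (- (k / 2 * (- ln (1 - t) - t)))" by (simp only: ennreal_le_iff exp_ge_zero)
  also have "\<dots> \<le> exp (- k * (t / (1 + t))\<^sup>2 / 4)"
  proof -
    have "(t / (1 + t))\<^sup>2 \<le> t\<^sup>2" using t by (intro power_mono) (auto simp: divide_simps)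
    then have "(t / (1 + t))\<^sup>2 / 2 \<le> - ln (1 - t) - t"
      using minus_ln_one_minus_ge[OF less_imp_le[OF t] True] by linarith
    then have "k / 2 * ((t / (1 + t))\<^sup>2 / 2) \<le> k / 2 * (- ln (1 - t) - t)"
      using k by (intro mult_left_mono) auto
    then show ?thesis by simp
  qed
  finally show ?thesis .
qed

text \<open>Markov's inequality for the test function, which is at least 1 exactly where
  \<open>\<alpha> + \<beta> * x \<le> 1 + x\<close>.\<close>

lemma measure_array_coef_sq_le:
  assumes p: "p \<le> n" and \<alpha>: "\<alpha> > 0" and \<beta>: "\<beta> > 0"
    and P[measurable]: "Measurable.pred borel P" and P_imp: "\<And>x. x \<ge> 0 \<Longrightarrow> P x \<Longrightarrow> \<alpha> + \<beta> * x \<le> 1 + x"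
  shows "measure (array_law n p) {\<omega> \<in> space (array_law n p). P (array_coef_sq n p \<omega>)}
    \<le> \<alpha> powr (- (real n + 1 - real p) / 2) * \<beta> powr (- real p / 2)"
proof -
  let ?h = "(real n + 1) / 2"
  have m: "(\<lambda>\<omega>. ennreal (ratio_pow ?h \<alpha> \<beta> (array_coef_sq n p \<omega>))) \<in> borel_measurable (array_law n p)"
    by (rule measurable_compose[OF measurable_compose[OF array_law_coef_sq ratio_pow_measurable] measurable_ennreal])
  have "ennreal (measure (array_law n p) {\<omega> \<in> space (array_law n p). P (array_coef_sq n p \<omega>)})
    \<le> (\<integral>\<^sup>+\<omega>. ennreal (ratio_pow ?h \<alpha> \<beta> (array_coef_sq n p \<omega>)) \<partial>array_law n p)"
    unfolding array_law.emeasure_eq_measure[symmetric]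
  proof (rule emeasure_le_nn_integral)
    fix \<omega> assume P: "P (array_coef_sq n p \<omega>)"
    define x where "x = array_coef_sq n p \<omega>"
    have x: "x \<ge> 0" by (simp add: x_def)
    have "\<alpha> + \<beta> * x > 0" using \<alpha> \<beta> x by (simp add: add_pos_nonneg)
    moreover have "\<alpha> + \<beta> * x \<le> 1 + x" using P_imp[OF x] P by (simp add: x_def)
    ultimately have "1 \<le> (1 + x) / (\<alpha> + \<beta> * x)" by (simp add: le_divide_eq)
    then have "1 \<le> ratio_pow ?h \<alpha> \<beta> x" unfolding ratio_pow_def by (intro ge_one_powr_ge_zero) auto
    then show "1 \<le> ennreal (ratio_pow ?h \<alpha> \<beta> (array_coef_sq n p \<omega>))" by (simp add: x_def ennreal_ge_1)
  qed measurable
  also have "\<dots> = ennreal (\<alpha> powr (- (real n + 1 - real p) / 2) * \<beta> powr (- real p / 2))"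
    unfolding nn_integral_array_law[OF m] fst_conv snd_conv by (rule nn_integral_ratio_pow_coef_sq[OF p \<alpha> \<beta>])
  finally show ?thesis by (subst (asm) ennreal_le_iff) auto
qed

text \<open>The values \<open>\<alpha> = 1 + \<tau>\<close>, \<open>\<beta> = 1 - \<tau> / a\<close> (for the lower tail \<open>1 - \<tau>\<close> and \<open>1 + \<tau> / a\<close>) are those of
  the optimal Chernoff bound for a ratio of independent chi-square variables.\<close>

lemma array_coef_sq_upper:
  fixes n p :: nat and t :: real
  defines "N \<equiv> real n + 1" and "q \<equiv> real n + 1 - real p"
  assumes p: "p \<le> n" and t: "t > 0"
  defines "\<tau> \<equiv> t * q / N"
  shows "measure (array_law n p) {\<omega> \<in> space (array_law n p). array_coef_sq n p \<omega> > real p / q + t}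
    \<le> exp (- q * (\<tau> / (1 + \<tau>))\<^sup>2 / 4)"
\<comment> \<open>Without columns the squared norm is an empty sum and the event impossible; in the
  other case \<open>p\<close> serves as a divisor.\<close>
proof (cases "p = 0")
  case True
  then have "\<not> array_coef_sq n p \<omega> > real p / q + t" for \<omega>
    using t by (simp add: coef_sq_def)
  then show ?thesis by simp
next
  case False
  have q: "q > 0" and N: "N > 0" and p0: "real p > 0" and qN: "q \<le> N" "q + real p = N"
    using p False by (auto simp: q_def N_def)
  have \<tau>: "\<tau> > 0" using t q N by (simp add: \<tau>_def)
  define u where "u = \<tau> / (1 + \<tau>)"
  have u: "0 \<le> u" "u < 1" "1 - u = 1 / (1 + \<tau>)" using \<tau> by (auto simp: u_def divide_simps)
  \<comment> \<open>Since \<open>1 + real p / q = N / q\<close>, the threshold satisfies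
    \<open>1 + a = (N / q) * (1 + \<tau>)\<close>, so \<open>\<tau>\<close> is the relative
    deviation of one plus the squared norm.\<close>
  define a where "a = real p / q + t"
  have a: "a > 0" using p0 q t by (simp add: a_def add_pos_pos)
  have pN: "real p = N - q" using qN(2) by simp
  have a\<tau>: "a - \<tau> = real p / q * (1 + \<tau>)"
  proof -
    have "t - \<tau> = t * (real p / N)" unfolding \<tau>_def pN using N by (simp add: field_simps)
    also have "\<dots> = real p / q * \<tau>" using q by (simp add: \<tau>_def)
    finally show ?thesis by (simp add: a_def distrib_left)
  qed
  \<comment> \<open>This makes \<open>1 + \<tau> + \<beta> * a = 1 + a\<close>: the test function
    equals 1 at the threshold.\<close>
  define \<beta> where "\<beta> = 1 - \<tau> / a"
  have \<beta>_eq: "\<beta> = real p * (1 + \<tau>) / (q * a)"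
  proof -
    have "\<beta> = (a - \<tau>) / a" using a by (simp add: \<beta>_def diff_divide_distrib)
    then show ?thesis unfolding a\<tau> by simp
  qed
  have \<beta>: "\<beta> > 0" unfolding \<beta>_eq using p0 q a \<tau> by simp
  have "measure (array_law n p) {\<omega> \<in> space (array_law n p). array_coef_sq n p \<omega> > a}
    \<le> (1 + \<tau>) powr (- (real n + 1 - real p) / 2) * \<beta> powr (- real p / 2)"
  proof (rule measure_array_coef_sq_le[OF p _ \<beta>])
    show "1 + \<tau> > 0" using \<tau> by simp
    show "Measurable.pred borel (\<lambda>x. x > a)" by measurable
    fix x assume "x > a"
    then have "\<tau> / a * (x - a) \<ge> 0" using \<tau> a by simp
    moreover have "\<tau> / a * (x - a) = \<tau> / a * x - \<tau>" using a by (simp add: field_simps)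
    ultimately show "1 + \<tau> + \<beta> * x \<le> 1 + x" unfolding \<beta>_def by (simp add: left_diff_distrib)
  qed
  also have "\<dots> = exp (- q / 2 * ln (1 + \<tau>)) * exp (- real p / 2 * ln \<beta>)"
    unfolding q_def powr_def using \<tau> \<beta> by simp
  also have "\<dots> = exp (- (q / 2 * ln (1 + \<tau>)) + real p / 2 * ln (1 / \<beta>))"
    unfolding exp_add[symmetric] using \<beta> by (simp add: ln_div)
  \<comment> \<open>The inequality \<open>ln b \<le> b - 1\<close> at \<open>b = 1 / \<beta>\<close>
    turns the term in \<open>p\<close> into a multiple of \<open>q\<close>, after which the exponent
    is \<open>q\<close> times a function of \<open>\<tau>\<close>.\<close>
  also have "\<dots> \<le> exp (- (q / 2 * ln (1 + \<tau>)) + q / 2 * u)"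
  proof -
    have "1 / \<beta> - 1 = q * u / real p"
    proof -
      have "q * a = real p + N * \<tau>" using q N by (simp add: a_def \<tau>_def field_simps)
      then have "q * a = real p + (q + real p) * \<tau>" unfolding qN(2) .
      then have "q * a - real p * (1 + \<tau>) = q * \<tau>" by (simp only:) (simp add: algebra_simps)
      moreover have "1 / \<beta> - 1 = (q * a - real p * (1 + \<tau>)) / (real p * (1 + \<tau>))"
        unfolding \<beta>_eq using q a p0 \<tau> by (simp add: diff_divide_distrib)
      ultimately show ?thesis by (simp add: u_def)
    qed
    then have "ln (1 / \<beta>) \<le> q * u / real p"
      using ln_le_minus_one[of "1 / \<beta>"] \<beta> by simp
    then have "real p / 2 * ln (1 / \<beta>) \<le> real p / 2 * (q * u / real p)"
      using p0 by (intro mult_left_mono) auto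
    also have "\<dots> = q / 2 * u" using p0 by simp
    finally show ?thesis by simp
  qed
  \<comment> \<open>In terms of \<open>u\<close> the exponent is
    \<open>- q / 2 * (- ln (1 - u) - u)\<close>.\<close>
  also have "\<dots> \<le> exp (- q * u\<^sup>2 / 4)"
  proof -
    have "ln (1 - u) = - ln (1 + \<tau>)" unfolding u(3) using \<tau> by (simp add: ln_div)
    then have "u\<^sup>2 / 2 \<le> ln (1 + \<tau>) - u" using minus_ln_one_minus_ge[OF u(1,2)] by simp
    then have "q / 2 * (u\<^sup>2 / 2) \<le> q / 2 * (ln (1 + \<tau>) - u)" using q by (intro mult_left_mono) auto
    then show ?thesis by (simp add: algebra_simps)
  qed
  finally show ?thesis unfolding a_def u_def .
qed

lemma array_coef_sq_lower:
  fixes n p :: nat and t :: real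
  defines "N \<equiv> real n + 1" and "q \<equiv> real n + 1 - real p"
  assumes p: "p \<le> n" and t: "t > 0"
  defines "\<tau> \<equiv> t * q / N"
  shows "measure (array_law n p) {\<omega> \<in> space (array_law n p). array_coef_sq n p \<omega> < real p / q - t}
    \<le> exp (- q * (\<tau> / (1 + \<tau>))\<^sup>2 / 4)"
\<comment> \<open>The squared norm is nonnegative, so a threshold at or below zero leaves an empty
  event.\<close>
proof (cases "real p / q - t > 0")
  case False
  have "\<not> array_coef_sq n p \<omega> < real p / q - t" for \<omega>
    using False coef_sq_nonneg[of n "curry (fst \<omega>)" p "snd \<omega>"] by linarith
  then show ?thesis by simp
next
  case True
  define a where "a = real p / q - t"
  have a: "a > 0" using True by (simp add: a_def)
  have q: "q > 0" and N: "N > 0" and qN: "q \<le> N" "q + real p = N"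
    using p by (auto simp: q_def N_def)
  have p0: "real p > 0"
  proof (rule ccontr)
    assume "\<not> real p > 0"
    then show False using True t by simp
  qed
  have \<tau>: "\<tau> > 0" using t q N by (simp add: \<tau>_def)
  have "\<tau> < 1"
  proof -
    have "t * q < real p" using True q by (simp add: field_simps)
    also have "\<dots> \<le> N" using qN q by simp
    finally show ?thesis using N by (simp add: \<tau>_def)
  qed
  have pN: "real p = N - q" using qN(2) by simp
  have a\<tau>: "a + \<tau> = real p / q * (1 - \<tau>)"
  proof -
    have "t - \<tau> = t * (real p / N)" unfolding \<tau>_def pN using N by (simp add: field_simps)
    also have "\<dots> = real p / q * \<tau>" using q by (simp add: \<tau>_def)
    finally show ?thesis by (simp add: a_def right_diff_distrib)
  qed
  \<comment> \<open>The counterpart of \<open>u\<close> in the upper bound: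
    \<open>1 + v = 1 / (1 - \<tau>)\<close>, and the exponent becomes
    \<open>- q / 2 * (v - ln (1 + v))\<close>.\<close>
  define v where "v = \<tau> / (1 - \<tau>)"
  have v: "v \<ge> 0" "1 + v = 1 / (1 - \<tau>)" "v / (1 + v) = \<tau>"
    using \<tau> \<open>\<tau> < 1\<close> by (auto simp: v_def divide_simps)
  define \<beta> where "\<beta> = 1 + \<tau> / a"
  have \<beta>_eq: "\<beta> = real p * (1 - \<tau>) / (q * a)"
  proof -
    have "\<beta> = (a + \<tau>) / a" using a by (simp add: \<beta>_def add_divide_distrib)
    then show ?thesis unfolding a\<tau> by simp
  qed
  have \<beta>: "\<beta> > 0" unfolding \<beta>_eq using p0 q a \<open>\<tau> < 1\<close> by simp
  have "measure (array_law n p) {\<omega> \<in> space (array_law n p). array_coef_sq n p \<omega> < a}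
    \<le> (1 - \<tau>) powr (- (real n + 1 - real p) / 2) * \<beta> powr (- real p / 2)"
  proof (rule measure_array_coef_sq_le[OF p _ \<beta>])
    show "1 - \<tau> > 0" using \<open>\<tau> < 1\<close> by simp
    show "Measurable.pred borel (\<lambda>x. x < a)" by measurable
    fix x assume "x < a"
    then have "\<tau> / a * (a - x) \<ge> 0" using \<tau> a by simp
    moreover have "\<tau> / a * (a - x) = \<tau> - \<tau> / a * x" using a by (simp add: field_simps)
    ultimately show "1 - \<tau> + \<beta> * x \<le> 1 + x" unfolding \<beta>_def by (simp add: distrib_right)
  qed
  also have "\<dots> = exp (- q / 2 * ln (1 - \<tau>)) * exp (- real p / 2 * ln \<beta>)"
    unfolding q_def powr_def using \<open>\<tau> < 1\<close> \<beta> by simp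
  also have "\<dots> = exp (q / 2 * ln (1 + v) + real p / 2 * ln (1 / \<beta>))"
    unfolding exp_add[symmetric] v(2) using \<beta> \<open>\<tau> < 1\<close> by (simp add: ln_div)
  also have "\<dots> \<le> exp (q / 2 * ln (1 + v) - q / 2 * v)"
  proof -
    have "1 / \<beta> - 1 = - (q * v / real p)"
    proof -
      have "q * a = real p - N * \<tau>" using q N by (simp add: a_def \<tau>_def field_simps)
      then have "q * a = real p - (q + real p) * \<tau>" unfolding qN(2) .
      then have "q * a - real p * (1 - \<tau>) = - (q * \<tau>)" by (simp only:) (simp add: algebra_simps)
      moreover have "1 / \<beta> - 1 = (q * a - real p * (1 - \<tau>)) / (real p * (1 - \<tau>))"
        unfolding \<beta>_eq using q a p0 \<open>\<tau> < 1\<close> by (simp add: diff_divide_distrib)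
      ultimately show ?thesis by (simp add: v_def)
    qed
    then have "ln (1 / \<beta>) \<le> - (q * v / real p)"
      using ln_le_minus_one[of "1 / \<beta>"] \<beta> by simp
    then have "real p / 2 * ln (1 / \<beta>) \<le> real p / 2 * - (q * v / real p)"
      using p0 by (intro mult_left_mono) auto
    also have "\<dots> = - (q / 2 * v)" using p0 by simp
    finally show ?thesis by simp
  qed
  also have "\<dots> \<le> exp (- q * (\<tau> / (1 + \<tau>))\<^sup>2 / 4)"
  proof -
    have "(\<tau> / (1 + \<tau>))\<^sup>2 \<le> \<tau>\<^sup>2" using \<tau> by (intro power_mono) (auto simp: divide_simps)
    then have "(\<tau> / (1 + \<tau>))\<^sup>2 / 2 \<le> v - ln (1 + v)" using diff_ln_one_plus_ge[OF v(1)] unfolding v(3) by linarith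
    then have "q / 2 * ((\<tau> / (1 + \<tau>))\<^sup>2 / 2) \<le> q / 2 * (v - ln (1 + v))" using q by (intro mult_left_mono) auto
    then show ?thesis by (simp add: algebra_simps)
  qed
  finally show ?thesis unfolding a_def .
qed

lemma measure_estimation_error:
  fixes n p :: nat and r \<epsilon> c s :: real
  assumes p: "p < n" and pr: "real p / real n \<le> r" and r: "r < 1" and \<epsilon>: "\<epsilon> > 0" and c: "c > 0" and s: "s\<^sup>2 \<le> c"
  shows "measure (array_law n p) {\<omega> \<in> space (array_law n p).
      \<bar>s\<^sup>2 * array_rss n p \<omega> / (real n - real p) * ((real n + 1) / (real n + 1 - real p))
        - s\<^sup>2 * (1 + array_coef_sq n p \<omega>)\<bar> > \<epsilon>}
    \<le> 4 * exp (- real n * (1 - r) * Psi (\<epsilon> / (2 * c) * (1 - r)))"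
proof -
  let ?P = "array_law n p"
  define k where "k = real n - real p"
  define N where "N = real n + 1"
  define q where "q = real n + 1 - real p"
  \<comment> \<open>Half of the allowed error for each of the two deviations, once the factor
    \<open>s\<^sup>2 \<le> c\<close> is taken out.\<close>
  define t where "t = \<epsilon> / (2 * c)"
  \<comment> \<open>The deviation of \<open>R / k\<close> from 1 gets multiplied by
    \<open>N / q \<le> 1 / (1 - r)\<close>; the tolerance \<open>t * (1 - r)\<close> keeps the
    product at most \<open>t\<close>.\<close>
  define tr where "tr = t * (1 - r)"
  have k: "k > 0" and q: "q > 0" and N: "N > 0" and n: "real n > 0" and qk: "k \<le> q" and qN: "q \<le> N" "q + real p = N"
    using p by (auto simp: k_def q_def N_def)
  have t: "t > 0" using \<epsilon> c by (simp add: t_def)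
  have tr: "tr > 0" using t r by (simp add: tr_def)
  have kr: "real n * (1 - r) \<le> k" using pr n by (simp add: k_def field_simps)
  have qr: "1 - r \<le> q / N"
  proof -
    have "real p / N \<le> real p / real n" using n by (intro divide_left_mono) (auto simp: N_def)
    moreover have "q / N = 1 - real p / N" using N qN(2) by (simp add: field_simps)
    ultimately show ?thesis using pr by linarith
  qed
  define \<tau> where "\<tau> = t * q / N"
  have \<tau>: "tr \<le> \<tau>" unfolding \<tau>_def tr_def using qr t by (metis mult_left_mono less_imp_le times_divide_eq_right)
  define B where "B = exp (- real n * (1 - r) * Psi tr)"
  \<comment> \<open>One bound for all four tails: the fraction is increasing in the deviation, and
    each exponent carries at least \<open>k \<ge> real n * (1 - r)\<close> degrees of freedom. The
    tail bounds have 1/4 where \<open>Psi\<close> has 1/8.\<close>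
  have B: "exp (- l * (v / (1 + v))\<^sup>2 / 4) \<le> B" if "k \<le> l" "tr \<le> v" for l v
  proof -
    have "(tr / (1 + tr))\<^sup>2 \<le> (v / (1 + v))\<^sup>2"
      using frac_mono[of tr v] that tr by (intro power_mono) auto
    moreover have "real n * (1 - r) \<le> l" using kr that by simp
    ultimately have "real n * (1 - r) * (tr / (1 + tr))\<^sup>2 \<le> l * (v / (1 + v))\<^sup>2"
      using r n k that by (intro mult_mono) auto
    moreover have "real n * (1 - r) * Psi tr = real n * (1 - r) * (tr / (1 + tr))\<^sup>2 / 8"
      by (simp add: Psi_def add.commute)
    moreover have "real n * (1 - r) * (tr / (1 + tr))\<^sup>2 \<ge> 0" using r n by simp
    ultimately have "real n * (1 - r) * Psi tr \<le> l * (v / (1 + v))\<^sup>2 / 4" by linarith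
    then show ?thesis unfolding B_def by simp
  qed
  define E1 where "E1 = {\<omega> \<in> space ?P. array_rss n p \<omega> > k * (1 + tr)}"
  define E2 where "E2 = {\<omega> \<in> space ?P. array_rss n p \<omega> < k * (1 - tr)}"
  define E3 where "E3 = {\<omega> \<in> space ?P. array_coef_sq n p \<omega> > real p / q + t}"
  define E4 where "E4 = {\<omega> \<in> space ?P. array_coef_sq n p \<omega> < real p / q - t}"
  have sets: "E1 \<in> sets ?P" "E2 \<in> sets ?P" "E3 \<in> sets ?P" "E4 \<in> sets ?P"
    unfolding E1_def E2_def E3_def E4_def by measurable
  have m1: "measure ?P E1 \<le> B" unfolding E1_def k_def
    using array_rss_upper[OF p tr] B[OF order_refl order_refl] unfolding k_def by linarith
  have m2: "measure ?P E2 \<le> B" unfolding E2_def k_def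
    using array_rss_lower[OF p tr] B[OF order_refl order_refl] unfolding k_def by linarith
  have m3: "measure ?P E3 \<le> B" unfolding E3_def q_def
    using array_coef_sq_upper[OF less_imp_le[OF p] t] B[OF qk \<tau>] unfolding q_def \<tau>_def N_def by linarith
  have m4: "measure ?P E4 \<le> B" unfolding E4_def q_def
    using array_coef_sq_lower[OF less_imp_le[OF p] t] B[OF qk \<tau>] unfolding q_def \<tau>_def N_def by linarith
  have sub: "{\<omega> \<in> space ?P. \<bar>s\<^sup>2 * array_rss n p \<omega> / k * (N / q) - s\<^sup>2 * (1 + array_coef_sq n p \<omega>)\<bar> > \<epsilon>}
    \<subseteq> (E1 \<union> E2) \<union> (E3 \<union> E4)"
  proof (rule ccontr)
    assume "\<not> ?thesis"
    then obtain \<omega> where big: "\<bar>s\<^sup>2 * array_rss n p \<omega> / k * (N / q) - s\<^sup>2 * (1 + array_coef_sq n p \<omega>)\<bar> > \<epsilon>"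
      and no: "\<omega> \<notin> E1" "\<omega> \<notin> E2" "\<omega> \<notin> E3" "\<omega> \<notin> E4" and sp: "\<omega> \<in> space ?P" by blast
    define R where "R = array_rss n p \<omega>"
    define x where "x = array_coef_sq n p \<omega>"
    have "k * (1 - tr) \<le> R" "R \<le> k * (1 + tr)" and x: "\<bar>x - real p / q\<bar> \<le> t"
      using no sp by (auto simp: E1_def E2_def E3_def E4_def R_def x_def not_less abs_le_iff)
    then have "1 - tr \<le> R / k" "R / k \<le> 1 + tr"
      using k by (simp_all add: le_divide_eq divide_le_eq mult.commute)
    then have R: "\<bar>R / k - 1\<bar> \<le> tr" by (simp add: abs_le_iff)
    have "s\<^sup>2 * R / k * (N / q) - s\<^sup>2 * (1 + x) = s\<^sup>2 * ((N / q) * (R / k - 1) - (x - real p / q))"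
    proof -
      \<comment> \<open>Both quantities are compared with the common centre \<open>N / q\<close>,
        which is also \<open>1 + real p / q\<close>.\<close>
      have pq: "real p / q = N / q - 1" using q qN(2) by (simp add: field_simps)
      have "s\<^sup>2 * R / k * M - s\<^sup>2 * (1 + x) = s\<^sup>2 * (M * (R / k - 1) - (x - (M - 1)))" for M
        by (simp add: algebra_simps)
      then show ?thesis unfolding pq .
    qed
    also have "\<bar>\<dots>\<bar> = s\<^sup>2 * \<bar>(N / q) * (R / k - 1) - (x - real p / q)\<bar>" by (simp add: abs_mult)
    also have "\<dots> \<le> s\<^sup>2 * ((N / q) * tr + t)"
    proof (intro mult_left_mono)
      have "\<bar>(N / q) * (R / k - 1) - (x - real p / q)\<bar> \<le> \<bar>(N / q) * (R / k - 1)\<bar> + \<bar>x - real p / q\<bar>"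
        by (rule abs_triangle_ineq4)
      moreover have "\<bar>(N / q) * (R / k - 1)\<bar> \<le> (N / q) * tr"
      proof -
        have "\<bar>(N / q) * (R / k - 1)\<bar> = (N / q) * \<bar>R / k - 1\<bar>" using N q unfolding abs_mult by simp
        also have "\<dots> \<le> (N / q) * tr" using R N q by (intro mult_left_mono) auto
        finally show ?thesis .
      qed
      ultimately show "\<bar>(N / q) * (R / k - 1) - (x - real p / q)\<bar> \<le> (N / q) * tr + t" using x by linarith
    qed simp
    also have "\<dots> \<le> s\<^sup>2 * (t + t)"
    proof -
      have "(N / q) * tr \<le> (N / q) * \<tau>" using \<tau> N q by (intro mult_left_mono) auto
      also have "\<dots> = t" using N q by (simp add: \<tau>_def)
      finally show ?thesis by (intro mult_left_mono) auto
    qed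
    also have "\<dots> \<le> c * (t + t)" using s t by (intro mult_right_mono) auto
    also have "\<dots> = \<epsilon>" using c by (simp add: t_def)
    finally show False using big unfolding R_def x_def by simp
  qed
  have "measure ?P {\<omega> \<in> space ?P. \<bar>s\<^sup>2 * array_rss n p \<omega> / k * (N / q) - s\<^sup>2 * (1 + array_coef_sq n p \<omega>)\<bar> > \<epsilon>}
    \<le> measure ?P ((E1 \<union> E2) \<union> (E3 \<union> E4))"
    by (rule array_law.finite_measure_mono[OF sub]) (use sets in auto)
  also have "\<dots> \<le> measure ?P (E1 \<union> E2) + measure ?P (E3 \<union> E4)"
    using sets by (intro measure_Un_le) auto
  also have "measure ?P (E1 \<union> E2) \<le> measure ?P E1 + measure ?P E2"
    using sets by (intro measure_Un_le) auto
  also have "measure ?P (E3 \<union> E4) \<le> measure ?P E3 + measure ?P E4"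
    using sets by (intro measure_Un_le) auto
  finally have "measure ?P {\<omega> \<in> space ?P. \<bar>s\<^sup>2 * array_rss n p \<omega> / k * (N / q) - s\<^sup>2 * (1 + array_coef_sq n p \<omega>)\<bar> > \<epsilon>}
    \<le> 4 * B" using m1 m2 m3 m4 by simp
  then show ?thesis unfolding k_def N_def q_def B_def tr_def t_def .
qed

section \<open>Orthonormal coordinates for a model\<close>

lemma (in prob_space) gaussian_rv_integrable_square:
  assumes "gaussian_rv M X"
  shows "integrable M (\<lambda>\<omega>. (X \<omega>)\<^sup>2)"
proof -
  have X[measurable]: "X \<in> borel_measurable M" using assms by (simp add: gaussian_rv_def)
  obtain \<mu> s where cases: "(s = 0 \<and> distr M borel X = return borel \<mu>) \<or>
      (s > 0 \<and> distr M borel X = density lborel (normal_density \<mu> s))"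
    using assms by (auto simp: gaussian_rv_def)
  have "integrable (distr M borel X) (\<lambda>x. x\<^sup>2)"
  proof (cases "s > 0")
    case False
    then have "distr M borel X = return borel \<mu>" using cases by auto
    then show ?thesis by (auto intro!: integrableI_bounded simp: nn_integral_return)
  next
    case True
    then have d: "distr M borel X = density lborel (normal_density \<mu> s)" using cases by auto
    have "integrable lborel (\<lambda>x. normal_density \<mu> s x * (x - \<mu>)\<^sup>2 + 2 * \<mu> * (normal_density \<mu> s x * x) - \<mu>\<^sup>2 * normal_density \<mu> s x)"
      using True integrable_normal_moment[OF True, of \<mu> 2] integrable_normal_moment_nz_1[OF True, of \<mu>] integrable_normal_density[OF True, of \<mu>]
      by (intro Bochner_Integration.integrable_add Bochner_Integration.integrable_diff integrable_mult_right) auto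
    also have "(\<lambda>x. normal_density \<mu> s x * (x - \<mu>)\<^sup>2 + 2 * \<mu> * (normal_density \<mu> s x * x) - \<mu>\<^sup>2 * normal_density \<mu> s x)
      = (\<lambda>x. normal_density \<mu> s x * x\<^sup>2)"
      by (auto simp: power2_eq_square algebra_simps)
    finally show ?thesis unfolding d by (subst integrable_density) auto
  qed
  then show ?thesis by (subst (asm) integrable_distr_eq) auto
qed

lemma (in prob_space) gaussian_rv_char:
  assumes X: "gaussian_rv M X" and mean: "expectation X = 0"
  shows "(CLINT \<omega>|M. iexp (t * X \<omega>)) = of_real (exp (- (t\<^sup>2 * expectation (\<lambda>\<omega>. (X \<omega>)\<^sup>2)) / 2))"
proof -
  have Xm[measurable]: "X \<in> borel_measurable M" using X by (simp add: gaussian_rv_def)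
  obtain \<mu> s where cases: "(s = 0 \<and> distr M borel X = return borel \<mu>) \<or>
      (s > 0 \<and> distr M borel X = density lborel (normal_density \<mu> s))"
    using X by (auto simp: gaussian_rv_def)
  show ?thesis
  proof (cases "s > 0")
    case False
    then have d: "distr M borel X = return borel \<mu>" using cases by auto
    have I: "(\<integral>\<omega>. f (X \<omega>) \<partial>M) = f \<mu>" if f[measurable]: "f \<in> borel_measurable borel" for f :: "real \<Rightarrow> 'b::{second_countable_topology,banach}"
    proof -
      have "(\<integral>\<omega>. f (X \<omega>) \<partial>M) = (\<integral>x. f x \<partial>distr M borel X)" by (rule integral_distr[symmetric]) auto
      then show ?thesis unfolding d by (simp add: integral_return)
    qed
    have "\<mu> = 0" using I[of "\<lambda>x. x"] mean by simp
    then show ?thesis using I[of "\<lambda>x. x\<^sup>2"] I[of "\<lambda>x. iexp (t * x)"] by simp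
  next
    case True
    then have d: "distr M borel X = density lborel (normal_density \<mu> s)" using cases by auto
    have D: "distributed M lborel X (normal_density \<mu> s)"
      unfolding distributed_def using d by (auto cong: distr_cong)
    have \<mu>: "\<mu> = 0" using normal_distributed_expectation[OF True D] mean by simp
    have var: "expectation (\<lambda>\<omega>. (X \<omega>)\<^sup>2) = s\<^sup>2"
      using normal_distributed_variance[OF True D] mean by simp
    have "distributed M lborel (\<lambda>x. (X x - \<mu>) / s) std_normal_density"
      using D normal_standard_normal_convert[OF True, of X \<mu>] by simp
    then have std: "distr M borel (\<lambda>x. X x / s) = std_normal_distribution"
      unfolding \<mu> distributed_def by (auto cong: distr_cong)
    have "(CLINT \<omega>|M. iexp (t * X \<omega>)) = (CLINT x|distr M borel (\<lambda>x. X x / s). iexp ((t * s) * x))"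
      using True by (subst integral_distr) auto
    also have "\<dots> = of_real (exp (- ((t * s)\<^sup>2) / 2))"
      unfolding std char_def[symmetric] char_std_normal_distribution ..
    finally show ?thesis unfolding var by (simp add: power_mult_distrib)
  qed
qed

text \<open>Gram-Schmidt for the bilinear form with matrix \<open>S\<close>, one index at a time;
  \<open>T\<close> is orthonormal for the form and \<open>U\<close> inverts it. With a covariance
  matrix for \<open>S\<close> the new coordinates are uncorrelated of second moment 1.\<close>

lemma orthonormal_coordinates:
  fixes S :: "nat \<Rightarrow> nat \<Rightarrow> real"
  assumes I: "finite I" and sym: "\<And>i j. S i j = S j i"
    and pd: "\<And>c. \<exists>j\<in>I. c j \<noteq> 0 \<Longrightarrow> 0 < (\<Sum>i\<in>I. \<Sum>j\<in>I. c i * c j * S i j)"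
  obtains T U :: "nat \<Rightarrow> nat \<Rightarrow> real" where
    "\<And>\<xi> j. j \<in> I \<Longrightarrow> \<xi> j = (\<Sum>k<card I. U j k * (\<Sum>l\<in>I. T k l * \<xi> l))"
    "\<And>k k'. k < card I \<Longrightarrow> k' < card I \<Longrightarrow> (\<Sum>i\<in>I. \<Sum>j\<in>I. T k i * T k' j * S i j) = (if k = k' then 1 else 0)"
proof -
  define B where "B f g = (\<Sum>i\<in>I. \<Sum>j\<in>I. f i * g j * S i j)" for f g
  have B_sym: "B f g = B g f" for f g
    unfolding B_def by (subst sum.swap) (simp add: sym mult_ac)
  have B_scale: "B (\<lambda>i. a * f i) g = a * B f g" for a f g
    unfolding B_def sum_distrib_left mult.assoc ..
  have B_diff: "B (\<lambda>i. f i - f' i) g = B f g - B f' g" for f f' g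
    unfolding B_def left_diff_distrib sum_subtractf ..
  have B_sum: "B (\<lambda>i. \<Sum>k\<in>K. c k * f k i) g = (\<Sum>k\<in>K. c k * B (f k) g)" if "finite K" for K c f g
    using that
  proof (induction K rule: finite_induct)
    case empty
    then show ?case by (simp add: B_def)
  next
    case (insert k K)
    have "B (\<lambda>i. c k * f k i + (\<Sum>k\<in>K. c k * f k i)) g = B (\<lambda>i. c k * f k i) g + B (\<lambda>i. \<Sum>k\<in>K. c k * f k i) g"
      unfolding B_def distrib_right sum.distrib ..
    then show ?case using insert.hyps insert.IH by (simp add: B_scale)
  qed
  \<comment> \<open>The first conjunct confines each \<open>T k\<close> to the indices treated so
    far, so that the vector constructed for a new index \<open>a\<close> is nonzero at
    \<open>a\<close>.\<close>
  have "\<exists>T U. (\<forall>k<card J. \<forall>l. l \<notin> J \<longrightarrow> T k l = 0)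
      \<and> (\<forall>\<xi>. \<forall>j\<in>J. \<xi> j = (\<Sum>k<card J. U j k * (\<Sum>l\<in>I. T k l * \<xi> l)))
      \<and> (\<forall>k<card J. \<forall>k'<card J. B (T k) (T k') = (if k = k' then 1 else 0))" if "finite J" "J \<subseteq> I" for J
    using that
  proof (induction J rule: finite_induct)
    case empty
    show ?case by simp
  next
    case (insert a J)
    define p where "p = card J"
    have "J \<subseteq> I" using insert.prems by simp
    from insert.IH[OF this] obtain T U where TU: "(\<forall>k<card J. \<forall>l. l \<notin> J \<longrightarrow> T k l = 0)
      \<and> (\<forall>\<xi>. \<forall>j\<in>J. \<xi> j = (\<Sum>k<card J. U j k * (\<Sum>l\<in>I. T k l * \<xi> l)))
      \<and> (\<forall>k<card J. \<forall>k'<card J. B (T k) (T k') = (if k = k' then 1 else 0))" by (elim exE)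
    note supp = TU[THEN conjunct1, rule_format, folded p_def]
      and rep = TU[THEN conjunct2, THEN conjunct1, rule_format, folded p_def]
      and orth = TU[THEN conjunct2, THEN conjunct2, rule_format, folded p_def]
    have card: "card (insert a J) = Suc p" using insert by (simp add: p_def)
    have aI: "a \<in> I" using insert by simp
    define e where "e l = (if l = a then 1 else 0 :: real)" for l
    define c where "c k = B (T k) e" for k
    \<comment> \<open>The unit vector of \<open>a\<close> minus its projection onto the earlier
      \<open>T k\<close>. Since \<open>w a = 1\<close>, positive definiteness makes its norm
      positive.\<close>
    define w where "w l = e l - (\<Sum>k<p. c k * T k l)" for l
    have Bw: "B (T k) w = 0" if k: "k < p" for k
    proof -
      have "B (T k) w = B e (T k) - (\<Sum>k'<p. c k' * B (T k') (T k))"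
        unfolding B_sym[of "T k" w] w_def B_diff B_sum[OF finite_lessThan] ..
      also have "(\<Sum>k'<p. c k' * B (T k') (T k)) = (\<Sum>k'<p. if k' = k then c k' else 0)"
        using k by (intro sum.cong) (auto simp: orth)
      also have "\<dots> = c k" using k by (simp add: sum.delta)
      finally show ?thesis by (simp add: c_def B_sym)
    qed
    have wa: "w a = 1" using insert supp by (simp add: w_def e_def)
    have "B w w > 0" unfolding B_def by (rule pd) (use aI wa in force)
    define s where "s = sqrt (B w w)"
    have s: "s > 0" "s * s = B w w" using \<open>B w w > 0\<close> by (auto simp: s_def)
    define T' where "T' = T(p := (\<lambda>l. (1 / s) * w l))"
    \<comment> \<open>The definition of \<open>w\<close> read backwards: regressor \<open>a\<close>
      is \<open>s\<close> times the new coordinate plus \<open>c k\<close> times the earlier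
      ones.\<close>
    define U' where "U' j k = (if j = a then (if k = p then s else c k) else (if k = p then 0 else U j k))" for j k
    have T'_lt: "T' k = T k" if "k < p" for k using that by (simp add: T'_def)
    have T'_p: "T' p = (\<lambda>l. (1 / s) * w l)" by (simp add: T'_def)
    have supp': "\<forall>k<Suc p. \<forall>l. l \<notin> insert a J \<longrightarrow> T' k l = 0"
      using supp by (auto simp: less_Suc_eq T'_lt T'_p w_def e_def)
    have rep': "\<xi> j = (\<Sum>k<Suc p. U' j k * (\<Sum>l\<in>I. T' k l * \<xi> l))" if j: "j \<in> insert a J" for \<xi> j
    proof (cases "j = a")
      case False
      then have "j \<in> J" using j by simp
      have "(\<Sum>k<Suc p. U' j k * (\<Sum>l\<in>I. T' k l * \<xi> l)) = (\<Sum>k<p. U j k * (\<Sum>l\<in>I. T k l * \<xi> l))"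
        using False by (simp add: U'_def T'_lt)
      then show ?thesis using rep[OF \<open>j \<in> J\<close>, of \<xi>] by simp
    next
      case True
      have "(\<Sum>l\<in>I. e l * \<xi> l) = \<xi> a"
        using I aI by (simp add: e_def if_distrib[of "\<lambda>x. x * _"] sum.delta cong: if_cong)
      moreover have "(\<Sum>l\<in>I. (\<Sum>k<p. c k * T k l) * \<xi> l) = (\<Sum>k<p. c k * (\<Sum>l\<in>I. T k l * \<xi> l))"
        unfolding sum_distrib_left sum_distrib_right by (subst sum.swap) (simp add: mult_ac)
      ultimately have "(\<Sum>l\<in>I. w l * \<xi> l) = \<xi> a - (\<Sum>k<p. c k * (\<Sum>l\<in>I. T k l * \<xi> l))"
        by (simp add: w_def left_diff_distrib sum_subtractf)
      moreover have "s * (\<Sum>l\<in>I. T' p l * \<xi> l) = (\<Sum>l\<in>I. w l * \<xi> l)"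
        unfolding T'_p sum_distrib_left using s(1) by (intro sum.cong) auto
      moreover have "(\<Sum>k<Suc p. U' a k * (\<Sum>l\<in>I. T' k l * \<xi> l))
        = (\<Sum>k<p. c k * (\<Sum>l\<in>I. T k l * \<xi> l)) + s * (\<Sum>l\<in>I. T' p l * \<xi> l)"
        by (simp add: U'_def T'_lt)
      ultimately show ?thesis using True by simp
    qed
    have orth': "B (T' k) (T' k') = (if k = k' then 1 else 0)" if kk: "k < Suc p" "k' < Suc p" for k k'
    proof -
      have ws: "B w (\<lambda>l. (1 / s) * w l) = (1 / s) * B w w"
        unfolding B_sym[of w "\<lambda>l. (1 / s) * w l"] by (rule B_scale)
      have pp: "B (T' p) (T' p) = 1"
        unfolding T'_p B_scale ws s(2)[symmetric] using s(1) by simp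
      have pk: "B (T' p) (T' k) = 0" if "k < p" for k
        unfolding T'_p T'_lt[OF that] B_scale using Bw[OF that] B_sym[of w "T k"] by simp
      have kp: "B (T' k) (T' p) = 0" if "k < p" for k
        using pk[OF that] B_sym[of "T' k" "T' p"] by simp
      consider "k < p" "k' < p" | "k = p" "k' < p" | "k < p" "k' = p" | "k = p" "k' = p"
        using kk unfolding less_Suc_eq by blast
      then show ?thesis
      proof cases
        case 1
        then show ?thesis using orth[OF 1] by (simp only: T'_lt)
      next
        case 2
        then show ?thesis using pk by simp
      next
        case 3
        then show ?thesis using kp by simp
      next
        case 4
        then show ?thesis using pp by simp
      qed
    qed
    show ?case unfolding card
    proof (intro exI conjI)
      show "\<forall>k<Suc p. \<forall>l. l \<notin> insert a J \<longrightarrow> T' k l = 0" by (rule supp')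
      show "\<forall>\<xi>. \<forall>j\<in>insert a J. \<xi> j = (\<Sum>k<Suc p. U' j k * (\<Sum>l\<in>I. T' k l * \<xi> l))"
        by (intro allI ballI rep')
      show "\<forall>k<Suc p. \<forall>k'<Suc p. B (T' k) (T' k') = (if k = k' then 1 else 0)"
        by (intro allI impI orth')
    qed
  qed
  from this[OF I subset_refl] obtain T U where TU: "(\<forall>k<card I. \<forall>l. l \<notin> I \<longrightarrow> T k l = 0)
      \<and> (\<forall>\<xi>. \<forall>j\<in>I. \<xi> j = (\<Sum>k<card I. U j k * (\<Sum>l\<in>I. T k l * \<xi> l)))
      \<and> (\<forall>k<card I. \<forall>k'<card I. B (T k) (T k') = (if k = k' then 1 else 0))" by (elim exE)
  show thesis
    by (rule that[OF TU[THEN conjunct2, THEN conjunct1, rule_format]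
          TU[THEN conjunct2, THEN conjunct2, rule_format, unfolded B_def]])
qed

text \<open>\<open>T\<close> maps the regressors of the model \<open>m\<close> to new coordinates \<open>z\<^sub>0, \<dots>, z\<^sub>p\<^sub>-\<^sub>1\<close>, with inverse \<open>U\<close>;
  \<open>\<eta>\<close> is an arbitrary shift of the coefficients in these coordinates.\<close>

locale model_coordinates =
  fixes m :: model and T U :: "nat \<Rightarrow> nat \<Rightarrow> real" and p :: nat and \<eta> :: "nat \<Rightarrow> real"
  assumes fin: "finite {j. m j}"
    and rep: "\<And>\<xi> j. m j \<Longrightarrow> \<xi> j = (\<Sum>k<p. U j k * (\<Sum>l | m l. T k l * \<xi> l))"
    and inj: "\<And>c k. (\<And>l. m l \<Longrightarrow> (\<Sum>k<p. c k * T k l) = 0) \<Longrightarrow> k < p \<Longrightarrow> c k = 0"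
begin

definition zf :: "nat \<Rightarrow> real \<times> (nat \<Rightarrow> real) \<Rightarrow> real" where
  "zf k f = (\<Sum>l | m l. T k l * snd f l)"

definition wf :: "real \<times> (nat \<Rightarrow> real) \<Rightarrow> real" where
  "wf f = fst f - (\<Sum>k<p. \<eta> k * zf k f)"

definition Zm :: "data \<Rightarrow> nat \<Rightarrow> nat \<Rightarrow> real" where
  "Zm d k i = zf k (d i)"

definition Wm :: "data \<Rightarrow> nat \<Rightarrow> real" where
  "Wm d i = wf (d i)"

definition new_coef :: "(nat \<Rightarrow> real) \<Rightarrow> nat \<Rightarrow> real" where
  "new_coef b k = (\<Sum>j | m j. b j * U j k)"

definition old_coef :: "(nat \<Rightarrow> real) \<Rightarrow> nat \<Rightarrow> real" where
  "old_coef g l = (if m l then \<Sum>k<p. g k * T k l else 0)"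

lemma predictor_new: "(\<Sum>j | m j. x j * b j) = (\<Sum>k<p. new_coef b k * (\<Sum>l | m l. T k l * x l))"
proof -
  have "(\<Sum>j | m j. x j * b j) = (\<Sum>j | m j. (\<Sum>k<p. U j k * (\<Sum>l | m l. T k l * x l)) * b j)"
  proof (rule sum.cong[OF refl])
    fix j assume "j \<in> {j. m j}"
    then have "x j = (\<Sum>k<p. U j k * (\<Sum>l | m l. T k l * x l))" using rep by blast
    then show "x j * b j = (\<Sum>k<p. U j k * (\<Sum>l | m l. T k l * x l)) * b j" by (rule arg_cong)
  qed
  also have "\<dots> = (\<Sum>j | m j. \<Sum>k<p. b j * U j k * (\<Sum>l | m l. T k l * x l))"
    unfolding sum_distrib_right by (intro sum.cong refl) (simp only: mult_ac)
  also have "\<dots> = (\<Sum>k<p. \<Sum>j | m j. b j * U j k * (\<Sum>l | m l. T k l * x l))"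
    by (rule sum.swap)
  finally show ?thesis unfolding new_coef_def sum_distrib_right .
qed

lemma predictor_old: "(\<Sum>j | m j. x j * old_coef g j) = (\<Sum>k<p. g k * (\<Sum>l | m l. T k l * x l))"
proof -
  have "(\<Sum>j | m j. x j * old_coef g j) = (\<Sum>j | m j. \<Sum>k<p. g k * (T k j * x j))"
    unfolding old_coef_def by (intro sum.cong) (auto simp: sum_distrib_left mult_ac)
  also have "\<dots> = (\<Sum>k<p. \<Sum>j | m j. g k * (T k j * x j))" by (rule sum.swap)
  finally show ?thesis unfolding sum_distrib_left .
qed

lemma residual_new: "residual m b f = wf f - (\<Sum>k<p. (new_coef b k - \<eta> k) * zf k f)"
  unfolding residual_def case_prod_beta predictor_new[of "snd f" b] wf_def zf_def[symmetric]
  by (simp add: left_diff_distrib sum_subtractf)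

lemma residual_old: "residual m (old_coef (\<lambda>k. g k + \<eta> k)) f = wf f - (\<Sum>k<p. g k * zf k f)"
  unfolding residual_def case_prod_beta predictor_old[of "snd f"] wf_def zf_def[symmetric]
  by (simp add: distrib_right sum.distrib)

text \<open>Evaluating the predictor at the unit vector of \<open>j\<close> recovers
  \<open>b j\<close> from the new coefficients, so these determine \<open>b\<close>.\<close>

lemma old_new_coef:
  assumes "\<And>j. \<not> m j \<Longrightarrow> b j = 0" "\<And>k. k < p \<Longrightarrow> new_coef b k = g k"
  shows "b = old_coef g"
proof
  fix j
  show "b j = old_coef g j"
  proof (cases "m j")
    case True
    define e where "e l = (if l = j then 1 else 0 :: real)" for l
    have *: "(\<Sum>l | m l. f l * e l) = f j" for f
      using fin True by (simp add: e_def if_distrib sum.delta cong: if_cong)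
    have "b j = (\<Sum>l | m l. e l * b l)" using *[of b] by (simp only: mult.commute)
    also have "\<dots> = (\<Sum>k<p. new_coef b k * (\<Sum>l | m l. T k l * e l))" by (rule predictor_new)
    also have "\<dots> = (\<Sum>k<p. new_coef b k * T k j)" by (intro sum.cong refl arg_cong2[where f=times] *)
    also have "\<dots> = (\<Sum>k<p. g k * T k j)" using assms(2) by (intro sum.cong) auto
    finally show ?thesis using True by (simp add: old_coef_def)
  qed (use assms(1) in \<open>simp add: old_coef_def\<close>)
qed

section \<open>Least squares in the new coordinates\<close>

abbreviation "ls_coef n d \<equiv> coef n (Zm d) p (Wm d)"

lemma sum_residual_new:
  "(\<Sum>i<n. (residual m b (d i))\<^sup>2) = rss n (Zm d) p (Wm d)
    + (\<Sum>i<n. (\<Sum>k<p. (ls_coef n d k - (new_coef b k - \<eta> k)) * Zm d k i)\<^sup>2)"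
  using least_squares_decomp[where n=n and v="Wm d" and k=p and b="\<lambda>k. new_coef b k - \<eta> k" and Z="Zm d"]
  unfolding residual_new Wm_def Zm_def rss_def .

lemma sum_residual_old:
  "(\<Sum>i<n. (residual m (old_coef (\<lambda>k. ls_coef n d k + \<eta> k)) (d i))\<^sup>2) = rss n (Zm d) p (Wm d)"
  using least_squares_decomp[where n=n and v="Wm d" and k=p and b="ls_coef n d" and Z="Zm d"]
  unfolding residual_old Wm_def[symmetric] Zm_def[symmetric] rss_def by simp

lemma is_least_squares_old: "is_least_squares n d m (old_coef (\<lambda>k. ls_coef n d k + \<eta> k))"
  unfolding is_least_squares_def sum_residual_old
  by (auto simp: old_coef_def sum_residual_new intro!: sum_nonneg)

text \<open>In \<open>sum_residual_new\<close> only the second sum depends on \<open>b\<close>. At a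
  minimum it vanishes, and independence of the columns then makes every coefficient difference
  zero.\<close>

lemma least_squares_unique:
  assumes nd: "nondeg n (Zm d) p" and b: "is_least_squares n d m b"
  shows "b = old_coef (\<lambda>k. ls_coef n d k + \<eta> k)"
proof (rule old_new_coef)
  show "b j = 0" if "\<not> m j" for j using b that by (auto simp: is_least_squares_def)
  fix k assume k: "k < p"
  have "(\<Sum>i<n. (residual m b (d i))\<^sup>2) \<le> rss n (Zm d) p (Wm d)"
    using b unfolding is_least_squares_def sum_residual_old[symmetric] by blast
  then have "(\<Sum>i<n. (\<Sum>k<p. (ls_coef n d k - (new_coef b k - \<eta> k)) * Zm d k i)\<^sup>2) \<le> 0"
    unfolding sum_residual_new by simp
  then have "(\<Sum>i<n. (\<Sum>k<p. (ls_coef n d k - (new_coef b k - \<eta> k)) * Zm d k i)\<^sup>2) = 0"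
    by (intro antisym sum_nonneg) auto
  then have "\<forall>i<n. (\<Sum>k<p. (ls_coef n d k - (new_coef b k - \<eta> k)) * Zm d k i) = 0"
    by (subst (asm) sum_nonneg_eq_0_iff) auto
  then have "ls_coef n d k - (new_coef b k - \<eta> k) = 0"
    by (intro nondeg_independent[OF nd, where c="\<lambda>k. ls_coef n d k - (new_coef b k - \<eta> k)"]) (use k in auto)
  then show "new_coef b k = ls_coef n d k + \<eta> k" by simp
qed

lemma beta_tilde_nondeg:
  assumes "nondeg n (Zm d) p"
  shows "beta_tilde n d m = old_coef (\<lambda>k. ls_coef n d k + \<eta> k)"
proof -
  have "\<exists>!b. is_least_squares n d m b"
    using is_least_squares_old least_squares_unique[OF assms] by (intro ex1I)
  moreover have "(THE b. is_least_squares n d m b) = old_coef (\<lambda>k. ls_coef n d k + \<eta> k)"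
    using is_least_squares_old least_squares_unique[OF assms] by (intro the_equality)
  ultimately show ?thesis by (simp add: beta_tilde_def)
qed

text \<open>A linear relation among the columns can be added to a solution without changing any
  residual, and by \<open>inj\<close> the result is a different coefficient vector. So uniqueness
  fails and the default value applies; this makes \<open>residual_beta_tilde\<close> explicit, hence
  measurable, on all samples.\<close>

lemma beta_tilde_degenerate:
  assumes "\<not> nondeg n (Zm d) p"
  shows "beta_tilde n d m = (\<lambda>_. 0)"
proof -
  obtain c k where c: "\<And>i. i < n \<Longrightarrow> (\<Sum>k<p. c k * Zm d k i) = 0" and k: "k < p" "c k \<noteq> 0"
    using not_nondeg_dependent[OF assms] by metis
  have "\<not> (\<exists>!b. is_least_squares n d m b)"
  proof
    assume ex1: "\<exists>!b. is_least_squares n d m b"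
    let ?g = "\<lambda>k. ls_coef n d k + \<eta> k" and ?g' = "\<lambda>k. (ls_coef n d k + c k) + \<eta> k"
    have "residual m (old_coef ?g') (d i) = residual m (old_coef ?g) (d i)" if "i < n" for i
      unfolding residual_old Zm_def[symmetric] distrib_right sum.distrib c[OF that] by simp
    then have "is_least_squares n d m (old_coef ?g')"
      using is_least_squares_old[of n d] unfolding is_least_squares_def by (auto simp: old_coef_def)
    then have eq: "old_coef ?g' = old_coef ?g" using ex1 is_least_squares_old[of n d] by blast
    have "(\<Sum>k<p. c k * T k l) = 0" if "m l" for l
      using fun_cong[OF eq, of l] that by (simp add: old_coef_def distrib_right sum.distrib)
    then have "c k = 0" using k(1) by (rule inj)
    with k show False by simp
  qed
  then show ?thesis by (simp add: beta_tilde_def)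
qed

lemma RSS_nondeg: "nondeg n (Zm d) p \<Longrightarrow> RSS n d m = rss n (Zm d) p (Wm d)"
  unfolding RSS_def beta_tilde_nondeg by (rule sum_residual_old)

lemma residual_beta_tilde:
  "residual m (beta_tilde n d m) f
    = (if nondeg n (Zm d) p then wf f - (\<Sum>k<p. ls_coef n d k * zf k f) else fst f)"
proof (cases "nondeg n (Zm d) p")
  case True
  then show ?thesis by (simp add: beta_tilde_nondeg residual_old)
next
  case False
  then show ?thesis by (simp add: beta_tilde_degenerate residual_def case_prod_beta)
qed

end

section \<open>The error of the estimator\<close>

text \<open>\<open>row_char\<close> expresses that the \<open>zf k\<close> are standard normal,
  \<open>wf\<close> is normal with variance \<open>s\<^sup>2\<close>, and all are independent.
  \<open>row_square\<close> is the prediction error of the coefficients \<open>\<eta> + g\<close> in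
  the new coordinates.\<close>

locale observed_coordinates = model_coordinates +
  fixes \<theta> :: parameters and s :: real
  assumes prob_obs: "prob_space (obs_law \<theta>)"
    and row_char: "\<And>t b. (CLINT f|obs_law \<theta>. iexp ((\<Sum>k<p. t k * zf k f) + b * wf f))
      = of_real (exp (- ((\<Sum>k<p. (t k)\<^sup>2) + s\<^sup>2 * b\<^sup>2) / 2))"
    and row_square: "\<And>g. (\<integral>\<^sup>+f. ennreal ((wf f - (\<Sum>k<p. g k * zf k f))\<^sup>2) \<partial>obs_law \<theta>)
      = ennreal (s\<^sup>2 + (\<Sum>k<p. (g k)\<^sup>2))"
begin

sublocale obs: prob_space "obs_law \<theta>" by (rule prob_obs)

lemma sets_obs_law: "sets (obs_law \<theta>) = sets (borel \<Otimes>\<^sub>M (\<Pi>\<^sub>M j\<in>UNIV. borel))"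
  by (simp add: obs_law_def)

lemma fst_obs [measurable]: "fst \<in> borel_measurable (obs_law \<theta>)"
  unfolding measurable_cong_sets[OF sets_obs_law refl] by (rule measurable_fst)

lemma snd_obs: "(\<lambda>f. snd f l) \<in> borel_measurable (obs_law \<theta>)"
  unfolding measurable_cong_sets[OF sets_obs_law refl]
  using measurable_compose[OF measurable_snd measurable_component_singleton[of l UNIV "\<lambda>_. borel"]] by simp

lemma zf_obs [measurable]: "zf k \<in> borel_measurable (obs_law \<theta>)"
  unfolding zf_def by (intro borel_measurable_sum borel_measurable_times borel_measurable_const snd_obs)

lemma wf_obs [measurable]: "wf \<in> borel_measurable (obs_law \<theta>)"
  unfolding wf_def by measurable

lemma prob_space_sample: "prob_space (sample_law n \<theta>)"
  unfolding sample_law_def by (intro prob_space_PiM prob_obs)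

lemma sample_component: "i < n \<Longrightarrow> (\<lambda>d. d i) \<in> sample_law n \<theta> \<rightarrow>\<^sub>M obs_law \<theta>"
  unfolding sample_law_def by (rule measurable_component_singleton) simp

lemma Zm_sample: "i < n \<Longrightarrow> (\<lambda>d. Zm d k i) \<in> borel_measurable (sample_law n \<theta>)"
  unfolding Zm_def using sample_component zf_obs by (rule measurable_compose)

lemma Wm_sample: "i < n \<Longrightarrow> (\<lambda>d. Wm d i) \<in> borel_measurable (sample_law n \<theta>)"
  unfolding Wm_def using sample_component wf_obs by (rule measurable_compose)

section \<open>Standardising the sample\<close>

definition sd :: "nat \<Rightarrow> real" where "sd k = (if k < p then 1 else s)"

text \<open>Given as an image measure, so that \<open>s = 0\<close> is covered. The first index
  \<open>p\<close> stands for the error \<open>Wm\<close>, smaller ones for the columns of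
  \<open>Zm\<close>.\<close>

definition noise :: "nat \<times> nat \<Rightarrow> real measure" where
  "noise q = distr std_normal_distribution borel (\<lambda>x. sd (fst q) * x)"

lemma real_distribution_noise: "real_distribution (noise q)"
  unfolding noise_def by (intro prob_space.real_distribution_distr prob_std_normal) simp

lemma char_noise: "char (noise q) t = of_real (exp (- ((sd (fst q))\<^sup>2 * t\<^sup>2) / 2))"
proof -
  have "char (noise q) t = (CLINT x|std_normal_distribution. iexp ((t * sd (fst q)) * x))"
    unfolding noise_def char_def by (subst integral_distr) (auto simp: mult.assoc)
  also have "\<dots> = of_real (exp (- ((t * sd (fst q))\<^sup>2) / 2))"
    unfolding char_def[symmetric] char_std_normal_distribution ..
  finally show ?thesis by (simp add: power_mult_distrib mult.commute)
qed

lemma prod_char_noise: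
  "(\<Prod>q\<in>{..p} \<times> {..<n}. char (noise q) (t q))
    = of_real (exp (- (\<Sum>i<n. (\<Sum>k<p. (t (k, i))\<^sup>2) + s\<^sup>2 * (t (p, i))\<^sup>2) / 2))"
proof -
  have "(\<Sum>q\<in>{..p} \<times> {..<n}. (sd (fst q))\<^sup>2 * (t q)\<^sup>2) = (\<Sum>k\<le>p. \<Sum>i<n. (sd k)\<^sup>2 * (t (k, i))\<^sup>2)"
    by (simp add: sum.cartesian_product case_prod_beta)
  also have "\<dots> = (\<Sum>i<n. \<Sum>k\<le>p. (sd k)\<^sup>2 * (t (k, i))\<^sup>2)" by (rule sum.swap)
  also have "\<dots> = (\<Sum>i<n. (\<Sum>k<p. (t (k, i))\<^sup>2) + s\<^sup>2 * (t (p, i))\<^sup>2)"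
    by (simp add: lessThan_Suc_atMost[symmetric] sd_def)
  finally have e: "(\<Sum>q\<in>{..p} \<times> {..<n}. (sd (fst q))\<^sup>2 * (t q)\<^sup>2) = (\<Sum>i<n. (\<Sum>k<p. (t (k, i))\<^sup>2) + s\<^sup>2 * (t (p, i))\<^sup>2)" .
  have "(\<Prod>q\<in>{..p} \<times> {..<n}. char (noise q) (t q)) = of_real (exp (\<Sum>q\<in>{..p} \<times> {..<n}. - ((sd (fst q))\<^sup>2 * (t q)\<^sup>2) / 2))"
    unfolding char_noise by (subst exp_sum) auto
  also have "(\<Sum>q\<in>{..p} \<times> {..<n}. - ((sd (fst q))\<^sup>2 * (t q)\<^sup>2) / 2) = - (\<Sum>i<n. (\<Sum>k<p. (t (k, i))\<^sup>2) + s\<^sup>2 * (t (p, i))\<^sup>2) / 2"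
    unfolding sum_divide_distrib[symmetric] sum_negf e ..
  finally show ?thesis .
qed

lemma measurable_sample_entry:
  "q \<in> {..p} \<times> {..<n} \<Longrightarrow>
    (\<lambda>d. if fst q < p then Zm d (fst q) (snd q) else Wm d (snd q)) \<in> borel_measurable (sample_law n \<theta>)"
  using Zm_sample Wm_sample by (cases "fst q < p") auto

lemma measurable_array_entry:
  assumes q: "q \<in> {..p} \<times> {..<n}"
  shows "(\<lambda>\<omega>. if fst q < p then curry (fst \<omega>) (fst q) (snd q) else s * snd \<omega> (snd q)) \<in> borel_measurable (array_law n p)"
proof (cases "fst q < p")
  case True
  then show ?thesis using array_law_entries(2)[OF True, of "snd q" n] q by (simp only: if_True) auto
next
  case False
  moreover have "(\<lambda>\<omega>. s * snd \<omega> (snd q)) \<in> borel_measurable (array_law n p)"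
    using q by (intro borel_measurable_times borel_measurable_const array_law_entries(1)) auto
  ultimately show ?thesis by (simp only: if_False)
qed

text \<open>Observations are independent, and \<open>row_char\<close> factors within each
  observation, so the joint characteristic function factors over all entries.\<close>

lemma sample_array_law:
  "distr (sample_law n \<theta>) (\<Pi>\<^sub>M q\<in>{..p} \<times> {..<n}. borel)
     (\<lambda>d. \<lambda>q\<in>{..p} \<times> {..<n}. if fst q < p then Zm d (fst q) (snd q) else Wm d (snd q))
   = PiM ({..p} \<times> {..<n}) noise"
proof (rule prob_space.distr_eq_PiM_char_prod[OF prob_space_sample])
  let ?X = "\<lambda>q d. if fst q < p then Zm d (fst q) (snd q) else Wm d (snd q)"
  show "?X q \<in> borel_measurable (sample_law n \<theta>)" if "q \<in> {..p} \<times> {..<n}" for q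
    using that by (rule measurable_sample_entry)
  fix t :: "nat \<times> nat \<Rightarrow> real"
  let ?R = "\<lambda>i f. (\<Sum>k<p. t (k, i) * zf k f) + t (p, i) * wf f"
  interpret PS: product_prob_space "\<lambda>_::nat. obs_law \<theta>" "{..<n}" by (intro product_prob_spaceI prob_obs)
  have X_eq: "(\<Sum>q\<in>{..p} \<times> {..<n}. t q * ?X q d) = (\<Sum>i<n. ?R i (d i))" for d
  proof -
    have "(\<Sum>q\<in>{..p} \<times> {..<n}. t q * ?X q d) = (\<Sum>k\<le>p. \<Sum>i<n. t (k, i) * (if k < p then Zm d k i else Wm d i))"
      by (simp add: sum.cartesian_product case_prod_beta)
    also have "\<dots> = (\<Sum>i<n. \<Sum>k\<le>p. t (k, i) * (if k < p then Zm d k i else Wm d i))" by (rule sum.swap)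
    finally show ?thesis by (simp add: lessThan_Suc_atMost[symmetric] Zm_def Wm_def)
  qed
  have "(CLINT d|sample_law n \<theta>. iexp (\<Sum>q\<in>{..p} \<times> {..<n}. t q * ?X q d))
    = (CLINT d|sample_law n \<theta>. (\<Prod>i<n. iexp (?R i (d i))))"
    unfolding X_eq by (intro Bochner_Integration.integral_cong refl) (simp only: of_real_sum sum_distrib_left exp_sum[OF finite_lessThan])
  also have "\<dots> = (\<Prod>i<n. CLINT f|obs_law \<theta>. iexp (?R i f))"
    unfolding sample_law_def by (intro PS.product_integral_prod obs.integrable_iexp) auto
  also have "\<dots> = (\<Prod>i<n. of_real (exp (- ((\<Sum>k<p. (t (k, i))\<^sup>2) + s\<^sup>2 * (t (p, i))\<^sup>2) / 2)))"
    by (intro prod.cong refl row_char)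
  also have "\<dots> = of_real (exp (\<Sum>i<n. - ((\<Sum>k<p. (t (k, i))\<^sup>2) + s\<^sup>2 * (t (p, i))\<^sup>2) / 2))"
    by (subst exp_sum) auto
  also have "(\<Sum>i<n. - ((\<Sum>k<p. (t (k, i))\<^sup>2) + s\<^sup>2 * (t (p, i))\<^sup>2) / 2)
    = - (\<Sum>i<n. (\<Sum>k<p. (t (k, i))\<^sup>2) + s\<^sup>2 * (t (p, i))\<^sup>2) / 2"
    unfolding sum_divide_distrib[symmetric] sum_negf ..
  finally show "(CLINT d|sample_law n \<theta>. iexp (\<Sum>q\<in>{..p} \<times> {..<n}. t q * ?X q d)) = (\<Prod>q\<in>{..p} \<times> {..<n}. char (noise q) (t q))"
    unfolding prod_char_noise .
qed (auto simp: real_distribution_noise)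

lemma standard_array_law:
  "distr (array_law n p) (\<Pi>\<^sub>M q\<in>{..p} \<times> {..<n}. borel)
     (\<lambda>\<omega>. \<lambda>q\<in>{..p} \<times> {..<n}. if fst q < p then curry (fst \<omega>) (fst q) (snd q) else s * snd \<omega> (snd q))
   = PiM ({..p} \<times> {..<n}) noise"
proof (rule array_law.distr_eq_PiM_char_prod)
  let ?X = "\<lambda>q \<omega>. if fst q < p then curry (fst \<omega>) (fst q) (snd q) else s * snd \<omega> (snd q)"
  show "?X q \<in> borel_measurable (array_law n p)" if "q \<in> {..p} \<times> {..<n}" for q
    using that by (rule measurable_array_entry)
  fix t :: "nat \<times> nat \<Rightarrow> real"
  have X_eq: "(\<Sum>q\<in>{..p} \<times> {..<n}. t q * ?X q \<omega>) = (\<Sum>q\<in>{..<p} \<times> {..<n}. t q * fst \<omega> q) + (\<Sum>i<n. (t (p, i) * s) * snd \<omega> i)" for \<omega>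
  proof -
    have "(\<Sum>q\<in>{..p} \<times> {..<n}. t q * ?X q \<omega>) = (\<Sum>k\<le>p. \<Sum>i<n. t (k, i) * (if k < p then fst \<omega> (k, i) else s * snd \<omega> i))"
      by (auto simp: sum.cartesian_product intro!: sum.cong)
    also have "\<dots> = (\<Sum>k<p. \<Sum>i<n. t (k, i) * fst \<omega> (k, i)) + (\<Sum>i<n. (t (p, i) * s) * snd \<omega> i)"
      by (simp add: lessThan_Suc_atMost[symmetric] mult.assoc)
    also have "(\<Sum>k<p. \<Sum>i<n. t (k, i) * fst \<omega> (k, i)) = (\<Sum>q\<in>{..<p} \<times> {..<n}. t q * fst \<omega> q)"
      by (simp add: sum.cartesian_product case_prod_beta)
    finally show ?thesis .
  qed
  have "(\<Sum>q\<in>{..<p} \<times> {..<n}. (t q)\<^sup>2) + (\<Sum>i<n. (t (p, i) * s)\<^sup>2) = (\<Sum>i<n. (\<Sum>k<p. (t (k, i))\<^sup>2) + s\<^sup>2 * (t (p, i))\<^sup>2)"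
  proof -
    have "(\<Sum>q\<in>{..<p} \<times> {..<n}. (t q)\<^sup>2) = (\<Sum>k<p. \<Sum>i<n. (t (k, i))\<^sup>2)"
      by (simp add: sum.cartesian_product case_prod_beta)
    also have "\<dots> = (\<Sum>i<n. \<Sum>k<p. (t (k, i))\<^sup>2)" by (rule sum.swap)
    finally show ?thesis by (simp add: sum.distrib power_mult_distrib mult.commute)
  qed
  then show "(CLINT \<omega>|array_law n p. iexp (\<Sum>q\<in>{..p} \<times> {..<n}. t q * ?X q \<omega>)) = (\<Prod>q\<in>{..p} \<times> {..<n}. char (noise q) (t q))"
    unfolding X_eq prod_char_noise array_law_def columns_def
    by (simp only: normal_vec_pair_iexp_sum[OF finite_cartesian_product[OF finite_lessThan finite_lessThan] finite_lessThan])
qed (auto simp: real_distribution_noise)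

text \<open>The sample and the standardised array with error scaled by \<open>s\<close> have the
  same image, a product of the \<open>noise\<close> laws, so events about them are equally probable.
  \<open>P_cong\<close> restricts \<open>P\<close> to the entries recorded in that image.\<close>

lemma measure_sample_eq_array:
  fixes P :: "(nat \<Rightarrow> nat \<Rightarrow> real) \<Rightarrow> (nat \<Rightarrow> real) \<Rightarrow> bool"
  assumes P: "Measurable.pred (\<Pi>\<^sub>M q\<in>{..p} \<times> {..<n}. borel) (\<lambda>a. P (curry a) (curry a p))"
    and P_cong: "\<And>Z Z' w w'. (\<And>k i. k < p \<Longrightarrow> i < n \<Longrightarrow> Z k i = Z' k i) \<Longrightarrow> (\<And>i. i < n \<Longrightarrow> w i = w' i) \<Longrightarrow> P Z w = P Z' w'"
  shows "measure (sample_law n \<theta>) {d \<in> space (sample_law n \<theta>). P (Zm d) (Wm d)}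
    = measure (array_law n p) {\<omega> \<in> space (array_law n p). P (curry (fst \<omega>)) (\<lambda>i. s * snd \<omega> i)}"
    and "{d \<in> space (sample_law n \<theta>). P (Zm d) (Wm d)} \<in> sets (sample_law n \<theta>)"
proof -
  let ?J = "{..p} \<times> {..<n}"
  let ?E = "{a \<in> space (\<Pi>\<^sub>M q\<in>?J. borel). P (curry a) (curry a p)}"
  let ?f = "\<lambda>d. \<lambda>q\<in>?J. if fst q < p then Zm d (fst q) (snd q) else Wm d (snd q)"
  let ?g = "\<lambda>\<omega>. \<lambda>q\<in>?J. if fst q < p then curry (fst \<omega>) (fst q) (snd q) else s * snd \<omega> (snd q)"
  have E: "?E \<in> sets (\<Pi>\<^sub>M q\<in>?J. borel)" using P by (simp add: pred_def)
  have f: "?f \<in> sample_law n \<theta> \<rightarrow>\<^sub>M (\<Pi>\<^sub>M q\<in>?J. borel)"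
    by (intro measurable_restrict measurable_sample_entry)
  have g: "?g \<in> array_law n p \<rightarrow>\<^sub>M (\<Pi>\<^sub>M q\<in>?J. borel)"
    by (intro measurable_restrict measurable_array_entry)
  have Pf: "P (curry (?f d)) (curry (?f d) p) = P (Zm d) (Wm d)" for d
    by (rule P_cong) auto
  have Pg: "P (curry (?g \<omega>)) (curry (?g \<omega>) p) = P (curry (fst \<omega>)) (\<lambda>i. s * snd \<omega> i)" for \<omega>
    by (rule P_cong) auto
  have pf: "?f -` ?E \<inter> space (sample_law n \<theta>) = {d \<in> space (sample_law n \<theta>). P (Zm d) (Wm d)}"
    using measurable_space[OF f] Pf by blast
  have pg: "?g -` ?E \<inter> space (array_law n p) = {\<omega> \<in> space (array_law n p). P (curry (fst \<omega>)) (\<lambda>i. s * snd \<omega> i)}"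
    using measurable_space[OF g] Pg by blast
  show "{d \<in> space (sample_law n \<theta>). P (Zm d) (Wm d)} \<in> sets (sample_law n \<theta>)"
    unfolding pf[symmetric] using f E by (rule measurable_sets)
  show "measure (sample_law n \<theta>) {d \<in> space (sample_law n \<theta>). P (Zm d) (Wm d)}
    = measure (array_law n p) {\<omega> \<in> space (array_law n p). P (curry (fst \<omega>)) (\<lambda>i. s * snd \<omega> i)}"
    unfolding pf[symmetric] pg[symmetric] measure_distr[OF f E, symmetric] measure_distr[OF g E, symmetric]
      sample_array_law standard_array_law ..
qed

end

section \<open>The conditional prediction error\<close>

lemma AE_pair_fst:
  assumes "prob_space N" "AE x in M. P x"
  shows "AE \<omega> in M \<Otimes>\<^sub>M N. P (fst \<omega>)"
proof -
  have d: "distr (M \<Otimes>\<^sub>M N) M fst = M" using assms(1) by (rule prob_space.distr_pair_fst)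
  have "AE x in distr (M \<Otimes>\<^sub>M N) M fst. P x" unfolding d by (rule assms(2))
  then show ?thesis by (rule AE_distrD[OF measurable_fst])
qed

lemma rss_scale: "rss n Z k (\<lambda>i. c * v i) = c\<^sup>2 * rss n Z k v"
proof -
  have "res n Z k (\<lambda>i. c * v i) = (\<lambda>i. c * res n Z k v i)"
    using res_linear[of n Z k c v 0 v] by simp
  then show ?thesis unfolding rss_def by (simp only: ip_scale_left ip_scale_right power2_eq_square mult.assoc)
qed

lemma coef_sq_scale: "coef_sq n Z k (\<lambda>i. c * v i) = c\<^sup>2 * coef_sq n Z k v"
proof -
  have "coef n Z k (\<lambda>i. c * v i) j = c * coef n Z k v j" for j
    using coef_linear[of n Z k c v 0 v j] by simp
  then show ?thesis unfolding coef_sq_def by (simp only: power_mult_distrib sum_distrib_left)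
qed

context observed_coordinates
begin

lemma array_component: "k \<le> p \<Longrightarrow> i < n \<Longrightarrow> (\<lambda>a. curry a k i) \<in> borel_measurable (\<Pi>\<^sub>M q\<in>{..p} \<times> {..<n}. borel)"
  unfolding curry_def by (rule measurable_component_singleton) simp

lemma AE_nondeg_sample:
  assumes "p \<le> n"
  shows "AE d in sample_law n \<theta>. nondeg n (Zm d) p"
proof -
  interpret S: prob_space "sample_law n \<theta>" by (rule prob_space_sample)
  let ?P = "\<lambda>Z w. \<not> nondeg n Z p"
  have m: "Measurable.pred (\<Pi>\<^sub>M q\<in>{..p} \<times> {..<n}. borel) (\<lambda>a. ?P (curry a) (curry a p))"
    by (rule pred_intros_logic(2), rule measurable_nondeg, rule array_component) simp_all
  have cg: "?P Z w = ?P Z' w'" if "\<And>k i. k < p \<Longrightarrow> i < n \<Longrightarrow> Z k i = Z' k i" "\<And>i. i < n \<Longrightarrow> w i = w' i" for Z Z' and w w' :: "nat \<Rightarrow> real"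
    using nondeg_cong[of p n Z Z'] that by simp
  note t = measure_sample_eq_array[where n=n and P="?P", OF m cg]
  have "AE \<omega> in array_law n p. nondeg n (curry (fst \<omega>)) p"
    unfolding array_law_def by (rule AE_pair_fst[OF prob_space_normal_vec AE_nondeg_columns[OF assms]])
  then have "measure (array_law n p) {\<omega> \<in> space (array_law n p). \<not> nondeg n (curry (fst \<omega>)) p} = 0"
    by (intro array_law.prob_eq_0_AE) (auto elim!: eventually_mono)
  with t have "measure (sample_law n \<theta>) {d \<in> space (sample_law n \<theta>). \<not> nondeg n (Zm d) p} = 0"
    and "{d \<in> space (sample_law n \<theta>). \<not> nondeg n (Zm d) p} \<in> sets (sample_law n \<theta>)"
    by (simp_all only:)
  then have "{d \<in> space (sample_law n \<theta>). \<not> nondeg n (Zm d) p} \<in> null_sets (sample_law n \<theta>)"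
    by (intro null_setsI) (simp_all add: S.emeasure_eq_measure)
  then show ?thesis by (rule AE_I') auto
qed

lemma residual_joint:
  "(\<lambda>\<omega>. residual m (beta_tilde n (fst \<omega>) m) (snd \<omega>)) \<in> borel_measurable (joint_prob n \<theta>)"
proof -
  have Z: "(\<lambda>\<omega>. Zm (fst \<omega>) k i) \<in> borel_measurable (joint_prob n \<theta>)" if "i < n" for k i
    unfolding joint_prob_def using measurable_fst Zm_sample[OF that] by (rule measurable_compose)
  have W: "(\<lambda>\<omega>. Wm (fst \<omega>) i) \<in> borel_measurable (joint_prob n \<theta>)" if "i < n" for i
    unfolding joint_prob_def using measurable_fst Wm_sample[OF that] by (rule measurable_compose)
  have [measurable]: "Measurable.pred (joint_prob n \<theta>) (\<lambda>\<omega>. nondeg n (Zm (fst \<omega>)) p)"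
    by (rule measurable_nondeg) (rule Z)
  have [measurable]: "(\<lambda>\<omega>. ls_coef n (fst \<omega>) k) \<in> borel_measurable (joint_prob n \<theta>)" for k
    by (rule measurable_coef) (rule W Z, assumption)+
  have [measurable]: "(\<lambda>\<omega>. zf k (snd \<omega>)) \<in> borel_measurable (joint_prob n \<theta>)" for k
    unfolding joint_prob_def using measurable_snd zf_obs by (rule measurable_compose)
  have [measurable]: "(\<lambda>\<omega>. wf (snd \<omega>)) \<in> borel_measurable (joint_prob n \<theta>)"
    unfolding joint_prob_def using measurable_snd wf_obs by (rule measurable_compose)
  have [measurable]: "(\<lambda>\<omega>. fst (snd \<omega>)) \<in> borel_measurable (joint_prob n \<theta>)"
    unfolding joint_prob_def using measurable_snd fst_obs by (rule measurable_compose)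
  show ?thesis unfolding residual_beta_tilde by measurable
qed

lemma prob_space_joint: "prob_space (joint_prob n \<theta>)"
proof -
  interpret S: prob_space "sample_law n \<theta>" by (rule prob_space_sample)
  interpret pair_prob_space "sample_law n \<theta>" "obs_law \<theta>" ..
  show ?thesis unfolding joint_prob_def by (rule P.prob_space_axioms)
qed

text \<open>For a nondegenerate sample the future observation is integrated out by
  \<open>row_square\<close>, with the least-squares coefficients as \<open>g\<close>. By Tonelli the
  result has the integrals over sample events that characterise a conditional expectation.\<close>

lemma AE_rho2:
  assumes "p \<le> n"
  shows "AE \<omega> in joint_prob n \<theta>. rho2 n \<theta> m \<omega> = s\<^sup>2 + coef_sq n (Zm (fst \<omega>)) p (Wm (fst \<omega>))"
proof -
  let ?S = "sample_law n \<theta>" and ?J = "joint_prob n \<theta>" and ?F = "obs_law \<theta>"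
  let ?G = "vimage_algebra (space ?J) fst ?S"
  interpret S: prob_space ?S by (rule prob_space_sample)
  interpret SF: pair_prob_space ?S ?F ..
  interpret J: prob_space ?J by (rule prob_space_joint)
  have fstJ: "fst \<in> ?J \<rightarrow>\<^sub>M ?S" unfolding joint_prob_def by (rule measurable_fst)
  have fst_space: "fst \<in> space ?J \<rightarrow> space ?S" using measurable_space[OF fstJ] by auto
  have sub: "subalgebra ?J ?G"
    unfolding subalgebra_def sets_vimage_algebra2[OF fst_space] using measurable_sets[OF fstJ] by auto
  interpret FM: finite_measure_subalgebra ?J ?G
    by (intro finite_measure_subalgebra.intro J.finite_measure_axioms finite_measure_subalgebra_axioms.intro sub)
  define h where "h \<omega> = ennreal ((residual m (beta_tilde n (fst \<omega>) m) (snd \<omega>))\<^sup>2)" for \<omega>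
  have h: "h \<in> borel_measurable ?J" unfolding h_def
    by (rule measurable_compose[OF borel_measurable_power[OF residual_joint] measurable_ennreal])
  define g where "g d = (\<integral>\<^sup>+f. h (d, f) \<partial>?F)" for d
  have g: "g \<in> borel_measurable ?S"
    unfolding g_def using h unfolding joint_prob_def by (rule obs.borel_measurable_nn_integral_fst)
  have gG: "(\<lambda>\<omega>. g (fst \<omega>)) \<in> borel_measurable ?G"
    by (rule measurable_compose[OF measurable_vimage_algebra1[OF fst_space] g])
  have "AE \<omega> in ?J. g (fst \<omega>) = nn_cond_exp ?J ?G h \<omega>"
  proof (rule FM.nn_cond_exp_charact[OF _ h gG])
    fix A assume "A \<in> sets ?G"
    then obtain B where B: "B \<in> sets ?S" "A = fst -` B \<inter> space ?J"
      unfolding sets_vimage_algebra2[OF fst_space] by blast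
    have Bm: "(\<lambda>\<omega>. indicator B (fst \<omega>) :: ennreal) \<in> borel_measurable (?S \<Otimes>\<^sub>M ?F)"
      using B(1) by (intro measurable_compose[OF measurable_fst borel_measurable_indicator])
    have ind: "(\<integral>\<^sup>+\<omega>\<in>A. k \<omega> \<partial>?J) = (\<integral>\<^sup>+d. indicator B d * (\<integral>\<^sup>+f. k (d, f) \<partial>?F) \<partial>?S)"
      if k: "k \<in> borel_measurable ?J" for k
    proof -
      have kS: "k \<in> borel_measurable (?S \<Otimes>\<^sub>M ?F)" using k by (simp add: joint_prob_def)
      have "(\<integral>\<^sup>+\<omega>\<in>A. k \<omega> \<partial>?J) = (\<integral>\<^sup>+\<omega>. indicator B (fst \<omega>) * k \<omega> \<partial>(?S \<Otimes>\<^sub>M ?F))"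
        unfolding joint_prob_def B(2) by (intro nn_integral_cong) (auto simp: indicator_def)
      also have "\<dots> = (\<integral>\<^sup>+d. \<integral>\<^sup>+f. indicator B d * k (d, f) \<partial>?F \<partial>?S)"
        using obs.nn_integral_fst[OF borel_measurable_times_ennreal[OF Bm kS]] by simp
      also have "\<dots> = (\<integral>\<^sup>+d. indicator B d * (\<integral>\<^sup>+f. k (d, f) \<partial>?F) \<partial>?S)"
        using measurable_compose[OF measurable_Pair1' kS] by (intro nn_integral_cong nn_integral_cmult) simp
      finally show ?thesis .
    qed
    have gJ: "(\<lambda>\<omega>. g (fst \<omega>)) \<in> borel_measurable ?J" using fstJ g by (rule measurable_compose)
    show "(\<integral>\<^sup>+\<omega>\<in>A. h \<omega> \<partial>?J) = (\<integral>\<^sup>+\<omega>\<in>A. g (fst \<omega>) \<partial>?J)"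
      unfolding ind[OF h] ind[OF gJ] by (simp add: g_def[symmetric] obs.emeasure_space_1)
  qed
  \<comment> \<open>\<open>real_cond_exp\<close> subtracts the conditional expectation of the
    negative part, which is zero for a square.\<close>
  moreover have "AE \<omega> in ?J. 0 = nn_cond_exp ?J ?G (\<lambda>_. 0) \<omega>"
    by (rule FM.nn_cond_exp_charact) auto
  moreover have "AE \<omega> in ?J. nondeg n (Zm (fst \<omega>)) p"
    unfolding joint_prob_def by (rule AE_pair_fst[OF prob_obs AE_nondeg_sample[OF assms]])
  ultimately show ?thesis
  proof eventually_elim
    case (elim \<omega>)
    have "g (fst \<omega>) = ennreal (s\<^sup>2 + coef_sq n (Zm (fst \<omega>)) p (Wm (fst \<omega>)))"
      unfolding g_def h_def fst_conv snd_conv residual_beta_tilde coef_sq_def using elim(3) by (simp only: if_True row_square)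
    moreover have "rho2 n \<theta> m \<omega> = enn2real (nn_cond_exp ?J ?G h \<omega>) - enn2real (nn_cond_exp ?J ?G (\<lambda>_. 0) \<omega>)"
    proof -
      have "(\<lambda>\<omega>. ennreal (- (case \<omega> of (d, f) \<Rightarrow> (residual m (beta_tilde n d m) f)\<^sup>2))) = (\<lambda>_. 0)"
        by (auto simp: fun_eq_iff ennreal_eq_0_iff)
      moreover have "(\<lambda>\<omega>. ennreal (case \<omega> of (d, f) \<Rightarrow> (residual m (beta_tilde n d m) f)\<^sup>2)) = h"
        by (auto simp: fun_eq_iff h_def)
      ultimately show ?thesis unfolding rho2_def real_cond_exp_def by (simp only:)
    qed
    moreover have "nn_cond_exp ?J ?G h \<omega> = g (fst \<omega>)" "nn_cond_exp ?J ?G (\<lambda>_. 0) \<omega> = 0"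
      using elim(1,2) by simp_all
    moreover have "s\<^sup>2 + coef_sq n (Zm (fst \<omega>)) p (Wm (fst \<omega>)) \<ge> 0" by simp
    ultimately show ?case by (simp only: enn2real_ennreal) simp
  qed
qed

text \<open>Since \<open>rho2\<close> is fixed only almost surely, the error event is enclosed up to
  a null set in an event \<open>D\<close> about the sample alone, whose probability is computed on
  the standardised array.\<close>

lemma error_event:
  fixes r \<epsilon> c :: real
  assumes p: "p < n" and size: "model_size m = p" and pr: "real p / real n \<le> r" and r: "r < 1"
    and \<epsilon>: "\<epsilon> > 0" and c: "c > 0" and s: "s\<^sup>2 \<le> c"
  shows "\<exists>D \<in> sets (sample_law n \<theta>).
      measure (sample_law n \<theta>) D \<le> 4 * exp (- real n * (1 - r) * Psi (\<epsilon> / (2 * c) * (1 - r)))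
      \<and> (AE \<omega> in joint_prob n \<theta>. \<bar>rho2_hat n (fst \<omega>) m - rho2 n \<theta> m \<omega>\<bar> > \<epsilon> \<longrightarrow> fst \<omega> \<in> D)"
proof -
  define P where "P Z w \<longleftrightarrow> \<bar>rss n Z p w / (real n - real p) * ((real n + 1) / (real n + 1 - real p))
    - (s\<^sup>2 + coef_sq n Z p w)\<bar> > \<epsilon>" for Z w
  have m: "Measurable.pred (\<Pi>\<^sub>M q\<in>{..p} \<times> {..<n}. borel) (\<lambda>a. P (curry a) (curry a p))"
  proof -
    have [measurable]: "(\<lambda>a. rss n (curry a) p (curry a p)) \<in> borel_measurable (\<Pi>\<^sub>M q\<in>{..p} \<times> {..<n}. borel)"
      by (rule measurable_rss; rule array_component; simp)
    have [measurable]: "(\<lambda>a. coef_sq n (curry a) p (curry a p)) \<in> borel_measurable (\<Pi>\<^sub>M q\<in>{..p} \<times> {..<n}. borel)"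
      by (rule measurable_coef_sq; rule array_component; simp)
    show ?thesis unfolding P_def by measurable
  qed
  have cg: "P Z w = P Z' w'" if "\<And>k i. k < p \<Longrightarrow> i < n \<Longrightarrow> Z k i = Z' k i" "\<And>i. i < n \<Longrightarrow> w i = w' i" for Z Z' w w'
    using rss_cong[of n w w' p Z Z'] coef_sq_cong[of n w w' p Z Z'] that by (simp add: P_def)
  define D where "D = {d \<in> space (sample_law n \<theta>). P (Zm d) (Wm d)}"
  have D: "D \<in> sets (sample_law n \<theta>)" unfolding D_def by (rule measure_sample_eq_array(2)[where n=n and P=P, OF m cg])
  have "measure (sample_law n \<theta>) D = measure (array_law n p) {\<omega> \<in> space (array_law n p). P (curry (fst \<omega>)) (\<lambda>i. s * snd \<omega> i)}"
    unfolding D_def by (rule measure_sample_eq_array(1)[where n=n and P=P, OF m cg])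
  also have "\<dots> = measure (array_law n p) {\<omega> \<in> space (array_law n p).
      \<bar>s\<^sup>2 * array_rss n p \<omega> / (real n - real p) * ((real n + 1) / (real n + 1 - real p))
        - s\<^sup>2 * (1 + array_coef_sq n p \<omega>)\<bar> > \<epsilon>}"
    unfolding P_def rss_scale coef_sq_scale by (simp only: distrib_left mult_1_right)
  also have "\<dots> \<le> 4 * exp (- real n * (1 - r) * Psi (\<epsilon> / (2 * c) * (1 - r)))"
    by (rule measure_estimation_error[OF p pr r \<epsilon> c s])
  finally have le: "measure (sample_law n \<theta>) D \<le> 4 * exp (- real n * (1 - r) * Psi (\<epsilon> / (2 * c) * (1 - r)))" .
  have "AE \<omega> in joint_prob n \<theta>. nondeg n (Zm (fst \<omega>)) p"
    unfolding joint_prob_def by (rule AE_pair_fst[OF prob_obs AE_nondeg_sample[OF less_imp_le[OF p]]])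
  with AE_rho2[OF less_imp_le[OF p]] AE_space
  have "AE \<omega> in joint_prob n \<theta>. \<bar>rho2_hat n (fst \<omega>) m - rho2 n \<theta> m \<omega>\<bar> > \<epsilon> \<longrightarrow> fst \<omega> \<in> D"
  proof eventually_elim
    case (elim \<omega>)
    have "fst \<omega> \<in> space (sample_law n \<theta>)" using elim(2) by (simp add: joint_prob_def space_pair_measure mem_Times_iff)
    then show ?case unfolding D_def P_def rho2_hat_def size elim(1) RSS_nondeg[OF elim(3)] by simp
  qed
  with D le show ?thesis by blast
qed

end

section \<open>Coordinates for the Gaussian model\<close>

lemma integrable_mult_square:
  fixes f g :: "'a \<Rightarrow> real"
  assumes "f \<in> borel_measurable M" "g \<in> borel_measurable M"
    and "integrable M (\<lambda>x. (f x)\<^sup>2)" "integrable M (\<lambda>x. (g x)\<^sup>2)"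
  shows "integrable M (\<lambda>x. f x * g x)"
proof (rule Bochner_Integration.integrable_bound)
  show "integrable M (\<lambda>x. (f x)\<^sup>2 + (g x)\<^sup>2)" using assms by simp
  show "(\<lambda>x. f x * g x) \<in> borel_measurable M" using assms by simp
  have "\<bar>a * b\<bar> \<le> a\<^sup>2 + b\<^sup>2" for a b :: real
    using sum_squares_bound[of "\<bar>a\<bar>" "\<bar>b\<bar>"] mult_nonneg_nonneg[OF abs_ge_zero[of a] abs_ge_zero[of b]]
    unfolding abs_mult power2_abs by linarith
  then show "AE x in M. norm (f x * g x) \<le> norm ((f x)\<^sup>2 + (g x)\<^sup>2)"
    by (simp add: abs_of_nonneg)
qed

lemma (in prob_space) square_expectation_le:
  fixes f :: "'a \<Rightarrow> real"
  assumes f: "f \<in> borel_measurable M" "integrable M (\<lambda>x. (f x)\<^sup>2)"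
  shows "(expectation f)\<^sup>2 \<le> expectation (\<lambda>x. (f x)\<^sup>2)"
proof -
  have "integrable M f" using f by (rule square_integrable_imp_integrable)
  then have "variance f = expectation (\<lambda>x. (f x)\<^sup>2) - (expectation f)\<^sup>2"
    using f(2) by (rule variance_eq)
  then show ?thesis using variance_positive[of f] by linarith
qed

context gaussian_linear_model
begin

lemma gaussian_linear:
  "finite J \<Longrightarrow> gaussian_rv M (\<lambda>\<omega>. a * y \<omega> + (\<Sum>j\<in>J. c j * x j \<omega>))"
  using jointly_gaussian[of J a 0 c] by simp

lemma y_square_integrable: "integrable M (\<lambda>\<omega>. (y \<omega>)\<^sup>2)"
  using gaussian_rv_integrable_square[OF gaussian_linear[of "{}" 1 "\<lambda>_. 0"]] by simp

lemmas y_integrable = square_integrable_imp_integrable[OF rv_measurable(1) y_square_integrable]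
lemmas u_integrable = square_integrable_imp_integrable[OF rv_measurable(2) u_square_integrable]
lemmas x_integrable = square_integrable_imp_integrable[OF rv_measurable(3) x_square_integrable]

text \<open>Each remainder \<open>D k\<close> has the same mean as \<open>y\<close>, and the square
  of this mean is at most the second moment of \<open>D k\<close>, which tends to zero.\<close>

lemma y_mean: "expectation y = 0"
proof -
  define D where "D k \<omega> = y \<omega> - u \<omega> - (\<Sum>j<k. x j \<omega> * \<beta> j)" for k \<omega>
  have D_gauss: "gaussian_rv M (D k)" for k
    using jointly_gaussian[of "{..<k}" 1 "-1" "\<lambda>j. - \<beta> j"]
    by (simp add: D_def[abs_def] sum_negf mult.commute)
  have D2: "integrable M (\<lambda>\<omega>. (D k \<omega>)\<^sup>2)" for k
    by (rule gaussian_rv_integrable_square[OF D_gauss])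
  have Dm: "D k \<in> borel_measurable M" for k using D_gauss by (simp add: gaussian_rv_def)
  have ED: "expectation (D k) = expectation y" for k
  proof -
    have "expectation (D k) = expectation y - expectation u - (\<Sum>j<k. expectation (x j) * \<beta> j)"
      unfolding D_def using y_integrable u_integrable x_integrable by simp
    then show ?thesis by (simp add: u_mean x_mean)
  qed
  have "ennreal ((expectation y)\<^sup>2) \<le> (\<integral>\<^sup>+\<omega>. ennreal ((D k \<omega>)\<^sup>2) \<partial>M)" for k
  proof -
    have "(expectation y)\<^sup>2 \<le> expectation (\<lambda>\<omega>. (D k \<omega>)\<^sup>2)"
      using square_expectation_le[OF Dm D2, of k] by (simp only: ED)
    then have "ennreal ((expectation y)\<^sup>2) \<le> ennreal (expectation (\<lambda>\<omega>. (D k \<omega>)\<^sup>2))"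
      by (rule ennreal_leI)
    also have "\<dots> = (\<integral>\<^sup>+\<omega>. ennreal ((D k \<omega>)\<^sup>2) \<partial>M)"
      using D2 by (intro nn_integral_eq_integral[symmetric]) auto
    finally show ?thesis .
  qed
  then have "ennreal ((expectation y)\<^sup>2) \<le> 0"
    using series_mean_square unfolding D_def by (intro LIMSEQ_le_const) auto
  then show ?thesis by (simp add: ennreal_eq_0_iff)
qed

text \<open>Population regression coefficients as \<open>\<eta>\<close> make the error
  \<open>w\<close> uncorrelated with every \<open>z k\<close>. All linear combinations are centred
  Gaussian, so second moments determine the characteristic function, and it is that of independent
  variables.\<close>

lemma exists_standard_coordinates:
  assumes fin: "finite {j. m j}"
  defines "p \<equiv> card {j. m j}"
  obtains T U \<eta> s where "model_coordinates m T U p"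
    and "\<And>t b. (CLINT \<omega>|M. iexp ((\<Sum>k<p. t k * (\<Sum>l | m l. T k l * x l \<omega>))
        + b * (y \<omega> - (\<Sum>k<p. \<eta> k * (\<Sum>l | m l. T k l * x l \<omega>)))))
      = of_real (exp (- ((\<Sum>k<p. (t k)\<^sup>2) + s\<^sup>2 * b\<^sup>2) / 2))"
    and "\<And>g. (\<integral>\<^sup>+\<omega>. ennreal ((y \<omega> - (\<Sum>k<p. \<eta> k * (\<Sum>l | m l. T k l * x l \<omega>))
        - (\<Sum>k<p. g k * (\<Sum>l | m l. T k l * x l \<omega>)))\<^sup>2) \<partial>M)
      = ennreal (s\<^sup>2 + (\<Sum>k<p. (g k)\<^sup>2))"
    and "s\<^sup>2 \<le> expectation (\<lambda>\<omega>. (y \<omega>)\<^sup>2)"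
proof -
  let ?I = "{j. m j}"
  note [measurable] = rv_measurable
  have sym: "\<Sigma> i j = \<Sigma> j i" for i j
    using x_cov[of i j] x_cov[of j i] by (simp add: mult.commute)
  have pd: "0 < (\<Sum>i\<in>?I. \<Sum>j\<in>?I. c i * c j * \<Sigma> i j)" if "\<exists>j\<in>?I. c j \<noteq> 0" for c
    using fin that by (rule cov_positive_definite)
  have "\<exists>T U. (\<forall>\<xi>. \<forall>j\<in>?I. \<xi> j = (\<Sum>k<card ?I. U j k * (\<Sum>l\<in>?I. T k l * \<xi> l)))
    \<and> (\<forall>k<card ?I. \<forall>k'<card ?I. (\<Sum>i\<in>?I. \<Sum>j\<in>?I. T k i * T k' j * \<Sigma> i j) = (if k = k' then 1 else 0))"
  proof (rule orthonormal_coordinates[OF fin sym pd])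
    fix T U :: "nat \<Rightarrow> nat \<Rightarrow> real"
    assume 1: "\<And>\<xi> j. j \<in> ?I \<Longrightarrow> \<xi> j = (\<Sum>k<card ?I. U j k * (\<Sum>l\<in>?I. T k l * \<xi> l))"
      and 2: "\<And>k k'. k < card ?I \<Longrightarrow> k' < card ?I \<Longrightarrow> (\<Sum>i\<in>?I. \<Sum>j\<in>?I. T k i * T k' j * \<Sigma> i j) = (if k = k' then 1 else 0)"
    have "\<forall>\<xi>. \<forall>j\<in>?I. \<xi> j = (\<Sum>k<card ?I. U j k * (\<Sum>l\<in>?I. T k l * \<xi> l))"
      by (intro allI ballI) (rule 1)
    moreover have "\<forall>k<card ?I. \<forall>k'<card ?I. (\<Sum>i\<in>?I. \<Sum>j\<in>?I. T k i * T k' j * \<Sigma> i j) = (if k = k' then 1 else 0)"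
      by (intro allI impI) (rule 2)
    ultimately show ?thesis by (intro exI conjI)
  qed
  then obtain T U where TU: "(\<forall>\<xi>. \<forall>j\<in>?I. \<xi> j = (\<Sum>k<card ?I. U j k * (\<Sum>l\<in>?I. T k l * \<xi> l)))
    \<and> (\<forall>k<card ?I. \<forall>k'<card ?I. (\<Sum>i\<in>?I. \<Sum>j\<in>?I. T k i * T k' j * \<Sigma> i j) = (if k = k' then 1 else 0))"
    by (elim exE)
  note rep = TU[THEN conjunct1, rule_format] and orth = TU[THEN conjunct2, rule_format]
  define z where "z k \<omega> = (\<Sum>l\<in>?I. T k l * x l \<omega>)" for k \<omega>
  have z_gauss: "gaussian_rv M (z k)" for k
    using gaussian_linear[OF fin, of 0 "T k"] by (simp add: z_def[abs_def])
  have zm[measurable]: "z k \<in> borel_measurable M" for k using z_gauss by (simp add: gaussian_rv_def)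
  have z2: "integrable M (\<lambda>\<omega>. (z k \<omega>)\<^sup>2)" for k by (rule gaussian_rv_integrable_square[OF z_gauss])
  have xx: "integrable M (\<lambda>\<omega>. x i \<omega> * x j \<omega>)" for i j
    by (rule integrable_mult_square[OF rv_measurable(3) rv_measurable(3) x_square_integrable x_square_integrable])
  have zz: "integrable M (\<lambda>\<omega>. z k \<omega> * z k' \<omega>)" for k k'
    by (rule integrable_mult_square[OF zm zm z2 z2])
  have yz: "integrable M (\<lambda>\<omega>. y \<omega> * z k \<omega>)" for k
    by (rule integrable_mult_square[OF rv_measurable(1) zm y_square_integrable z2])
  have Ezz: "expectation (\<lambda>\<omega>. z k \<omega> * z k' \<omega>) = (if k = k' then 1 else 0)" if "k < p" "k' < p" for k k'
  proof -
    have "z k \<omega> * z k' \<omega> = (\<Sum>i\<in>?I. \<Sum>j\<in>?I. T k i * T k' j * (x i \<omega> * x j \<omega>))" for \<omega>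
      unfolding z_def sum_product by (intro sum.cong refl) (simp only: mult_ac)
    then have "expectation (\<lambda>\<omega>. z k \<omega> * z k' \<omega>) = (\<Sum>i\<in>?I. \<Sum>j\<in>?I. T k i * T k' j * \<Sigma> i j)"
      using xx by (simp add: x_cov)
    then show ?thesis using orth[folded p_def, OF that] by (simp only:)
  qed
  define \<eta> where "\<eta> k = expectation (\<lambda>\<omega>. y \<omega> * z k \<omega>)" for k
  define w where "w \<omega> = y \<omega> - (\<Sum>k<p. \<eta> k * z k \<omega>)" for \<omega>
  have lin: "(\<Sum>k<p. t k * z k \<omega>) = (\<Sum>l\<in>?I. (\<Sum>k<p. t k * T k l) * x l \<omega>)" for t \<omega>
  proof -
    have "(\<Sum>k<p. t k * z k \<omega>) = (\<Sum>k<p. \<Sum>l\<in>?I. t k * T k l * x l \<omega>)"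
      unfolding z_def sum_distrib_left by (simp only: mult.assoc)
    also have "\<dots> = (\<Sum>l\<in>?I. \<Sum>k<p. t k * T k l * x l \<omega>)" by (rule sum.swap)
    finally show ?thesis unfolding sum_distrib_right .
  qed
  \<comment> \<open>One family of combinations serves all claims: the characteristic function, the
    prediction error at \<open>V (\<lambda>k. - g k) 1\<close>, and the bound on \<open>s\<close>
    from \<open>y = V \<eta> 1\<close>.\<close>
  define V where "V t b \<omega> = (\<Sum>k<p. t k * z k \<omega>) + b * w \<omega>" for t b \<omega>
  have V_eq: "V t b \<omega> = b * y \<omega> + (\<Sum>k<p. (t k - b * \<eta> k) * z k \<omega>)" for t b \<omega>
    unfolding V_def w_def by (simp add: right_diff_distrib left_diff_distrib sum_subtractf sum_distrib_left mult.assoc)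
  have V_gauss: "gaussian_rv M (V t b)" for t b
    unfolding V_eq[abs_def] lin by (rule gaussian_linear[OF fin])
  have w_gauss: "gaussian_rv M w" using V_gauss[of "\<lambda>_. 0" 1] by (simp add: V_def[abs_def])
  have wm[measurable]: "w \<in> borel_measurable M" using w_gauss by (simp add: gaussian_rv_def)
  have w2: "integrable M (\<lambda>\<omega>. (w \<omega>)\<^sup>2)" by (rule gaussian_rv_integrable_square[OF w_gauss])
  have zw: "integrable M (\<lambda>\<omega>. z k \<omega> * w \<omega>)" for k by (rule integrable_mult_square[OF zm wm z2 w2])
  have z_int: "integrable M (z k)" for k by (rule square_integrable_imp_integrable[OF zm z2])
  have V_mean: "expectation (V t b) = 0" for t b
  proof -
    have "expectation (z k) = 0" for k
      unfolding z_def using x_integrable by (simp add: x_mean)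
    then show ?thesis unfolding V_eq using y_integrable z_int by (simp add: y_mean)
  qed
  have Ezw: "expectation (\<lambda>\<omega>. z k \<omega> * w \<omega>) = 0" if k: "k < p" for k
  proof -
    have "z k \<omega> * w \<omega> = y \<omega> * z k \<omega> - (\<Sum>k'<p. \<eta> k' * (z k' \<omega> * z k \<omega>))" for \<omega>
      unfolding w_def by (simp add: right_diff_distrib sum_distrib_left mult_ac)
    then have "expectation (\<lambda>\<omega>. z k \<omega> * w \<omega>) = \<eta> k - (\<Sum>k'<p. \<eta> k' * expectation (\<lambda>\<omega>. z k' \<omega> * z k \<omega>))"
      using yz zz by (simp add: \<eta>_def)
    also have "(\<Sum>k'<p. \<eta> k' * expectation (\<lambda>\<omega>. z k' \<omega> * z k \<omega>)) = (\<Sum>k'<p. if k' = k then \<eta> k' else 0)"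
      using k by (intro sum.cong) (auto simp: Ezz)
    also have "\<dots> = \<eta> k" using k by (simp add: sum.delta)
    finally show ?thesis by simp
  qed
  define s where "s = sqrt (expectation (\<lambda>\<omega>. (w \<omega>)\<^sup>2))"
  have s: "s\<^sup>2 = expectation (\<lambda>\<omega>. (w \<omega>)\<^sup>2)" by (simp add: s_def)
  have EV: "expectation (\<lambda>\<omega>. (V t b \<omega>)\<^sup>2) = (\<Sum>k<p. (t k)\<^sup>2) + s\<^sup>2 * b\<^sup>2" for t b
  proof -
    have "(V t b \<omega>)\<^sup>2 = (\<Sum>k<p. \<Sum>k'<p. t k * t k' * (z k \<omega> * z k' \<omega>)) + (\<Sum>k<p. (2 * b * t k) * (z k \<omega> * w \<omega>)) + b\<^sup>2 * (w \<omega>)\<^sup>2" for \<omega>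
    proof -
      have "(\<Sum>k<p. t k * z k \<omega>)\<^sup>2 = (\<Sum>k<p. \<Sum>k'<p. t k * t k' * (z k \<omega> * z k' \<omega>))"
        unfolding power2_eq_square sum_product by (intro sum.cong refl) (simp only: mult_ac)
      moreover have "2 * (\<Sum>k<p. t k * z k \<omega>) * (b * w \<omega>) = (\<Sum>k<p. (2 * b * t k) * (z k \<omega> * w \<omega>))"
        by (simp add: sum_distrib_left sum_distrib_right mult_ac)
      ultimately show ?thesis unfolding V_def power2_sum by (simp add: power_mult_distrib)
    qed
    then have "expectation (\<lambda>\<omega>. (V t b \<omega>)\<^sup>2) = (\<Sum>k<p. \<Sum>k'<p. t k * t k' * expectation (\<lambda>\<omega>. z k \<omega> * z k' \<omega>))
        + (\<Sum>k<p. (2 * b * t k) * expectation (\<lambda>\<omega>. z k \<omega> * w \<omega>)) + b\<^sup>2 * expectation (\<lambda>\<omega>. (w \<omega>)\<^sup>2)"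
      using zz zw w2 by simp
    also have "(\<Sum>k<p. (2 * b * t k) * expectation (\<lambda>\<omega>. z k \<omega> * w \<omega>)) = 0" by (simp add: Ezw)
    also have "(\<Sum>k<p. \<Sum>k'<p. t k * t k' * expectation (\<lambda>\<omega>. z k \<omega> * z k' \<omega>)) = (\<Sum>k<p. \<Sum>k'<p. if k' = k then t k * t k' else 0)"
      by (intro sum.cong refl) (auto simp: Ezz)
    also have "\<dots> = (\<Sum>k<p. (t k)\<^sup>2)" by (simp add: sum.delta power2_eq_square)
    finally show ?thesis by (simp add: s mult.commute)
  qed
  show thesis
  proof (rule that[of T U \<eta> s])
    show "model_coordinates m T U p"
    proof
      show "finite ?I" by (rule fin)
      show "\<xi> j = (\<Sum>k<p. U j k * (\<Sum>l\<in>?I. T k l * \<xi> l))" if "m j" for \<xi> j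
        unfolding p_def by (rule rep) (use that in simp)
      \<comment> \<open>The relation makes the combination of the \<open>z k\<close> vanish, while
        by orthonormality its second moment is the sum of the squares of the
        \<open>c k\<close>.\<close>
      fix c k assume c: "\<And>l. m l \<Longrightarrow> (\<Sum>k<p. c k * T k l) = 0" and k: "k < p"
      have "(\<Sum>k<p. c k * z k \<omega>) = 0" for \<omega>
        unfolding lin using c by (intro sum.neutral) auto
      then have "V c 0 = (\<lambda>_. 0)" by (simp add: V_def fun_eq_iff)
      then have "(\<Sum>k<p. (c k)\<^sup>2) = 0" using EV[of c 0] by simp
      then show "c k = 0" using k by (simp add: sum_nonneg_eq_0_iff)
    qed
    show "(CLINT \<omega>|M. iexp ((\<Sum>k<p. t k * (\<Sum>l\<in>?I. T k l * x l \<omega>))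
        + b * (y \<omega> - (\<Sum>k<p. \<eta> k * (\<Sum>l\<in>?I. T k l * x l \<omega>)))))
      = of_real (exp (- ((\<Sum>k<p. (t k)\<^sup>2) + s\<^sup>2 * b\<^sup>2) / 2))" for t b
      using gaussian_rv_char[OF V_gauss V_mean, of 1 t b]
      unfolding EV unfolding V_def w_def z_def by simp
    show "(\<integral>\<^sup>+\<omega>. ennreal ((y \<omega> - (\<Sum>k<p. \<eta> k * (\<Sum>l\<in>?I. T k l * x l \<omega>))
        - (\<Sum>k<p. g k * (\<Sum>l\<in>?I. T k l * x l \<omega>)))\<^sup>2) \<partial>M)
      = ennreal (s\<^sup>2 + (\<Sum>k<p. (g k)\<^sup>2))" for g
    proof -
      have V: "V (\<lambda>k. - g k) 1 \<omega> = y \<omega> - (\<Sum>k<p. \<eta> k * (\<Sum>l\<in>?I. T k l * x l \<omega>)) - (\<Sum>k<p. g k * (\<Sum>l\<in>?I. T k l * x l \<omega>))" for \<omega>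
        unfolding V_def w_def z_def by (simp add: sum_negf)
      have "(\<integral>\<^sup>+\<omega>. ennreal ((V (\<lambda>k. - g k) 1 \<omega>)\<^sup>2) \<partial>M) = ennreal (expectation (\<lambda>\<omega>. (V (\<lambda>k. - g k) 1 \<omega>)\<^sup>2))"
        by (rule nn_integral_eq_integral[OF gaussian_rv_integrable_square[OF V_gauss]]) simp
      then show ?thesis unfolding EV unfolding V by (simp add: add.commute)
    qed
    have "V \<eta> 1 = y" unfolding V_def w_def by (simp add: fun_eq_iff)
    then have "expectation (\<lambda>\<omega>. (y \<omega>)\<^sup>2) = (\<Sum>k<p. (\<eta> k)\<^sup>2) + s\<^sup>2" using EV[of \<eta> 1] by simp
    then show "s\<^sup>2 \<le> expectation (\<lambda>\<omega>. (y \<omega>)\<^sup>2)" by (simp add: sum_nonneg)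
  qed
qed

end

text \<open>Coordinates and error involve only \<open>y\<close> and the regressors, so their law
  under \<open>model_law\<close> is also the one under \<open>obs_law\<close>.\<close>

lemma exists_observed_coordinates:
  assumes \<theta>: "\<theta> \<in> admissible" and fin: "finite {j. m j}"
  shows "\<exists>T U \<eta> s. observed_coordinates m T U (card {j. m j}) \<eta> \<theta> s \<and> s\<^sup>2 \<le> var_y \<theta>"
proof -
  let ?L = "model_law \<theta>" and ?p = "card {j. m j}"
  let ?B = "borel \<Otimes>\<^sub>M (\<Pi>\<^sub>M j\<in>UNIV. borel) :: (real \<times> (nat \<Rightarrow> real)) measure"
  obtain \<beta> \<sigma> \<Sigma> where \<theta>_eq: "\<theta> = (\<beta>, \<sigma>, \<Sigma>)" by (cases \<theta>) auto
  have law: "is_model_law \<theta> ?L"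
    using \<theta> unfolding admissible_def model_law_def by (auto intro: someI)
  then interpret L: gaussian_linear_model ?L "\<lambda>(y, u, x). y" "\<lambda>(y, u, x). u" "\<lambda>j (y, u, x). x j" \<beta> \<sigma> \<Sigma>
    by (simp add: is_model_law_def \<theta>_eq)
  have sets_L: "sets ?L = sets triple_space" using law by (simp add: is_model_law_def \<theta>_eq)
  define g where "g = (\<lambda>(y :: real, u :: real, x :: nat \<Rightarrow> real). (y, x))"
  have g: "g \<in> ?L \<rightarrow>\<^sub>M ?B"
    unfolding measurable_cong_sets[OF sets_L refl] triple_space_def g_def by measurable
  have obs: "obs_law \<theta> = distr ?L ?B g" by (simp add: obs_law_def g_def)
  show ?thesis
  proof (rule L.exists_standard_coordinates[OF fin])
    fix T U :: "nat \<Rightarrow> nat \<Rightarrow> real" and \<eta> :: "nat \<Rightarrow> real" and s :: real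
    assume MC: "model_coordinates m T U ?p"
      and char: "\<And>t b. (CLINT \<omega>|?L. iexp ((\<Sum>k<?p. t k * (\<Sum>l | m l. T k l * (case \<omega> of (y, u, x) \<Rightarrow> x l)))
          + b * ((case \<omega> of (y, u, x) \<Rightarrow> y) - (\<Sum>k<?p. \<eta> k * (\<Sum>l | m l. T k l * (case \<omega> of (y, u, x) \<Rightarrow> x l))))))
        = of_real (exp (- ((\<Sum>k<?p. (t k)\<^sup>2) + s\<^sup>2 * b\<^sup>2) / 2))"
      and square: "\<And>h. (\<integral>\<^sup>+\<omega>. ennreal (((case \<omega> of (y, u, x) \<Rightarrow> y) - (\<Sum>k<?p. \<eta> k * (\<Sum>l | m l. T k l * (case \<omega> of (y, u, x) \<Rightarrow> x l)))
          - (\<Sum>k<?p. h k * (\<Sum>l | m l. T k l * (case \<omega> of (y, u, x) \<Rightarrow> x l))))\<^sup>2) \<partial>?L)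
        = ennreal (s\<^sup>2 + (\<Sum>k<?p. (h k)\<^sup>2))"
      and s_le: "s\<^sup>2 \<le> L.expectation (\<lambda>\<omega>. (case \<omega> of (y, u, x) \<Rightarrow> y)\<^sup>2)"
    interpret MC: model_coordinates m T U ?p \<eta> by (rule MC)
    have zf: "MC.zf k (g \<omega>) = (\<Sum>l | m l. T k l * (case \<omega> of (y, u, x) \<Rightarrow> x l))" for k \<omega>
      by (simp add: MC.zf_def g_def case_prod_beta)
    have wf: "MC.wf (g \<omega>) = (case \<omega> of (y, u, x) \<Rightarrow> y) - (\<Sum>k<?p. \<eta> k * (\<Sum>l | m l. T k l * (case \<omega> of (y, u, x) \<Rightarrow> x l)))" for \<omega>
      unfolding MC.wf_def zf by (simp add: g_def case_prod_beta)
    have x_B: "(\<lambda>f. snd f l) \<in> borel_measurable ?B" for l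
      using measurable_compose[OF measurable_snd measurable_component_singleton[of l UNIV "\<lambda>_. borel"]] by simp
    have zf_B[measurable]: "MC.zf k \<in> borel_measurable ?B" for k
      unfolding MC.zf_def by (intro borel_measurable_sum borel_measurable_times borel_measurable_const x_B)
    have wf_B[measurable]: "MC.wf \<in> borel_measurable ?B"
      unfolding MC.wf_def by measurable
    have "observed_coordinates m T U ?p \<eta> \<theta> s"
    proof (intro observed_coordinates.intro observed_coordinates_axioms.intro MC)
      show "prob_space (obs_law \<theta>)" unfolding obs by (rule L.prob_space_distr[OF g])
      show "(CLINT f|obs_law \<theta>. iexp ((\<Sum>k<?p. t k * MC.zf k f) + b * MC.wf f))
        = of_real (exp (- ((\<Sum>k<?p. (t k)\<^sup>2) + s\<^sup>2 * b\<^sup>2) / 2))" for t b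
      proof -
        have "(\<lambda>f. iexp ((\<Sum>k<?p. t k * MC.zf k f) + b * MC.wf f)) \<in> borel_measurable ?B" by measurable
        from integral_distr[OF g this] show ?thesis unfolding obs zf wf using char[of t b] by (simp only:)
      qed
      show "(\<integral>\<^sup>+f. ennreal ((MC.wf f - (\<Sum>k<?p. h k * MC.zf k f))\<^sup>2) \<partial>obs_law \<theta>)
        = ennreal (s\<^sup>2 + (\<Sum>k<?p. (h k)\<^sup>2))" for h
      proof -
        have "(\<lambda>f. ennreal ((MC.wf f - (\<Sum>k<?p. h k * MC.zf k f))\<^sup>2)) \<in> borel_measurable ?B" by measurable
        then have "(\<integral>\<^sup>+f. ennreal ((MC.wf f - (\<Sum>k<?p. h k * MC.zf k f))\<^sup>2) \<partial>obs_law \<theta>)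
          = (\<integral>\<^sup>+\<omega>. ennreal ((MC.wf (g \<omega>) - (\<Sum>k<?p. h k * MC.zf k (g \<omega>)))\<^sup>2) \<partial>?L)"
          unfolding obs by (intro nn_integral_distr[OF g]) simp
        then show ?thesis unfolding zf wf using square[of h] by (simp only:)
      qed
    qed
    moreover have "var_y \<theta> = L.expectation (\<lambda>\<omega>. (case \<omega> of (y, u, x) \<Rightarrow> y)\<^sup>2)"
    proof -
      have "(\<lambda>(y :: real, u :: real, x :: nat \<Rightarrow> real). y) = fst" by (auto simp: fun_eq_iff)
      then have "L.expectation fst = 0" using L.y_mean by (simp only:)
      then show ?thesis unfolding var_y_def by (simp add: case_prod_beta)
    qed
    ultimately show ?thesis using s_le by (intro exI[of _ T] exI[of _ U] exI[of _ \<eta>] exI[of _ s] conjI) simp_all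
  qed
qed

section \<open>Union bound over the models and supremum over the parameters\<close>

theorem corollary3p3:
  fixes n :: nat and \<M> :: "model set" and r \<epsilon> c :: real
  assumes "finite \<M>" and "\<M> \<noteq> {}"
    and "\<And>m. m \<in> \<M> \<Longrightarrow> finite {j. m j}"
    and "\<And>m. m \<in> \<M> \<Longrightarrow> real (model_size m) < real n - 1"
    and r: "r = (SUP m\<in>\<M>. real (model_size m) / real n)"
    and "\<epsilon> > 0" and "c > 0"
  shows "(SUP \<theta> \<in> {\<theta> \<in> admissible. var_y \<theta> \<le> c}.
            \<P>(\<omega> in joint_prob n \<theta>. (SUP m\<in>\<M>. \<bar>rho2_hat n (fst \<omega>) m - rho2 n \<theta> m \<omega>\<bar>) > \<epsilon>))
         \<le> 4 * real (card \<M>) * exp (- real n * (1 - r) * Psi (\<epsilon> / (2 * c) * (1 - r)))"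
proof (rule cSUP_least)
  \<comment> \<open>A real supremum is well behaved only over a nonempty set; the standard model
    with \<open>var_y\<close> equal to zero is a member.\<close>
  show "{\<theta> \<in> admissible. var_y \<theta> \<le> c} \<noteq> {}"
    using admissible_standard \<open>c > 0\<close> by fastforce
  define b where "b = 4 * exp (- real n * (1 - r) * Psi (\<epsilon> / (2 * c) * (1 - r)))"
  have n: "real n > 0" using assms(2,4) by force
  have le_r: "real (model_size m) / real n \<le> r" if "m \<in> \<M>" for m
    unfolding r using assms(1) that by (intro cSUP_upper) auto
  \<comment> \<open>The supremum over a finite collection is attained, so \<open>r < 1\<close>
    follows from the size condition on a single model.\<close>
  have "r \<in> (\<lambda>m. real (model_size m) / real n) ` \<M>"
    unfolding r using assms(1,2) by (subst cSup_eq_Max) auto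
  then obtain m0 where "m0 \<in> \<M>" "r = real (model_size m0) / real n" by blast
  then have r1: "r < 1" using assms(4)[of m0] n by simp
  fix \<theta> assume "\<theta> \<in> {\<theta> \<in> admissible. var_y \<theta> \<le> c}"
  then have \<theta>: "\<theta> \<in> admissible" "var_y \<theta> \<le> c" by auto
  let ?S = "sample_law n \<theta>" and ?J = "joint_prob n \<theta>"
  have "\<exists>D. \<forall>m\<in>\<M>. D m \<in> sets ?S \<and> measure ?S (D m) \<le> b
      \<and> (AE \<omega> in ?J. \<bar>rho2_hat n (fst \<omega>) m - rho2 n \<theta> m \<omega>\<bar> > \<epsilon> \<longrightarrow> fst \<omega> \<in> D m)"
  proof (rule bchoice, rule ballI)
    fix m assume m: "m \<in> \<M>"
    obtain T U \<eta> s where "observed_coordinates m T U (card {j. m j}) \<eta> \<theta> s" and s: "s\<^sup>2 \<le> var_y \<theta>"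
      using exists_observed_coordinates[OF \<theta>(1) assms(3)[OF m]] by blast
    then interpret observed_coordinates m T U "card {j. m j}" \<eta> \<theta> s by simp
    have "card {j. m j} < n" using assms(4)[OF m] by (simp add: model_size_def)
    then show "\<exists>D. D \<in> sets ?S \<and> measure ?S D \<le> b
        \<and> (AE \<omega> in ?J. \<bar>rho2_hat n (fst \<omega>) m - rho2 n \<theta> m \<omega>\<bar> > \<epsilon> \<longrightarrow> fst \<omega> \<in> D)"
      using error_event[of n r \<epsilon> c] le_r[OF m] r1 \<open>\<epsilon> > 0\<close> \<open>c > 0\<close> s \<theta>(2)
      unfolding b_def by (auto simp: model_size_def)
  qed
  then obtain D where D: "\<And>m. m \<in> \<M> \<Longrightarrow> D m \<in> sets ?S" "\<And>m. m \<in> \<M> \<Longrightarrow> measure ?S (D m) \<le> b"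
    "\<And>m. m \<in> \<M> \<Longrightarrow> AE \<omega> in ?J. \<bar>rho2_hat n (fst \<omega>) m - rho2 n \<theta> m \<omega>\<bar> > \<epsilon> \<longrightarrow> fst \<omega> \<in> D m"
    by blast
  \<comment> \<open>Any model of the collection serves to show that \<open>joint_prob\<close> is a
    probability measure.\<close>
  obtain m1 where "m1 \<in> \<M>" using assms(2) by blast
  then obtain T U \<eta> s where "observed_coordinates m1 T U (card {j. m1 j}) \<eta> \<theta> s"
    using exists_observed_coordinates[OF \<theta>(1) assms(3)] by blast
  then interpret oc: observed_coordinates m1 T U "card {j. m1 j}" \<eta> \<theta> s .
  interpret J: prob_space ?J by (rule oc.prob_space_joint)
  let ?E = "{\<omega> \<in> space ?J. (SUP m\<in>\<M>. \<bar>rho2_hat n (fst \<omega>) m - rho2 n \<theta> m \<omega>\<bar>) > \<epsilon>}"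
  let ?C = "\<lambda>m. fst -` D m \<inter> space ?J"
  have fstJ: "fst \<in> ?J \<rightarrow>\<^sub>M ?S" unfolding joint_prob_def by (rule measurable_fst)
  have C: "?C m \<in> sets ?J" if "m \<in> \<M>" for m using fstJ D(1)[OF that] by (rule measurable_sets)
  \<comment> \<open>Outside a null set, a supremum above \<open>\<epsilon>\<close> puts the sample
    into some \<open>D m\<close>.\<close>
  have "measure ?J ?E \<le> measure ?J (\<Union>m\<in>\<M>. ?C m)"
  proof (rule J.finite_measure_mono_AE)
    have "AE \<omega> in ?J. \<forall>m\<in>\<M>. \<bar>rho2_hat n (fst \<omega>) m - rho2 n \<theta> m \<omega>\<bar> > \<epsilon> \<longrightarrow> fst \<omega> \<in> D m"
      using D(3) assms(1) by (simp add: AE_finite_all)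
    then show "AE \<omega> in ?J. \<omega> \<in> ?E \<longrightarrow> \<omega> \<in> (\<Union>m\<in>\<M>. ?C m)"
    proof eventually_elim
      case (elim \<omega>)
      have "\<exists>m\<in>\<M>. \<bar>rho2_hat n (fst \<omega>) m - rho2 n \<theta> m \<omega>\<bar> > \<epsilon>"
        if "(SUP m\<in>\<M>. \<bar>rho2_hat n (fst \<omega>) m - rho2 n \<theta> m \<omega>\<bar>) > \<epsilon>"
        using that assms(1,2) by (subst (asm) less_cSUP_iff) auto
      then show ?case using elim by blast
    qed
    show "(\<Union>m\<in>\<M>. ?C m) \<in> sets ?J" using assms(1) C by (intro sets.finite_UN) auto
  qed
  also have "\<dots> \<le> (\<Sum>m\<in>\<M>. measure ?J (?C m))"
    using assms(1) C by (intro J.finite_measure_subadditive_finite) auto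
  also have "\<dots> \<le> (\<Sum>m\<in>\<M>. b)"
  proof (rule sum_mono)
    fix m assume m: "m \<in> \<M>"
    have "distr ?J ?S fst = ?S"
      unfolding joint_prob_def by (rule prob_space.distr_pair_fst[OF oc.prob_obs])
    then have "measure ?J (?C m) = measure ?S (D m)"
      using measure_distr[OF fstJ D(1)[OF m]] by simp
    then show "measure ?J (?C m) \<le> b" using D(2)[OF m] by simp
  qed
  also have "\<dots> = 4 * real (card \<M>) * exp (- real n * (1 - r) * Psi (\<epsilon> / (2 * c) * (1 - r)))"
    by (simp add: b_def)
  finally show "\<P>(\<omega> in ?J. (SUP m\<in>\<M>. \<bar>rho2_hat n (fst \<omega>) m - rho2 n \<theta> m \<omega>\<bar>) > \<epsilon>)
    \<le> 4 * real (card \<M>) * exp (- real n * (1 - r) * Psi (\<epsilon> / (2 * c) * (1 - r)))" .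
qed

end
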